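(* Let $\mathcal{G}_P$ be the parallelogram bar-joint framework of a regular multigrid parallelogram tiling $P$ of $\mathbb{R}^2$ and let $\underline{a}$ be a basis for $\mathbb{R}^2$. Then the reduced slippage spectrum satisfies \[ \Omega^{\rm log}_{\rm slip}(\mathcal{G}_P,\underline{a}) = RF(P)^{\underline{a}}/\mathbb{Z}^2 , \] where $RF(P)$ is the ribbon figure of $P$.
   Context: Frameworks. A bar-joint framework $\mathcal{G}=(G,p)$ in $\mathbb{R}^2$ is a countable simple graph $G=(V,E)$ with a placement $p:V\to\mathbb{R}^2$ by distinct points (joints). It is a Delone framework if its set of joints is a Delone set (uniformly discrete and relatively dense) and the bar lengths $|p(v)-p(w)|$, $vw\in E$, are uniformly bounded. A velocity field is a map $u:p(V)\to\mathbb{C}^2$; it is an infinitesimal flex if $\langle u(p(v))-u(p(w)),p(v)-p(w)\rangle=0$ for all $vw\in E$. A line figure is a set of lines through the origin (identified with its union). Phase fields. For a basis $\underline{\bf t}=\{{\bf t_1},{\bf t_2}\}$ of $\mathbb{R}^2$ and $\lambda\in\mathbb{T}$ (the unit circle), the banded phase field $\phi_{(1,\lambda),\underline{\bf t}}:\mathbb{R}^2\to\mathbb{T}$ takes the value $\lambda^k$ on the band $\{s_1{\bf t_1}+s_2{\bf t_2}:s_1\in\mathbb{R},\,k\le s_2<k+1\}$, $k\in\mathbb{Z}$. For a scalar function $\phi$ on $\mathbb{R}^2$ and a velocity field $u$, the modulation $\phi\cdot u$ is the pointwise product. $\tau_b$ denotes the constant velocity field with value $b$. Closeness. Velocity fields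 $u,z$ on the set $J$ of joints are mostly $\epsilon$-close if there is $N_0$ such that for all $N\ge N_0$ and every translate $S$ of the square $[-N,N]^2$, $|\{p\in J\cap S:\|u(p)-z(p)\|_2>\epsilon\}|<\epsilon|J\cap S|$. Slippage. A line $H=\mathbb{R}{\bf t_1}$ is a periodic slippage line for a Delone framework $\mathcal{G}$ if there are a nonzero $b\in\mathbb{R}^2$ and a vector ${\bf t_2}$, with $\{{\bf t_1},{\bf t_2}\}$ a basis, such that for every $\epsilon>0$ there are an infinitesimal flex $u$ of $\mathcal{G}$ and a positive integer $M$ with: (i) $\phi_{(1,\lambda),\{{\bf t_1},M{\bf t_2}\}}\cdot u$ is an infinitesimal flex for all $\lambda\in\mathbb{T}$; (ii) $\phi_{(1,\lambda),\{{\bf t_1},M{\bf t_2}\}}\cdot u$ is mostly $\epsilon$-close to the restriction to the joints of $\phi_{(1,\lambda),\{{\bf t_1},M{\bf t_2}\}}\cdot\tau_b$ for all $\lambda\in\mathbb{T}$. The periodic slippage figure $PSF(\mathcal{G})$ is the union of the periodic slippage lines. Reciprocal figures and spectra. For a basis $\underline{a}=\{a_1,a_2\}$ of $\mathbb{R}^2$ and a line $H=\mathbb{R}(\alpha a_1+\beta a_2)$, the reciprocal line is $H^{\underline{a}}=\mathbb{R}(\beta,-\alpha)$ in the reciprocal space $\mathbb{R}^2_{\bf k}$ (a copy of $\mathbb{R}^2$ with standard basis). For a line figure $F$, $F^{\underline{a}}$ is the union of the lines $H^{\underline{a}}$, $H$ a line of $F$. The slippage spectrum is ${\bf L}_{\rm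 slip}(\mathcal{G},\underline{a})=PSF(\mathcal{G})^{\underline{a}}$, and the reduced slippage spectrum is $\Omega^{\rm log}_{\rm slip}(\mathcal{G},\underline{a})={\bf L}_{\rm slip}(\mathcal{G},\underline{a})/\mathbb{Z}^2$, the image in $[0,1)^2$ under reduction modulo $\mathbb{Z}^2$; $RF(P)^{\underline{a}}/\mathbb{Z}^2$ is understood in the same way. Multigrid tilings (de Bruijn, Beenker). A multigrid is a union of $r\ge2$ component grids, the $j$th consisting of the parallel lines $\{x:\langle x,n_j\rangle+\gamma_j=ks_j\}$, $k\in\mathbb{Z}$, with unit normals $n_j$ pairwise non-parallel, spacings $s_j>0$ and shifts $\gamma_j\in\mathbb{R}$. It is regular if no point lies on more than two of the lines. The associated parallelogram tiling $P$ is the dual tiling: fix edge vectors $d_j=\ell_jn_j$, $\ell_j>0$; each connected component of the complement of the multigrid gives a vertex $\sum_jK_j(x)d_j$, where $x$ is any point of the component and $K_j(x)=\lceil(\langle x,n_j\rangle+\gamma_j)/s_j\rceil$; components sharing a boundary segment on a line of the $j$th grid give vertices joined by an edge (a translate of $d_j$); and each intersection point of two grid lines gives a parallelogram tile. $\mathcal{G}_P$ is the bar-joint framework (a Delone framework) whose joints are the vertices of $P$ and whose bars are the edges of $P$. A ribbon of $P$ is a two-way infinite path of tiles, consecutive tiles sharing an edge, all the shared edges being translates of one another (these correspond to the lines of the multigrid). Each ribbon lies within a bounded distance of a unique line $H$ through the origin, and the ribbon figure $RF(P)$ is the union of the lines $H$ obtained in this way. *)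

theory Defs
  imports "HOL-Analysis.Analysis"
begin

definition is_basis :: "real^2 \<Rightarrow> real^2 \<Rightarrow> bool" where
  "is_basis a b \<longleftrightarrow> a \<noteq> b \<and> independent {a, b} \<and> span {a, b} = UNIV"

definition line_through_origin :: "(real^2) set \<Rightarrow> bool" where
  "line_through_origin H \<longleftrightarrow> (\<exists>t. t \<noteq> 0 \<and> H = span {t})"

record 'v framework =
  fverts :: "'v set"
  fedges :: "'v set set"
  placement :: "'v \<Rightarrow> real^2"

definition bar_joint_framework :: "'v framework \<Rightarrow> bool" where
  "bar_joint_framework G \<longleftrightarrow>
     countable (fverts G) \<and>
     (\<forall>e \<in> fedges G. \<exists>v \<in> fverts G. \<exists>w \<in> fverts G. v \<noteq> w \<and> e = {v, w}) \<and>
     inj_on (placement G) (fverts G)"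

definition joints :: "'v framework \<Rightarrow> (real^2) set" where
  "joints G = placement G ` fverts G"

definition delone_set :: "(real^2) set \<Rightarrow> bool" where
  "delone_set X \<longleftrightarrow>
     (\<exists>r>0. \<forall>x \<in> X. \<forall>y \<in> X. x \<noteq> y \<longrightarrow> r \<le> dist x y) \<and>
     (\<exists>R. \<forall>x. \<exists>y \<in> X. dist x y \<le> R)"

definition delone_framework :: "'v framework \<Rightarrow> bool" where
  "delone_framework G \<longleftrightarrow>
     bar_joint_framework G \<and> delone_set (joints G) \<and>
     (\<exists>B. \<forall>v w. {v, w} \<in> fedges G \<longrightarrow> dist (placement G v) (placement G w) \<le> B)"

text \<open>A velocity field is given by a total function; only its values on the joints matter.\<close>

type_synonym velocity_field = "real^2 \<Rightarrow> complex^2"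

definition infinitesimal_flex :: "'v framework \<Rightarrow> velocity_field \<Rightarrow> bool" where
  "infinitesimal_flex G u \<longleftrightarrow>
     (\<forall>v w. {v, w} \<in> fedges G \<longrightarrow>
        (\<Sum>i\<in>UNIV. (u (placement G v) - u (placement G w)) $ i *
           complex_of_real ((placement G v - placement G w) $ i)) = 0)"

definition constant_field :: "real^2 \<Rightarrow> velocity_field" where
  "constant_field b = (\<lambda>_. \<chi> i. complex_of_real (b $ i))"

definition modulation :: "(real^2 \<Rightarrow> complex) \<Rightarrow> velocity_field \<Rightarrow> velocity_field" where
  "modulation \<phi> u = (\<lambda>x. \<phi> x *s u x)"

definition banded_phase_field :: "complex \<Rightarrow> real^2 \<Rightarrow> real^2 \<Rightarrow> real^2 \<Rightarrow> complex" where
  "banded_phase_field lam t1 t2 x =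
     lam powi (THE k::int. \<exists>s1 s2::real. x = s1 *\<^sub>R t1 + s2 *\<^sub>R t2 \<and>
                  of_int k \<le> s2 \<and> s2 < of_int k + 1)"

definition mostly_close ::
    "(real^2) set \<Rightarrow> real \<Rightarrow> velocity_field \<Rightarrow> velocity_field \<Rightarrow> bool" where
  "mostly_close J \<epsilon> u z \<longleftrightarrow>
     (\<exists>N0::nat. \<forall>N\<ge>N0. \<forall>c::real^2.
        let S = (\<lambda>x. c + x) ` {x. \<forall>i. - real N \<le> x $ i \<and> x $ i \<le> real N} in
        real (card {x \<in> J \<inter> S. norm (u x - z x) > \<epsilon>}) < \<epsilon> * real (card (J \<inter> S)))"

definition periodic_slippage_line :: "'v framework \<Rightarrow> (real^2) set \<Rightarrow> bool" where
  "periodic_slippage_line G H \<longleftrightarrow>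
     delone_framework G \<and>
     (\<exists>t1 t2 b. H = span {t1} \<and> is_basis t1 t2 \<and> b \<noteq> 0 \<and>
       (\<forall>\<epsilon>>0. \<exists>u. \<exists>m::nat. infinitesimal_flex G u \<and> m > 0 \<and>
         (\<forall>lam. norm lam = 1 \<longrightarrow>
            infinitesimal_flex G (modulation (banded_phase_field lam t1 (real m *\<^sub>R t2)) u)) \<and>
         (\<forall>lam. norm lam = 1 \<longrightarrow>
            mostly_close (joints G) \<epsilon>
              (modulation (banded_phase_field lam t1 (real m *\<^sub>R t2)) u)
              (modulation (banded_phase_field lam t1 (real m *\<^sub>R t2)) (constant_field b)))))"

definition periodic_slippage_figure :: "'v framework \<Rightarrow> (real^2) set" where
  "periodic_slippage_figure G = \<Union> {H. periodic_slippage_line G H}"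

text \<open>The reciprocal line does not depend on the spanning vector chosen for \<open>H\<close>,
  so the union is over copies of a single line.\<close>

definition reciprocal_line :: "real^2 \<Rightarrow> real^2 \<Rightarrow> (real^2) set \<Rightarrow> (real^2) set" where
  "reciprocal_line a1 a2 H =
     \<Union> {span {vector [\<beta>, - \<alpha>]} | \<alpha> \<beta>. H = span {\<alpha> *\<^sub>R a1 + \<beta> *\<^sub>R a2}}"

text \<open>A line figure is identified with its union; the lines of the figure are recovered
  as the lines through the origin contained in it.\<close>

definition reciprocal_figure :: "real^2 \<Rightarrow> real^2 \<Rightarrow> (real^2) set \<Rightarrow> (real^2) set" where
  "reciprocal_figure a1 a2 F =
     \<Union> {reciprocal_line a1 a2 H | H. line_through_origin H \<and> H \<subseteq> F}"

definition reduce_mod_Z2 :: "(real^2) set \<Rightarrow> (real^2) set" where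
  "reduce_mod_Z2 L = (\<lambda>x. \<chi> i. frac (x $ i)) ` L"

definition slippage_spectrum :: "'v framework \<Rightarrow> real^2 \<Rightarrow> real^2 \<Rightarrow> (real^2) set" where
  "slippage_spectrum G a1 a2 = reciprocal_figure a1 a2 (periodic_slippage_figure G)"

definition reduced_slippage_spectrum :: "'v framework \<Rightarrow> real^2 \<Rightarrow> real^2 \<Rightarrow> (real^2) set" where
  "reduced_slippage_spectrum G a1 a2 = reduce_mod_Z2 (slippage_spectrum G a1 a2)"

text \<open>The component grids are indexed by \<open>j < num_grids M\<close>.\<close>

record multigrid =
  num_grids :: nat
  unit_normal :: "nat \<Rightarrow> real^2"
  spacing :: "nat \<Rightarrow> real"
  shift :: "nat \<Rightarrow> real"

definition is_multigrid :: "multigrid \<Rightarrow> bool" where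
  "is_multigrid M \<longleftrightarrow>
     num_grids M \<ge> 2 \<and>
     (\<forall>j<num_grids M. norm (unit_normal M j) = 1 \<and> spacing M j > 0) \<and>
     (\<forall>i<num_grids M. \<forall>j<num_grids M. i \<noteq> j \<longrightarrow>
        \<not> collinear {0, unit_normal M i, unit_normal M j})"

definition grid_line :: "multigrid \<Rightarrow> nat \<Rightarrow> int \<Rightarrow> (real^2) set" where
  "grid_line M j k = {x. x \<bullet> unit_normal M j + shift M j = of_int k * spacing M j}"

definition grid_lines :: "multigrid \<Rightarrow> (real^2) set set" where
  "grid_lines M = {grid_line M j k | j k. j < num_grids M}"

definition regular_multigrid :: "multigrid \<Rightarrow> bool" where
  "regular_multigrid M \<longleftrightarrow>
     is_multigrid M \<and>
     (\<forall>L1 \<in> grid_lines M. \<forall>L2 \<in> grid_lines M. \<forall>L3 \<in> grid_lines M.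
        L1 \<noteq> L2 \<and> L1 \<noteq> L3 \<and> L2 \<noteq> L3 \<longrightarrow> L1 \<inter> L2 \<inter> L3 = {})"

definition cells :: "multigrid \<Rightarrow> (real^2) set set" where
  "cells M = components (- \<Union> (grid_lines M))"

definition grid_index :: "multigrid \<Rightarrow> nat \<Rightarrow> real^2 \<Rightarrow> int" where
  "grid_index M j x = \<lceil>(x \<bullet> unit_normal M j + shift M j) / spacing M j\<rceil>"

text \<open>The grid indices are constant on each cell, so the choice of point is immaterial.
  The edge vectors are \<open>l j *\<^sub>R unit_normal M j\<close>.\<close>

definition cell_vertex :: "multigrid \<Rightarrow> (nat \<Rightarrow> real) \<Rightarrow> (real^2) set \<Rightarrow> real^2" where
  "cell_vertex M l C =
     (\<Sum>j<num_grids M. of_int (grid_index M j (SOME x. x \<in> C)) *\<^sub>R (l j *\<^sub>R unit_normal M j))"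

definition adjacent_cells :: "multigrid \<Rightarrow> (real^2) set \<Rightarrow> (real^2) set \<Rightarrow> bool" where
  "adjacent_cells M C D \<longleftrightarrow>
     C \<in> cells M \<and> D \<in> cells M \<and> C \<noteq> D \<and>
     (\<exists>L \<in> grid_lines M. \<exists>x y. x \<noteq> y \<and>
        closed_segment x y \<subseteq> L \<inter> frontier C \<inter> frontier D)"

text \<open>Edges are given by their pairs of end points, tiles as closed convex sets.\<close>

record tiling =
  tverts :: "(real^2) set"
  tedges :: "(real^2) set set"
  tiles :: "(real^2) set set"

text \<open>The tile of an intersection point \<open>x\<close> is spanned by the vertices of the
  cells that meet at \<open>x\<close>.\<close>

definition dual_tiling :: "multigrid \<Rightarrow> (nat \<Rightarrow> real) \<Rightarrow> tiling" where
  "dual_tiling M l =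
     \<lparr>tverts = cell_vertex M l ` cells M,
      tedges = {{cell_vertex M l C, cell_vertex M l D} | C D. adjacent_cells M C D},
      tiles = {convex hull (cell_vertex M l ` {C \<in> cells M. x \<in> closure C}) | x.
                 \<exists>L1 \<in> grid_lines M. \<exists>L2 \<in> grid_lines M. L1 \<noteq> L2 \<and> x \<in> L1 \<inter> L2}\<rparr>"

definition regular_multigrid_tiling :: "tiling \<Rightarrow> bool" where
  "regular_multigrid_tiling P \<longleftrightarrow>
     (\<exists>M l. regular_multigrid M \<and> (\<forall>j<num_grids M. l j > 0) \<and> P = dual_tiling M l)"

definition tiling_framework :: "tiling \<Rightarrow> (real^2) framework" where
  "tiling_framework P = \<lparr>fverts = tverts P, fedges = tedges P, placement = (\<lambda>x. x)\<rparr>"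

text \<open>Being a path, a ribbon does not revisit a tile. Consecutive tiles \<open>T i\<close> and
  \<open>T (i + 1)\<close> share the edge \<open>e i\<close>.\<close>

definition is_ribbon :: "tiling \<Rightarrow> (int \<Rightarrow> (real^2) set) \<Rightarrow> bool" where
  "is_ribbon P T \<longleftrightarrow>
     inj T \<and> range T \<subseteq> tiles P \<and>
     (\<exists>e. (\<forall>i. e i \<in> tedges P \<and>
               (convex hull (e i)) edge_of (T i) \<and> (convex hull (e i)) edge_of (T (i + 1))) \<and>
          (\<forall>i j. \<exists>c. e j = (\<lambda>x. c + x) ` e i))"

definition ribbon_figure :: "tiling \<Rightarrow> (real^2) set" where
  "ribbon_figure P =
     \<Union> {H. line_through_origin H \<and>
            (\<exists>T. is_ribbon P T \<and> (\<exists>R. \<forall>x \<in> \<Union> (range T). infdist x H \<le> R))}"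

end

theory Submission
  imports Defs
begin

text \<open>
  Both figures are the union of the lines \<open>H\<^sub>j\<close> spanned by \<open>A (perp n\<^sub>j)\<close>, where
  \<open>A = (\<Sum>j. (l\<^sub>j / s\<^sub>j) n\<^sub>j n\<^sub>j\<^sup>T)\<close> is the positive definite linear map that is at bounded distance
  from the map sending a point of the plane to the vertex of its cell.

  A joint determines the grid indices \<open>K\<^sub>j\<close> of its cell, so fields of the form
  \<open>g (K\<^sub>j) perp n\<^sub>j\<close> are flexes for every function \<open>g\<close>: an edge in direction \<open>n\<^sub>i\<close> changes only \<open>K\<^sub>i\<close>. Up to a
  bounded error \<open>K\<^sub>j\<close> is the coordinate transverse to \<open>H\<^sub>j\<close>, so letting \<open>g\<close> vanish near the band
  boundaries and be 1 elsewhere makes all banded modulations flexes, and the joints near the boundaries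
  have density \<open>O(1/m)\<close>.

  Conversely, for a slippage line \<open>H\<close> the restriction of the flex to a single band is again a flex.
  The jump of a flex across the edges of a ribbon is constant along the ribbon, because it is so in each
  parallelogram. If \<open>H\<close> were different from all the \<open>H\<^sub>j\<close>, then every ribbon would leave the band, so
  all jumps and hence the flex itself would vanish.
\<close>

subsection \<open>Plane geometry\<close>

text \<open>The obstacle is that joints belong to cells, while the argument moves along lines and
  through crossings. It is met by a local calculus: near a point \<open>q\<close> the index of each
  family in \<open>lines_at q\<close> either keeps its value or rises by one, and these choices are
  independent, since regularity leaves at most two normals at \<open>q\<close>. The cells, edge or
  parallelogram at \<open>q\<close> are thus described by subsets of \<open>lines_at q\<close>, and
  statements along a line or over the plane reduce to local constancy and connectedness.

  The map \<open>A\<close> comes from the vertex formula by dropping shifts and rounding; it carries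
  the direction of the grid lines to that of their ribbons. The velocity
  \<open>perp n\<^sub>j\<close> is orthogonal to exactly the edges across which
  \<open>K\<^sub>j\<close> changes, which is why it may jump there. The bands of a phase field are
  straight while the level sets of \<open>K\<^sub>j\<close> on the joints are not; this forces the
  field to be switched off near the boundaries. Conversely, a flex can be cut off to one band
  because some phase gives opposite factors to the two ends of a bar joining different
  bands.\<close>

definition perp :: "real^2 \<Rightarrow> real^2" where
  "perp v = vector [- v $ 2, v $ 1]"

lemma perp_nth [simp]: "perp v $ 1 = - v $ 2" "perp v $ 2 = v $ 1"
  by (auto simp: perp_def)

lemma inner_real2: "x \<bullet> y = x $ 1 * y $ 1 + x $ 2 * y $ (2::2)" for x y :: "real^2"
  by (simp add: inner_vec_def sum_2)

lemma eq_real2_iff: "x = y \<longleftrightarrow> x $ 1 = y $ 1 \<and> x $ 2 = y $ (2::2)"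
  by (simp add: vec_eq_iff forall_2)

lemma perp_inner_self [simp]: "perp v \<bullet> v = 0" "v \<bullet> perp v = 0"
  by (auto simp: inner_real2)

lemma perp_eq_0_iff [simp]: "perp v = 0 \<longleftrightarrow> v = 0"
  by (auto simp: eq_real2_iff)

lemma perp_swap: "perp b \<bullet> a = - (perp a \<bullet> b)"
  by (simp add: inner_real2)

text \<open>Cramer's rule without denominators. Here and below \<open>perp a \<bullet> b\<close> is
  the determinant of the pair, so that its being nonzero expresses linear independence.\<close>

lemma perp_coordinates:
  "(perp a \<bullet> b) *\<^sub>R x = (- (perp b \<bullet> x)) *\<^sub>R a + (perp a \<bullet> x) *\<^sub>R b"
  by (simp add: eq_real2_iff inner_real2 algebra_simps)

text \<open>Up to sign and the factor \<open>perp a \<bullet> b\<close>, the vectors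
  \<open>perp b\<close> and \<open>perp a\<close> form the basis dual to \<open>a, b\<close>; hence
  a vector is recovered from its two inner products.\<close>

lemma perp_dual_coordinates:
  "(perp a \<bullet> b) *\<^sub>R x = (x \<bullet> b) *\<^sub>R perp a - (x \<bullet> a) *\<^sub>R perp b"
  by (simp add: eq_real2_iff inner_real2 algebra_simps)

lemma inner_eq_0_imp_eq_0:
  assumes "perp a \<bullet> b \<noteq> 0" "x \<bullet> a = 0" "x \<bullet> b = 0"
  shows "x = 0"
  using perp_dual_coordinates[of a b x] assms by simp

lemma exists_inner_eq:
  assumes "perp a \<bullet> b \<noteq> 0"
  shows "\<exists>x. x \<bullet> a = \<alpha> \<and> x \<bullet> b = \<beta>"
proof (intro exI conjI)
  let ?x = "(1 / (perp a \<bullet> b)) *\<^sub>R (\<beta> *\<^sub>R perp a - \<alpha> *\<^sub>R perp b)"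
  show "?x \<bullet> a = \<alpha>" "?x \<bullet> b = \<beta>"
    using assms by (auto simp: inner_diff_left perp_swap[of b a])
qed

lemma perp_eq_0_imp_parallel:
  assumes "perp a \<bullet> b = 0" "a \<noteq> 0"
  shows "b = ((a \<bullet> b) / (a \<bullet> a)) *\<^sub>R a"
proof -
  \<comment> \<open>Expansion of \<open>b\<close> in the orthogonal basis
    \<open>a, perp a\<close>.\<close>
  have "(a \<bullet> a) *\<^sub>R b = (a \<bullet> b) *\<^sub>R a + (perp a \<bullet> b) *\<^sub>R perp a"
    by (simp add: eq_real2_iff inner_real2 algebra_simps)
  then have "(a \<bullet> a) *\<^sub>R b = (a \<bullet> b) *\<^sub>R a"
    using assms by simp
  then have "(1 / (a \<bullet> a)) *\<^sub>R (a \<bullet> a) *\<^sub>R b = (1 / (a \<bullet> a)) *\<^sub>R (a \<bullet> b) *\<^sub>R a"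
    by simp
  then show ?thesis
    using assms(2) by simp
qed

lemma not_collinear_imp_perp:
  assumes "\<not> collinear {0, a, b}"
  shows "perp a \<bullet> b \<noteq> 0"
  using assms perp_eq_0_imp_parallel[of a b] collinear_lemma[of a b] by metis

lemma is_basis_iff_perp: "is_basis a b \<longleftrightarrow> perp a \<bullet> b \<noteq> 0"
proof
  assume "is_basis a b"
  then have ne: "a \<noteq> b" and ind: "independent {a, b}"
    by (auto simp: is_basis_def)
  have "a \<noteq> 0"
    using ind dependent_zero by blast
  have "b \<notin> span {a}"
    using ind ne by (auto simp: independent_insert insert_commute[of a b])
  then show "perp a \<bullet> b \<noteq> 0"
    using perp_eq_0_imp_parallel[of a b] \<open>a \<noteq> 0\<close> by (metis span_mul span_base singletonI)
next
  assume p: "perp a \<bullet> b \<noteq> 0"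
  have ne: "a \<noteq> b"
    using p by auto
  have "span {a, b} = UNIV"
  proof -
    have "x \<in> span {a, b}" for x
    proof -
      have "x = (1 / (perp a \<bullet> b)) *\<^sub>R ((- (perp b \<bullet> x)) *\<^sub>R a + (perp a \<bullet> x) *\<^sub>R b)"
        unfolding perp_coordinates[symmetric] using p by simp
      also have "\<dots> \<in> span {a, b}"
        by (intro span_mul span_add) (auto intro: span_base)
      finally show ?thesis .
    qed
    then show ?thesis by auto
  qed
  moreover have "independent {a, b}"
  proof -
    have "b \<notin> span {}"
      using p by auto
    moreover have "a \<notin> span {b}"
    proof
      assume "a \<in> span {b}"
      then obtain c where "a = c *\<^sub>R b"
        by (auto simp: span_singleton)
      then show False
        using p by (simp add: inner_real2)
    qed
    ultimately show ?thesis
      by (simp add: independent_insert ne)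
  qed
  ultimately show "is_basis a b"
    using ne by (simp add: is_basis_def)
qed

text \<open>The coordinate functional along \<open>t2\<close> of the basis \<open>t1, t2\<close>.\<close>

definition transverse :: "real^2 \<Rightarrow> real^2 \<Rightarrow> real^2 \<Rightarrow> real" where
  "transverse t1 t2 x = (perp t1 \<bullet> x) / (perp t1 \<bullet> t2)"

text \<open>Coordinates in a basis are unique, so exactly one \<open>k\<close> satisfies the
  description inside \<open>THE\<close>, and the phase depends only on the floor of the second
  coordinate.\<close>

lemma banded_phase_field_eq:
  assumes "perp t1 \<bullet> t2 \<noteq> 0"
  shows "banded_phase_field lam t1 t2 x = lam powi \<lfloor>transverse t1 t2 x\<rfloor>"
proof -
  let ?D = "perp t1 \<bullet> t2"
  have "(\<exists>s1 s2. x = s1 *\<^sub>R t1 + s2 *\<^sub>R t2 \<and> of_int k \<le> s2 \<and> s2 < of_int k + 1) \<longleftrightarrow>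
        k = \<lfloor>transverse t1 t2 x\<rfloor>" for k
  proof
    assume "\<exists>s1 s2. x = s1 *\<^sub>R t1 + s2 *\<^sub>R t2 \<and> of_int k \<le> s2 \<and> s2 < of_int k + 1"
    then obtain s1 s2 where s: "x = s1 *\<^sub>R t1 + s2 *\<^sub>R t2" "of_int k \<le> s2" "s2 < of_int k + 1"
      by auto
    have "transverse t1 t2 x = s2"
      using assms by (simp add: s(1) transverse_def inner_add_right)
    then show "k = \<lfloor>transverse t1 t2 x\<rfloor>"
      using s floor_unique by blast
  next
    assume k: "k = \<lfloor>transverse t1 t2 x\<rfloor>"
    have "x = (1 / ?D) *\<^sub>R ?D *\<^sub>R x"
      using assms by simp
    also have "\<dots> = (- (perp t2 \<bullet> x) / ?D) *\<^sub>R t1 + transverse t1 t2 x *\<^sub>R t2"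
      unfolding perp_coordinates[of t1 t2 x] by (simp add: scaleR_diff_right transverse_def)
    finally show "\<exists>s1 s2. x = s1 *\<^sub>R t1 + s2 *\<^sub>R t2 \<and> of_int k \<le> s2 \<and> s2 < of_int k + 1"
      using k by (metis floor_correct of_int_add of_int_1)
  qed
  then show ?thesis
    by (simp add: banded_phase_field_def)
qed

lemma transverse_scale_right:
  "transverse t1 (c *\<^sub>R t2) x = transverse t1 t2 x / c"
  by (simp add: transverse_def)

lemma transverse_diff: "transverse t1 t2 x - transverse t1 t2 y = transverse t1 t2 (x - y)"
  by (simp add: transverse_def inner_diff_right diff_divide_distrib)

lemma transverse_bound:
  obtains L where "L \<ge> 0" "\<And>x. \<bar>transverse t1 t2 x\<bar> \<le> L * norm x"
proof
  show "norm (perp t1) / \<bar>perp t1 \<bullet> t2\<bar> \<ge> 0"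
    by simp
  show "\<bar>transverse t1 t2 x\<bar> \<le> norm (perp t1) / \<bar>perp t1 \<bullet> t2\<bar> * norm x" for x
    using divide_right_mono[OF Cauchy_Schwarz_ineq2[of "perp t1" x], of "\<bar>perp t1 \<bullet> t2\<bar>"]
    by (simp add: transverse_def)
qed

lemma transverse_decomp:
  assumes "perp t1 \<bullet> t2 \<noteq> 0"
  shows "x = transverse t2 t1 x *\<^sub>R t1 + transverse t1 t2 x *\<^sub>R t2"
proof -
  have "x = (1 / (perp t1 \<bullet> t2)) *\<^sub>R ((- (perp t2 \<bullet> x)) *\<^sub>R t1 + (perp t1 \<bullet> x) *\<^sub>R t2)"
    unfolding perp_coordinates[symmetric] using assms by simp
  also have "\<dots> = transverse t2 t1 x *\<^sub>R t1 + transverse t1 t2 x *\<^sub>R t2"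
    using perp_swap[of t2 t1] by (simp add: transverse_def scaleR_diff_right)
  finally show ?thesis .
qed

subsection \<open>Velocity fields\<close>

text \<open>The sum occurring in \<open>infinitesimal_flex\<close>: bilinear over the reals in the
  bar and complex linear in the velocity, without conjugation.\<close>

definition cdot :: "complex^2 \<Rightarrow> real^2 \<Rightarrow> complex" where
  "cdot z d = (\<Sum>i\<in>UNIV. z $ i * complex_of_real (d $ i))"

lemma cdot_eq: "cdot z d = z $ 1 * complex_of_real (d $ 1) + z $ 2 * complex_of_real (d $ 2)"
  by (simp add: cdot_def sum_2)

lemma cdot_zero_left: "cdot 0 d = 0"
  by (simp add: cdot_eq)

lemma cdot_diff_left: "cdot (y - z) d = cdot y d - cdot z d"
  by (simp add: cdot_eq algebra_simps)

lemma cdot_minus_right: "cdot z (- d) = - cdot z d"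
  by (simp add: cdot_eq algebra_simps)

lemma cdot_scale_left: "cdot (c *s z) d = c * cdot z d"
  by (simp add: cdot_eq algebra_simps)

lemma cdot_eq_0_imp_eq_0:
  assumes "perp a \<bullet> b \<noteq> 0" "cdot z a = 0" "cdot z b = 0"
  shows "z = 0"
proof -
  let ?D = "complex_of_real (perp a \<bullet> b)"
  have "?D * z $ 1 = complex_of_real (b $ 2) * cdot z a - complex_of_real (a $ 2) * cdot z b"
       "?D * z $ 2 = complex_of_real (a $ 1) * cdot z b - complex_of_real (b $ 1) * cdot z a"
    by (simp_all add: cdot_eq inner_real2 algebra_simps)
  then show ?thesis
    using assms by (simp add: vec_eq_iff forall_2)
qed

lemma infinitesimal_flex_tiling_iff:
  "infinitesimal_flex (tiling_framework P) u \<longleftrightarrow>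
   (\<forall>v w. {v, w} \<in> tedges P \<longrightarrow> cdot (u v - u w) (v - w) = 0)"
  by (simp add: infinitesimal_flex_def tiling_framework_def cdot_def)

lemma joints_tiling [simp]: "joints (tiling_framework P) = tverts P"
  by (simp add: joints_def tiling_framework_def)

lemma infinitesimal_flexD:
  assumes "infinitesimal_flex (tiling_framework P) u" "{v, w} \<in> tedges P"
  shows "cdot (u v) (v - w) = cdot (u w) (v - w)"
proof -
  have "cdot (u v - u w) (v - w) = 0"
    using assms unfolding infinitesimal_flex_tiling_iff by blast
  then show ?thesis
    by (simp add: cdot_diff_left)
qed

text \<open>Letting the phase vary decouples the two ends of a bar that joins different bands.\<close>

lemma flex_restrict_band:
  assumes u: "infinitesimal_flex (tiling_framework P) u"
    and mod: "\<And>lam. norm lam = 1 \<Longrightarrow> infinitesimal_flex (tiling_framework P) (modulation (\<lambda>x. lam powi (\<beta> x)) u)"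
  shows "infinitesimal_flex (tiling_framework P) (\<lambda>p. if \<beta> p = k then u p else 0)"
  unfolding infinitesimal_flex_tiling_iff
proof (intro allI impI)
  fix v w
  assume vw: "{v, w} \<in> tedges P"
  have uvw: "cdot (u v) (v - w) = cdot (u w) (v - w)"
    using infinitesimal_flexD[OF u vw] .
  show "cdot ((if \<beta> v = k then u v else 0) - (if \<beta> w = k then u w else 0)) (v - w) = 0"
  proof (cases "\<beta> v = \<beta> w")
    case True
    then show ?thesis
      using uvw by (simp add: cdot_diff_left)
  next
    case False
    \<comment> \<open>A root of -1 of order \<open>\<beta> v - \<beta> w\<close>, so the phases at
      the two ends are opposite. The bar equations of \<open>u\<close> and of its modulation then
      say that two numbers are both equal and opposite, so each end is separately orthogonal to the
      bar.\<close>
    define lam where "lam = cis (pi / of_int (\<beta> v - \<beta> w))"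
    have "lam powi \<beta> v = cis (pi + of_int (\<beta> w) * pi / of_int (\<beta> v - \<beta> w))"
    proof -
      have "of_int (\<beta> v) * (pi / of_int (\<beta> v - \<beta> w)) = pi + of_int (\<beta> w) * pi / of_int (\<beta> v - \<beta> w)"
        using False by (simp add: field_simps)
      then show ?thesis
        by (simp add: lam_def cis_power_int)
    qed
    then have opp: "lam powi \<beta> v = - (lam powi \<beta> w)"
      by (simp add: lam_def cis_power_int cis_mult[symmetric])
    have nz: "lam powi \<beta> w \<noteq> 0"
      by (simp add: lam_def)
    have "norm lam = 1"
      by (simp add: lam_def)
    then have "lam powi \<beta> v * cdot (u v) (v - w) = lam powi \<beta> w * cdot (u w) (v - w)"
      using infinitesimal_flexD[OF mod vw] by (simp add: modulation_def cdot_scale_left)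
    then have "cdot (u w) (v - w) = 0" "cdot (u v) (v - w) = 0"
      using uvw nz unfolding opp by auto
    then show ?thesis
      using False by (auto simp: cdot_diff_left cdot_zero_left)
  qed
qed

lemma complexify_eq_0_iff:
  "(\<chi> i. complex_of_real (b $ i)) = (0 :: complex^2) \<longleftrightarrow> b = (0 :: real^2)"
  by (simp add: vec_eq_iff)

subsection \<open>Counting points of a Delone set\<close>

text \<open>Written exactly like the square in \<open>mostly_close\<close>, so that unfolding both
  makes the counts coincide.\<close>

definition box_at :: "real^2 \<Rightarrow> nat \<Rightarrow> (real^2) set" where
  "box_at c N = (\<lambda>x. c + x) ` {x. \<forall>i. - real N \<le> x $ i \<and> x $ i \<le> real N}"

lemma mem_box_at_iff: "p \<in> box_at c N \<longleftrightarrow> (\<forall>i. \<bar>p $ i - c $ i\<bar> \<le> real N)"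
proof
  assume "p \<in> box_at c N"
  then show "\<forall>i. \<bar>p $ i - c $ i\<bar> \<le> real N"
    unfolding box_at_def by (auto simp: abs_le_iff minus_le_iff)
next
  assume p: "\<forall>i. \<bar>p $ i - c $ i\<bar> \<le> real N"
  have "p = c + (p - c)"
    by simp
  moreover have "\<forall>i. - real N \<le> (p - c) $ i \<and> (p - c) $ i \<le> real N"
    using p by (auto simp: abs_le_iff algebra_simps)
  ultimately show "p \<in> box_at c N"
    unfolding box_at_def by blast
qed

lemma norm_box_at: "p \<in> box_at c N \<Longrightarrow> norm (p - c) \<le> 2 * real N"
  using norm_le_l1_cart[of "p - c"] by (auto simp: mem_box_at_iff sum_2 forall_2)

lemma card_floor_interval:
  fixes x y :: real
  assumes "x \<le> y"
  shows "real (card {\<lfloor>x\<rfloor>..\<lfloor>y\<rfloor>}) \<le> y - x + 2"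
  using floor_mono[OF assms] by (simp add: of_nat_nat) linarith

text \<open>A skew grid of mesh \<open>1 / h\<close> has cells of diameter at most
  \<open>(norm t1 + norm t2) / h\<close>. Once this is below the separation of a point set, the two
  floors identify a point of the set.\<close>

lemma floor_coordinates_separate:
  assumes basis: "perp t1 \<bullet> t2 \<noteq> 0" and "\<rho> > 0"
  obtains h :: nat where "h > 0" "\<And>p q. \<lfloor>h * transverse t2 t1 p\<rfloor> = \<lfloor>h * transverse t2 t1 q\<rfloor> \<Longrightarrow>
    \<lfloor>h * transverse t1 t2 p\<rfloor> = \<lfloor>h * transverse t1 t2 q\<rfloor> \<Longrightarrow> dist p q < \<rho>"
proof -
  obtain h :: nat where h: "real h > (norm t1 + norm t2) / \<rho>"
    using reals_Archimedean2 by blast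
  have pos: "norm t1 + norm t2 > 0"
    using basis by (metis add_pos_nonneg inner_zero_right norm_ge_zero zero_less_norm_iff perp_eq_0_iff inner_zero_left)
  then have "(norm t1 + norm t2) / \<rho> > 0"
    using assms by simp
  then have h0: "h > 0"
    using h by (metis of_nat_0_less_iff less_trans)
  have "dist p q < \<rho>" if f: "\<lfloor>h * transverse t2 t1 p\<rfloor> = \<lfloor>h * transverse t2 t1 q\<rfloor>"
    "\<lfloor>h * transverse t1 t2 p\<rfloor> = \<lfloor>h * transverse t1 t2 q\<rfloor>" for p q
  proof -
    have "\<bar>real h * transverse t2 t1 p - h * transverse t2 t1 q\<bar> < 1"
      "\<bar>real h * transverse t1 t2 p - h * transverse t1 t2 q\<bar> < 1"
      using f by linarith+
    then have a: "\<bar>h * transverse t2 t1 (p - q)\<bar> < 1" "\<bar>h * transverse t1 t2 (p - q)\<bar> < 1"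
      by (auto simp: transverse_diff[symmetric] algebra_simps)
    have "h * dist p q = norm ((h * transverse t2 t1 (p - q)) *\<^sub>R t1 + (h * transverse t1 t2 (p - q)) *\<^sub>R t2)"
    proof -
      have "(h * transverse t2 t1 (p - q)) *\<^sub>R t1 + (h * transverse t1 t2 (p - q)) *\<^sub>R t2 = real h *\<^sub>R (p - q)"
        by (subst (3) transverse_decomp[OF basis]) (simp add: scaleR_add_right)
      then show ?thesis
        by (simp add: dist_norm)
    qed
    also have "\<dots> \<le> \<bar>h * transverse t2 t1 (p - q)\<bar> * norm t1 + \<bar>h * transverse t1 t2 (p - q)\<bar> * norm t2"
      by (metis norm_scaleR norm_triangle_ineq)
    also have "\<dots> \<le> 1 * norm t1 + 1 * norm t2"
      using a by (intro add_mono mult_right_mono) auto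
    also have "\<dots> < h * \<rho>"
      using h \<open>\<rho> > 0\<close> by (simp add: field_simps)
    finally show ?thesis
      using h0 by simp
  qed
  then show ?thesis
    using that h0 by blast
qed

text \<open>Each point is recorded by its band, its residue in the band, and two bounded coordinates; the
  bad residues contribute a factor independent of the period \<open>m\<close>.\<close>

lemma card_near_band_boundaries:
  fixes \<kappa> :: "real^2 \<Rightarrow> int" and C :: nat
  assumes basis: "perp t1 \<bullet> t2 \<noteq> 0" and "\<rho> > 0"
    and sep: "\<And>p q. p \<in> J \<Longrightarrow> q \<in> J \<Longrightarrow> p \<noteq> q \<Longrightarrow> \<rho> \<le> dist p q"
    and close: "\<And>p. p \<in> J \<Longrightarrow> \<bar>transverse t1 t2 p - of_int (\<kappa> p)\<bar> \<le> real C"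
  obtains c1 c2 :: real where "c1 \<ge> 0" "c2 \<ge> 0"
    "\<And>m N c. m > 0 \<Longrightarrow> N \<ge> 1 \<Longrightarrow>
      finite {p \<in> J \<inter> box_at c N. \<kappa> p mod int m < int C \<or> \<kappa> p mod int m \<ge> int m - int C} \<and>
      real (card {p \<in> J \<inter> box_at c N. \<kappa> p mod int m < int C \<or> \<kappa> p mod int m \<ge> int m - int C})
        \<le> (c1 * N / m + 2) * c2 * N"
proof -
  obtain h :: nat where h: "h > 0" "\<And>p q. \<lfloor>h * transverse t2 t1 p\<rfloor> = \<lfloor>h * transverse t2 t1 q\<rfloor> \<Longrightarrow>
    \<lfloor>h * transverse t1 t2 p\<rfloor> = \<lfloor>h * transverse t1 t2 q\<rfloor> \<Longrightarrow> dist p q < \<rho>"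
    using floor_coordinates_separate[OF basis \<open>\<rho> > 0\<close>] by blast
  obtain L where L: "L \<ge> 0" "\<And>x. \<bar>transverse t1 t2 x\<bar> \<le> L * norm x"
    using transverse_bound by blast
  obtain L' where L': "L' \<ge> 0" "\<And>x. \<bar>transverse t2 t1 x\<bar> \<le> L' * norm x"
    using transverse_bound by blast
  \<comment> \<open>Points of a box are within \<open>2 * N\<close> of its centre, so the band
    indices span at most \<open>c1 * N / m\<close>, up to rounding. The factors of \<open>c2\<close>
    count the residues within \<open>C\<close> of a boundary, the offsets caused by the error
    \<open>C\<close>, and, per unit of \<open>N\<close>, the cells along \<open>t1\<close>.\<close>
  define c1 where "c1 = 4 * L + 2 * C"
  define c2 where "c2 = 2 * C * (2 * h * C + 1) * (4 * h * L' + 2)"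
  have "c1 \<ge> 0" "c2 \<ge> 0"
    using L L' by (auto simp: c1_def c2_def)
  have bound: "finite B \<and> real (card B) \<le> (c1 * N / m + 2) * c2 * N"
    if mN: "m > 0" "N \<ge> 1"
      and B: "B = {p \<in> J \<inter> box_at c N. \<kappa> p mod int m < int C \<or> \<kappa> p mod int m \<ge> int m - int C}"
    for m N :: nat and c B
  proof -
    \<comment> \<open>The first two components determine \<open>\<kappa> p\<close>; adding
      \<open>h * \<kappa> p\<close> to the third restores the floor of the transverse coordinate, so
      \<open>F\<close> is injective on separated points. Subtracting it keeps the third component in
      a range that depends on neither \<open>N\<close> nor \<open>m\<close>.\<close>
    define F where "F p = (\<kappa> p div int m, \<kappa> p mod int m, \<lfloor>h * transverse t1 t2 p\<rfloor> - int h * \<kappa> p,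
      \<lfloor>h * transverse t2 t1 p\<rfloor>)" for p
    let ?b = "transverse t1 t2 c" and ?a = "transverse t2 t1 c"
    let ?A1 = "{\<lfloor>(?b - 2 * L * N - C) / m\<rfloor>..\<lfloor>(?b + 2 * L * N + C) / m\<rfloor>}"
    let ?A2 = "{0..<int C} \<union> {int m - int C..<int m}"
    let ?A3 = "{- (int h * int C)..int h * int C}"
    let ?A4 = "{\<lfloor>h * (?a - 2 * L' * N)\<rfloor>..\<lfloor>h * (?a + 2 * L' * N)\<rfloor>}"
    have inj: "inj_on F B"
    proof (rule inj_onI)
      fix p q
      assume pq: "p \<in> B" "q \<in> B" "F p = F q"
      then have "\<kappa> p = \<kappa> q"
        unfolding F_def by (metis Pair_inject div_mult_mod_eq)
      then have "dist p q < \<rho>"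
        using pq(3) by (intro h(2)) (auto simp: F_def)
      then show "p = q"
        using sep[of p q] pq B by force
    qed
    have sub: "F ` B \<subseteq> ?A1 \<times> ?A2 \<times> ?A3 \<times> ?A4"
    proof
      fix y
      assume "y \<in> F ` B"
      then obtain p where p: "y = F p" "p \<in> J" "p \<in> box_at c N"
        "\<kappa> p mod int m < int C \<or> \<kappa> p mod int m \<ge> int m - int C"
        using B by auto
      have nb: "norm (p - c) \<le> 2 * real N"
        using norm_box_at[OF p(3)] .
      have 1: "\<bar>transverse t1 t2 p - ?b\<bar> \<le> 2 * L * N"
        using L(2)[of "p - c"] mult_left_mono[OF nb L(1)] by (simp add: transverse_diff)
      have 2: "\<bar>transverse t2 t1 p - ?a\<bar> \<le> 2 * L' * N"
        using L'(2)[of "p - c"] mult_left_mono[OF nb L'(1)] by (simp add: transverse_diff)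
      have "(?b - 2 * L * N - C) / m \<le> of_int (\<kappa> p) / m" "of_int (\<kappa> p) / m \<le> (?b + 2 * L * N + C) / m"
        using 1 close[OF p(2)] mN by (auto intro!: divide_right_mono)
      moreover have "\<kappa> p div int m = \<lfloor>real_of_int (\<kappa> p) / real m\<rfloor>"
        using floor_divide_of_int_eq[of "\<kappa> p" "int m", where 'a = real] by simp
      ultimately have A1: "\<kappa> p div int m \<in> ?A1"
        by (simp add: floor_mono)
      have A2: "\<kappa> p mod int m \<in> ?A2"
        using p(4) mN by auto
      have A4: "\<lfloor>h * transverse t2 t1 p\<rfloor> \<in> ?A4"
        using 2 h(1) by (auto intro!: floor_mono mult_left_mono)
      have "\<lfloor>h * transverse t1 t2 p\<rfloor> - int h * \<kappa> p = \<lfloor>h * (transverse t1 t2 p - of_int (\<kappa> p))\<rfloor>"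
      proof -
        have "h * (transverse t1 t2 p - of_int (\<kappa> p)) = h * transverse t1 t2 p - of_int (int h * \<kappa> p)"
          by (simp add: algebra_simps)
        then show ?thesis
          by (metis floor_diff_of_int)
      qed
      moreover have "\<bar>h * (transverse t1 t2 p - of_int (\<kappa> p))\<bar> \<le> h * C"
        using mult_left_mono[OF close[OF p(2)], of "real h"] by (simp add: abs_mult)
      then have "of_int (- (int h * int C)) \<le> h * (transverse t1 t2 p - of_int (\<kappa> p))"
        "h * (transverse t1 t2 p - of_int (\<kappa> p)) \<le> of_int (int h * int C)"
        by (auto simp: abs_le_iff)
      then have "- (int h * int C) \<le> \<lfloor>h * (transverse t1 t2 p - of_int (\<kappa> p))\<rfloor>"
        "\<lfloor>h * (transverse t1 t2 p - of_int (\<kappa> p))\<rfloor> \<le> int h * int C"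
        using le_floor_iff floor_mono floor_of_int by metis+
      ultimately have A3: "\<lfloor>h * transverse t1 t2 p\<rfloor> - int h * \<kappa> p \<in> ?A3"
        by simp
      show "y \<in> ?A1 \<times> ?A2 \<times> ?A3 \<times> ?A4"
        using A1 A2 A3 A4 p(1) by (simp only: F_def mem_Times_iff fst_conv snd_conv)
    qed
    have fin: "finite (?A1 \<times> ?A2 \<times> ?A3 \<times> ?A4)"
      by auto
    have finB: "finite B"
      using finite_imageD[OF finite_subset[OF sub fin] inj] .
    have "card B \<le> card (?A1 \<times> ?A2 \<times> ?A3 \<times> ?A4)"
      using card_inj_on_le[OF inj sub fin] .
    then have "real (card B) \<le> real (card ?A1) * (real (card ?A2) * (real (card ?A3) * real (card ?A4)))"
      by (simp only: card_cartesian_product of_nat_mult[symmetric] of_nat_le_iff)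
    also have "\<dots> \<le> (c1 * N / m + 2) * ((2 * C) * ((2 * h * C + 1) * ((4 * h * L' + 2) * N)))"
    proof (intro mult_mono)
      have "real (card ?A1) \<le> (?b + 2 * L * N + C) / m - (?b - 2 * L * N - C) / m + 2"
        using mN L by (intro card_floor_interval divide_right_mono) auto
      also have "\<dots> = (4 * L * N + 2 * C) / m + 2"
        by (simp add: diff_divide_distrib[symmetric])
      also have "\<dots> \<le> (c1 * N) / m + 2"
        using mN mult_left_mono[of 1 "real N" "real C"]
        by (auto intro!: divide_right_mono simp: c1_def algebra_simps)
      finally show "real (card ?A1) \<le> c1 * N / m + 2" .
      have "card ?A2 \<le> card {0..<int C} + card {int m - int C..<int m}"
        by (rule card_Un_le)
      then show "real (card ?A2) \<le> real (2 * C)"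
        by simp
      show "real (card ?A3) \<le> real (2 * h * C + 1)"
        by simp
      have "real (card ?A4) \<le> h * (?a + 2 * L' * N) - h * (?a - 2 * L' * N) + 2"
        using L' by (intro card_floor_interval mult_left_mono) auto
      also have "\<dots> = 4 * h * L' * N + 2"
        by (simp add: algebra_simps)
      also have "\<dots> \<le> (4 * h * L' + 2) * N"
        using mN by (simp add: algebra_simps)
      finally show "real (card ?A4) \<le> (4 * h * L' + 2) * N" .
    qed (use \<open>c1 \<ge> 0\<close> L' in auto)
    also have "\<dots> = (c1 * N / m + 2) * c2 * N"
      by (simp add: c2_def algebra_simps)
    finally show ?thesis
      using finB by blast
  qed
  show ?thesis
    by (rule that[OF \<open>c1 \<ge> 0\<close> \<open>c2 \<ge> 0\<close> bound[OF _ _ refl]])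
qed

lemma finite_separated_box:
  assumes "\<rho> > 0" and sep: "\<And>p q. p \<in> J \<Longrightarrow> q \<in> J \<Longrightarrow> p \<noteq> q \<Longrightarrow> \<rho> \<le> dist p q"
  shows "finite (J \<inter> box_at c N)"
proof -
  have "bounded (box_at c N)"
    unfolding bounded_def using norm_box_at by (metis dist_norm norm_minus_commute)
  then have "compact (closure (box_at c N))"
    by (simp add: compact_closure)
  then have "finite (closure (box_at c N) \<inter> J)"
  proof (rule finite_not_islimpt_in_compact)
    show "\<not> z islimpt J" for z
    proof
      assume "z islimpt J"
      then have "infinite (J \<inter> ball z (\<rho> / 2))"
        using \<open>\<rho> > 0\<close> by (simp add: islimpt_eq_infinite_ball)
      then obtain p q where "p \<in> J \<inter> ball z (\<rho> / 2)" "q \<in> J \<inter> ball z (\<rho> / 2)" "p \<noteq> q"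
        by (metis finite.emptyI finite_insert finite_subset insertI1 subsetI ex_in_conv singletonD insert_iff)
      then show False
        using sep[of p q] dist_triangle_half_r[of z p \<rho> q] by (auto simp: dist_commute)
    qed
  qed
  then show ?thesis
    by (rule finite_subset[rotated]) (use closure_subset in auto)
qed

text \<open>A square lattice of spacing \<open>4 * D\<close> fills one quadrant of the box. Each
  lattice point has a point of \<open>J\<close> within \<open>D\<close>; the spacing keeps these
  points distinct.\<close>

lemma card_dense_box:
  assumes dense: "\<And>z. \<exists>p\<in>J. dist z p \<le> R" and fin: "\<And>c N. finite (J \<inter> box_at c N)"
  obtains c3 :: real and N1 :: nat where "c3 > 0" "\<And>N c. N \<ge> N1 \<Longrightarrow> real (card (J \<inter> box_at c N)) \<ge> c3 * real N ^ 2"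
proof -
  obtain D :: nat where D: "D > 0" "R \<le> real D"
  proof -
    obtain D :: nat where "R \<le> real D"
      using real_arch_simple by blast
    then show ?thesis
      using that[of "Suc D"] by simp
  qed
  have dense': "\<exists>p\<in>J. dist z p \<le> real D" for z
    using dense[of z] D by force
  \<comment> \<open>From \<open>8 * D \<le> N\<close> the number \<open>k\<close> of lattice points
    per side is at least \<open>N / (8 * D)\<close>; its square gives the 64.\<close>
  have "real (card (J \<inter> box_at c N)) \<ge> (1 / (64 * real D ^ 2)) * real N ^ 2" if N: "N \<ge> 8 * D" for N c
  proof -
    define k where "k = N div (4 * D)"
    define z where "z ab = c + vector [4 * D * real (fst ab), 4 * D * real (snd ab)]" for ab :: "nat \<times> nat"
    have "\<forall>ab. \<exists>p. p \<in> J \<and> dist (z ab) p \<le> D"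
      using dense' by blast
    from choice[OF this] obtain f where f: "\<And>ab. f ab \<in> J" "\<And>ab. dist (z ab) (f ab) \<le> D"
      by blast
    have comp: "\<bar>z ab $ i - f ab $ i\<bar> \<le> D" for ab i
      using f(2)[of ab] component_le_norm_cart[of "z ab - f ab" i] by (simp add: dist_norm)
    have z12: "z ab $ 1 = c $ 1 + 4 * D * real (fst ab)" "z ab $ 2 = c $ 2 + 4 * D * real (snd ab)" for ab
      by (auto simp: z_def)
    have inj: "inj_on f ({..<k} \<times> {..<k})"
    proof (rule inj_onI)
      fix x y
      assume "f x = f y"
      then have d: "\<bar>z x $ i - z y $ i\<bar> \<le> 2 * D" for i
        using comp[of x i] comp[of y i] by simp
      have e: "a = b" if ab: "\<bar>4 * real D * real a - 4 * D * real b\<bar> \<le> 2 * D" for a b :: nat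
      proof -
        have "4 * real D * \<bar>real a - real b\<bar> \<le> 2 * D"
          using ab D(1) by (simp add: right_diff_distrib[symmetric] abs_mult)
        then have "\<bar>real a - real b\<bar> < 1"
          using D(1) by (simp add: field_simps)
        then show ?thesis
          by linarith
      qed
      show "x = y"
        using e[of "fst x" "fst y"] e[of "snd x" "snd y"] d[of 1] d[of 2] by (auto simp: z12 prod_eq_iff)
    qed
    have sub: "f ` ({..<k} \<times> {..<k}) \<subseteq> J \<inter> box_at c N"
    proof
      fix p
      assume "p \<in> f ` ({..<k} \<times> {..<k})"
      then obtain a b where ab: "a < k" "b < k" "p = f (a, b)"
        by auto
      have bound: "4 * D * real x + D \<le> N" if "x < k" for x
      proof -
        have "4 * D * (x + 1) \<le> 4 * D * k"
          using that by (intro mult_left_mono) auto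
        also have "\<dots> \<le> N"
          by (simp add: k_def)
        finally have "4 * D * x + D \<le> N"
          by (simp add: algebra_simps)
        then show ?thesis
          by (metis (mono_tags, lifting) of_nat_add of_nat_le_iff of_nat_mult of_nat_numeral)
      qed
      have "\<bar>p $ 1 - c $ 1\<bar> \<le> N" "\<bar>p $ 2 - c $ 2\<bar> \<le> N"
        using comp[of "(a, b)" 1] comp[of "(a, b)" 2] bound[OF ab(1)] bound[OF ab(2)]
        by (auto simp: z12 ab(3) abs_le_iff) (smt (verit) mult_nonneg_nonneg of_nat_0_le_iff)+
      then show "p \<in> J \<inter> box_at c N"
        using ab f(1) by (auto simp: mem_box_at_iff forall_2)
    qed
    have "card ({..<k} \<times> {..<k}) \<le> card (J \<inter> box_at c N)"
      using card_inj_on_le[OF inj sub fin] .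
    then have 1: "real k * real k \<le> real (card (J \<inter> box_at c N))"
      by (simp add: card_cartesian_product of_nat_mult[symmetric] del: of_nat_mult)
    have "N < 4 * D * (k + 1)"
      using D(1) by (simp add: k_def) (metis add.commute dividend_less_div_times mult.commute nat_0_less_mult_iff zero_less_numeral)
    then have "real N < 4 * D * (real k + 1)"
      by (metis (mono_tags, lifting) of_nat_1 of_nat_add of_nat_less_iff of_nat_mult of_nat_numeral)
    moreover have "8 * real D \<le> N"
      using N by linarith
    ultimately have "real N \<le> 8 * D * real k"
      by (simp add: algebra_simps)
    then have "real N / (8 * D) \<le> k"
      using D(1) by (simp add: field_simps)
    then have "(real N / (8 * D))\<^sup>2 \<le> real k * real k"
      using power_mono[of "real N / (8 * D)" "real k" 2] by (simp add: power2_eq_square)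
    then show ?thesis
      using 1 by (simp add: power_divide power_mult_distrib)
  qed
  moreover have "1 / (64 * real D ^ 2) > 0"
    using D by simp
  ultimately show ?thesis
    using that by blast
qed

subsection \<open>Connectedness, reals and lines\<close>

text \<open>No control is assumed on \<open>g\<close> outside \<open>X\<close>. The value that
  \<open>g\<close> takes on \<open>X\<close> near \<open>s\<close> defines a function
  \<open>h\<close> of all \<open>s\<close>; density of \<open>X\<close> makes \<open>h\<close> well
  determined and locally constant, so connectedness applies to \<open>h\<close> instead. In the
  applications \<open>X\<close> leaves out the points on too many grid lines.\<close>

lemma densely_locally_constant_imp_constant:
  fixes g :: "'a::topological_space \<Rightarrow> 'b"
  assumes conn: "connected (UNIV :: 'a set)"
    and dense: "\<And>s. \<exists>\<^sub>F y in nhds s. y \<in> X"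
    and const: "\<And>s. \<exists>c. \<forall>\<^sub>F y in nhds s. y \<in> X \<longrightarrow> g y = c"
    and "a \<in> X" "b \<in> X"
  shows "g a = g b"
proof -
  obtain h where h: "\<And>s. \<forall>\<^sub>F y in nhds s. y \<in> X \<longrightarrow> g y = h s"
    using const by metis
  have gh: "g x = h x" if "x \<in> X" for x
    using eventually_nhds_x_imp_x[OF h[of x]] that by simp
  have "h a = h b"
  proof (rule connected_local_const[OF conn])
    show "\<forall>s\<in>UNIV. \<forall>\<^sub>F t in at s within UNIV. h s = h t"
    proof
      fix s
      have "\<forall>\<^sub>F t in nhds s. \<forall>\<^sub>F y in nhds t. y \<in> X \<longrightarrow> g y = h s"
        using h[of s] by (simp add: eventually_eventually)
      then have "\<forall>\<^sub>F t in nhds s. h s = h t"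
      proof (rule eventually_mono)
        fix t
        assume "\<forall>\<^sub>F y in nhds t. y \<in> X \<longrightarrow> g y = h s"
        with h[of t] have "\<forall>\<^sub>F y in nhds t. y \<in> X \<longrightarrow> h s = h t"
          by eventually_elim auto
        then have "\<exists>\<^sub>F y in nhds t. h s = h t"
          using dense[of t] by (rule frequently_rev_mp[rotated])
        then show "h s = h t"
          by (metis frequently_const_iff)
      qed
      then show "\<forall>\<^sub>F t in at s within UNIV. h s = h t"
        by (auto simp: eventually_at_filter elim: eventually_mono)
    qed
  qed auto
  then show ?thesis
    using gh assms by simp
qed

lemma not_Ints_between:
  fixes y :: real
  assumes "of_int k - 1 < y" "y < of_int k"
  shows "y \<notin> \<int>"
proof
  assume "y \<in> \<int>"
  then obtain a where "y = of_int a"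
    by (rule Ints_cases)
  then have "k - 1 < a" "a < k"
    using assms by linarith+
  then show False by simp
qed

lemma span_eq_of_perp:
  assumes "perp h \<bullet> v = 0" "h \<noteq> 0" "v \<noteq> 0"
  shows "span {h} = span {v}"
proof -
  have "v \<in> span {h}"
    using perp_eq_0_imp_parallel[OF assms(1,2)] by (metis span_base span_mul singletonI)
  moreover have "perp v \<bullet> h = 0"
    using assms(1) perp_swap[of v h] by simp
  then have "h \<in> span {v}"
    using perp_eq_0_imp_parallel[of v h] assms(3) by (metis span_base span_mul singletonI)
  ultimately show ?thesis
    by (intro subset_antisym span_minimal) auto
qed

lemma unbounded_affine_bounded_imp_slope_0:
  fixes a b c :: real
  assumes "\<And>D. \<exists>s\<in>S. \<bar>s\<bar> > D" "\<And>s. s \<in> S \<Longrightarrow> \<bar>a + s * b\<bar> \<le> c"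
  shows "b = 0"
proof (rule ccontr)
  assume "b \<noteq> 0"
  obtain s where s: "s \<in> S" "\<bar>s\<bar> > (c + \<bar>a\<bar>) / \<bar>b\<bar>"
    using assms(1) by blast
  then have "\<bar>s * b\<bar> > c + \<bar>a\<bar>"
    using \<open>b \<noteq> 0\<close> by (simp add: field_simps abs_mult)
  then show False
    using assms(2)[OF s(1)] by linarith
qed

text \<open>Finiteness on bounded intervals gives every real a next and a previous element of
  \<open>X\<close>. Iterating both from one element produces a two-sided sequence, as the index set
  of a ribbon requires.\<close>

lemma consecutive_enumeration:
  fixes X :: "real set"
  assumes fin: "\<And>a b. finite (X \<inter> {a..b})"
    and above: "\<And>a. \<exists>x\<in>X. x > a" and below: "\<And>a. \<exists>x\<in>X. x < a"
  obtains f :: "int \<Rightarrow> real" where "\<And>i. f i \<in> X" "\<And>i. f i < f (i + 1)"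
    "\<And>i t. f i < t \<Longrightarrow> t < f (i + 1) \<Longrightarrow> t \<notin> X"
proof -
  have "\<exists>t. t \<in> X \<and> s < t \<and> (\<forall>u. s < u \<longrightarrow> u < t \<longrightarrow> u \<notin> X)" for s
  proof -
    obtain x where x: "x \<in> X" "x > s"
      using above by blast
    let ?S = "X \<inter> {s<..x}"
    have "finite ?S"
      by (rule finite_subset[OF _ fin[of s x]]) auto
    moreover have "?S \<noteq> {}"
      using x by auto
    ultimately have m: "Min ?S \<in> ?S" "\<And>u. u \<in> ?S \<Longrightarrow> Min ?S \<le> u"
      using Min_in by (blast, simp)
    show ?thesis
    proof (intro exI[of _ "Min ?S"] conjI allI impI notI)
      fix u
      assume u: "u \<in> X" "s < u" "u < Min ?S"
      then have "u \<in> ?S"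
        using m(1) by auto
      then show False
        using m(2)[of u] u by simp
    qed (use m(1) in auto)
  qed
  then obtain nxt where nxt: "\<And>s. nxt s \<in> X" "\<And>s. s < nxt s" "\<And>s u. s < u \<Longrightarrow> u < nxt s \<Longrightarrow> u \<notin> X"
    by metis
  have "\<exists>t. t \<in> X \<and> t < s \<and> (\<forall>u. t < u \<longrightarrow> u < s \<longrightarrow> u \<notin> X)" for s
  proof -
    obtain x where x: "x \<in> X" "x < s"
      using below by blast
    let ?S = "X \<inter> {x..<s}"
    have "finite ?S"
      by (rule finite_subset[OF _ fin[of x s]]) auto
    moreover have "?S \<noteq> {}"
      using x by auto
    ultimately have m: "Max ?S \<in> ?S" "\<And>u. u \<in> ?S \<Longrightarrow> u \<le> Max ?S"
      using Max_in by (blast, simp)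
    show ?thesis
    proof (intro exI[of _ "Max ?S"] conjI allI impI notI)
      fix u
      assume u: "u \<in> X" "Max ?S < u" "u < s"
      then have "u \<in> ?S"
        using m(1) by auto
      then show False
        using m(2)[of u] u by simp
    qed (use m(1) in auto)
  qed
  then obtain prv where prv: "\<And>s. prv s \<in> X" "\<And>s. prv s < s" "\<And>s u. prv s < u \<Longrightarrow> u < s \<Longrightarrow> u \<notin> X"
    by metis
  obtain s0 where s0: "s0 \<in> X"
    using above by blast
  define f where "f i = (if i \<ge> 0 then (nxt ^^ nat i) s0 else (prv ^^ nat (- i)) s0)" for i :: int
  have pos: "f (i + 1) = nxt (f i)" if "i \<ge> 0" for i
  proof -
    have "nat (i + 1) = Suc (nat i)"
      using that by simp
    then show ?thesis
      using that by (simp add: f_def)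
  qed
  have neg: "f i = prv (f (i + 1))" if "i < 0" for i
  proof -
    have "nat (- i) = Suc (nat (- (i + 1)))"
      using that by simp
    moreover have "f (i + 1) = (prv ^^ nat (- (i + 1))) s0"
      using that by (cases "i = -1") (auto simp: f_def)
    ultimately show ?thesis
      using that by (simp add: f_def)
  qed
  have mem: "f i \<in> X" for i
  proof (cases "i < 0")
    case True
    then show ?thesis
      using neg prv(1) by simp
  next
    case False
    then show ?thesis
      using pos[of "i - 1"] nxt(1) s0 by (cases "i = 0") (auto simp: f_def)
  qed
  have "f i < f (i + 1) \<and> (\<forall>t. f i < t \<longrightarrow> t < f (i + 1) \<longrightarrow> t \<notin> X)" for i
  proof (cases "i < 0")
    case True
    then show ?thesis
      using neg[of i] prv(2)[of "f (i + 1)"] prv(3)[of "f (i + 1)"] by simp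
  next
    case False
    then show ?thesis
      using pos[of i] nxt(2)[of "f i"] nxt(3)[of "f i"] by simp
  qed
  then show ?thesis
    using mem that by blast
qed

lemma strict_mono_int_stepI:
  fixes c :: "int \<Rightarrow> real"
  assumes "\<And>a. c a < c (a + 1)" "a < b"
  shows "c a < c b"
  using assms(2)
proof (induction b rule: int_gr_induct)
  case (step i)
  then show ?case
    using assms(1)[of i] by linarith
qed (use assms(1) in auto)

lemma exists_int_div_gt:
  fixes c a :: real
  assumes "c \<noteq> 0"
  shows "\<exists>m::int. of_int m / c > a"
proof (cases "c > 0")
  case True
  obtain m :: int where "a * c < of_int m"
    using ex_less_of_int by blast
  then show ?thesis
    using True by (intro exI[of _ m]) (simp add: field_simps)
next
  case False
  obtain m :: int where "of_int m < a * c"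
    using ex_of_int_less by blast
  then show ?thesis
    using False assms by (intro exI[of _ m]) (simp add: field_simps)
qed

text \<open>The functional vanishes on the line, so only the difference from the nearest point of
  the line contributes.\<close>

lemma inner_perp_infdist_span:
  assumes "infdist v (span {h}) \<le> R"
  shows "\<bar>perp h \<bullet> v\<bar> \<le> norm (perp h) * R"
proof -
  obtain y where y: "y \<in> span {h}" "infdist v (span {h}) = dist v y"
    using infdist_attains_inf[of "span {h}" v] closed_subspace[OF subspace_span] span_zero by blast
  then obtain c where "y = c *\<^sub>R h"
    by (auto simp: span_singleton)
  then have "perp h \<bullet> v = perp h \<bullet> (v - y)"
    by (simp add: inner_diff_right)
  then have "\<bar>perp h \<bullet> v\<bar> \<le> norm (perp h) * norm (v - y)"
    using Cauchy_Schwarz_ineq2 by metis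
  also have "\<dots> \<le> norm (perp h) * R"
    using assms y by (intro mult_left_mono) (auto simp: dist_norm)
  finally show ?thesis .
qed

subsection \<open>Grid indices\<close>

locale multigrid_dual =
  fixes M :: multigrid and l :: "nat \<Rightarrow> real"
  assumes regular: "regular_multigrid M"
    and length_pos: "\<And>j. j < num_grids M \<Longrightarrow> l j > 0"
begin

abbreviation r :: nat where "r \<equiv> num_grids M"
abbreviation n :: "nat \<Rightarrow> real^2" where "n \<equiv> unit_normal M"
abbreviation K :: "nat \<Rightarrow> real^2 \<Rightarrow> int" where "K \<equiv> grid_index M"

text \<open>Normalised so that the lines of the \<open>j\<close>th grid are the level sets at the
  integers and the index \<open>K\<close> is the ceiling.\<close>

definition height :: "nat \<Rightarrow> real^2 \<Rightarrow> real" where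
  "height j x = (x \<bullet> n j + shift M j) / spacing M j"

definition edge_vec :: "nat \<Rightarrow> real^2" where
  "edge_vec j = l j *\<^sub>R n j"

text \<open>Since the grid index is a ceiling, a point on some grid lines is assigned the vertex of the
  adjacent cell that lies below all of these lines. So every point of the plane has a vertex.\<close>

definition vertex_at :: "real^2 \<Rightarrow> real^2" where
  "vertex_at x = (\<Sum>j<r. of_int (K j x) *\<^sub>R edge_vec j)"

definition lines_at :: "real^2 \<Rightarrow> nat set" where
  "lines_at x = {j. j < r \<and> height j x \<in> \<int>}"

text \<open>A cell described by its indices instead of by connectedness. It is the component of
  \<open>x\<close> when \<open>x\<close> lies on no grid line; otherwise \<open>x\<close> is not one
  of its elements.\<close>

definition cell_of :: "real^2 \<Rightarrow> (real^2) set" where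
  "cell_of x = {y. lines_at y = {} \<and> (\<forall>j<r. K j y = K j x)}"

lemma r_ge_2: "r \<ge> 2"
  and norm_n [simp]: "j < r \<Longrightarrow> norm (n j) = 1"
  and spacing_pos: "j < r \<Longrightarrow> spacing M j > 0"
  and perp_n: "i < r \<Longrightarrow> j < r \<Longrightarrow> i \<noteq> j \<Longrightarrow> perp (n i) \<bullet> n j \<noteq> 0"
  using regular not_collinear_imp_perp by (auto simp: regular_multigrid_def is_multigrid_def)

lemma spacing_nonzero [simp]: "j < r \<Longrightarrow> spacing M j \<noteq> 0"
  using spacing_pos[of j] by auto

lemma n_nonzero [simp]: "j < r \<Longrightarrow> n j \<noteq> 0"
  using norm_n by fastforce

lemma inner_n_self [simp]: "j < r \<Longrightarrow> n j \<bullet> n j = 1"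
  by (simp add: dot_square_norm)

lemma edge_vec_nonzero: "j < r \<Longrightarrow> edge_vec j \<noteq> 0"
  using length_pos[of j] by (simp add: edge_vec_def)

lemma perp_edge_vec:
  assumes "i < r" "j < r" "i \<noteq> j"
  shows "perp (edge_vec i) \<bullet> edge_vec j \<noteq> 0"
proof -
  have "perp (edge_vec i) \<bullet> edge_vec j = l i * l j * (perp (n i) \<bullet> n j)"
    by (simp add: edge_vec_def inner_real2 algebra_simps)
  then show ?thesis
    using assms perp_n[of i j] length_pos[of i] length_pos[of j] by simp
qed

lemma K_eq: "K j x = \<lceil>height j x\<rceil>"
  by (simp add: grid_index_def height_def)

lemma height_add: "height j (x + y) = height j x + (y \<bullet> n j) / spacing M j"
  by (simp add: height_def inner_add_left add_divide_distrib)

lemma height_diff: "height j x - height j y = ((x - y) \<bullet> n j) / spacing M j"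
  by (simp add: height_def inner_diff_left add_divide_distrib diff_divide_distrib)

lemma continuous_height [continuous_intros]: "continuous_on S (height j)"
  unfolding height_def divide_inverse by (intro continuous_intros)

lemma mem_grid_line_iff: "j < r \<Longrightarrow> x \<in> grid_line M j k \<longleftrightarrow> height j x = of_int k"
  using spacing_pos[of j] by (auto simp: grid_line_def height_def field_simps)

lemma mem_Union_grid_lines_iff: "x \<in> \<Union> (grid_lines M) \<longleftrightarrow> lines_at x \<noteq> {}"
proof -
  have "x \<in> \<Union> (grid_lines M) \<longleftrightarrow> (\<exists>j<r. \<exists>k. x \<in> grid_line M j k)"
    unfolding grid_lines_def by blast
  also have "\<dots> \<longleftrightarrow> (\<exists>j<r. height j x \<in> \<int>)"
    by (auto simp: mem_grid_line_iff elim!: Ints_cases)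
  finally show ?thesis
    by (auto simp: lines_at_def)
qed

lemma lines_at_less: "j \<in> lines_at x \<Longrightarrow> j < r"
  by (simp add: lines_at_def)

lemma heights_unique:
  assumes "i < r" "j < r" "i \<noteq> j" "height i x = height i y" "height j x = height j y"
  shows "x = y"
proof -
  have "(x - y) \<bullet> n i = 0" "(x - y) \<bullet> n j = 0"
    using height_diff[of i x y] height_diff[of j x y] assms spacing_pos[of i] spacing_pos[of j]
    by auto
  then show ?thesis
    using inner_eq_0_imp_eq_0[OF perp_n[OF assms(1-3)], of "x - y"] by simp
qed

lemma exists_heights:
  assumes "i < r" "j < r" "i \<noteq> j"
  shows "\<exists>x. height i x = a \<and> height j x = b"
proof -
  obtain x where "x \<bullet> n i = a * spacing M i - shift M i" "x \<bullet> n j = b * spacing M j - shift M j"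
    using exists_inner_eq[OF perp_n[OF assms]] by metis
  then show ?thesis
    using assms spacing_pos[of i] spacing_pos[of j] by (intro exI[of _ x]) (auto simp: height_def)
qed

text \<open>Regularity compares lines as sets. A point at integer height for \<open>i\<close> and
  half-integer height for \<open>j\<close> tells the two sets apart.\<close>

lemma grid_line_neq:
  assumes "i < r" "j < r" "i \<noteq> j"
  shows "grid_line M i a \<noteq> grid_line M j b"
proof -
  obtain x where "height i x = of_int a" "height j x = of_int b + 1/2"
    using exists_heights[OF assms] by metis
  then have "x \<in> grid_line M i a" "x \<notin> grid_line M j b"
    using assms by (auto simp: mem_grid_line_iff)
  then show ?thesis by blast
qed

text \<open>Three families through \<open>x\<close> would give three distinct lines with a common
  point, contrary to regularity. Lines of one family are disjoint, so it is enough to count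
  families.\<close>

lemma lines_at_cases:
  obtains "lines_at x = {}" | j where "lines_at x = {j}" | i j where "i \<noteq> j" "lines_at x = {i, j}"
proof -
  have False 
    if in_i: "i \<in> lines_at x" and in_j: "j \<in> lines_at x" and in_k: "k \<in> lines_at x"
      and ne: "i \<noteq> j" "i \<noteq> k" "j \<noteq> k" for i j k
  proof -
    have *: "\<exists>a. x \<in> grid_line M p a \<and> grid_line M p a \<in> grid_lines M" if p: "p \<in> lines_at x" for p
    proof -
      have "p < r" "height p x \<in> \<int>"
        using p by (auto simp: lines_at_def)
      moreover obtain a where "height p x = of_int a"
        using \<open>height p x \<in> \<int>\<close> by (rule Ints_cases)
      ultimately show ?thesis
        by (intro exI[of _ a]) (auto simp: grid_lines_def mem_grid_line_iff)
    qed
    obtain a b c where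
      L: "x \<in> grid_line M i a" "grid_line M i a \<in> grid_lines M" "x \<in> grid_line M j b"
         "grid_line M j b \<in> grid_lines M" "x \<in> grid_line M k c" "grid_line M k c \<in> grid_lines M"
      using *[OF in_i] *[OF in_j] *[OF in_k] by blast
    have lt: "i < r" "j < r" "k < r"
      using in_i in_j in_k lines_at_less by auto
    have "grid_line M i a \<inter> grid_line M j b \<inter> grid_line M k c = {}"
      using regular L grid_line_neq[OF lt(1,2) ne(1)] grid_line_neq[OF lt(1,3) ne(2)]
        grid_line_neq[OF lt(2,3) ne(3)]
      by (simp add: regular_multigrid_def)
    then show False
      using L by blast
  qed
  then have three: "k = i \<or> k = j"
    if "i \<in> lines_at x" "j \<in> lines_at x" "k \<in> lines_at x" "i \<noteq> j" for i j k
    using that by blast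
  show ?thesis
  proof (cases "\<exists>i j. i \<noteq> j \<and> i \<in> lines_at x \<and> j \<in> lines_at x")
    case True
    then obtain i j where ij: "i \<noteq> j" "i \<in> lines_at x" "j \<in> lines_at x"
      by blast
    then have "lines_at x = {i, j}"
      using three[of i j] by auto
    then show ?thesis
      using ij that(3) by blast
  next
    case False
    then have "lines_at x = {j}" if "j \<in> lines_at x" for j
      using that by blast
    then show ?thesis
      using that by blast
  qed
qed

text \<open>Monotonicity of the grid indices gives \<open>(x - y) \<bullet> (vertex_at x - vertex_at y) \<ge> 0\<close>, with
  equality only if all the indices agree.\<close>

lemma vertex_at_inj:
  assumes eq: "vertex_at x = vertex_at y" and j: "j < r"
  shows "K j x = K j y"
proof -
  let ?t = "\<lambda>j. of_int (K j x - K j y) * l j * ((x - y) \<bullet> n j)"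
  have t: "?t j \<ge> 0 \<and> (K j x \<noteq> K j y \<longrightarrow> ?t j > 0)" if "j < r" for j
  proof -
    have h: "(x - y) \<bullet> n j = spacing M j * (height j x - height j y)"
      using height_diff[of j x y] spacing_pos[OF that] by simp
    consider "K j x = K j y" | "K j x < K j y" | "K j x > K j y" by linarith
    then show ?thesis
    proof cases
      case 2
      then have "height j x < height j y"
        unfolding K_eq by (meson ceiling_mono not_less)
      then show ?thesis
        using 2 length_pos[OF that] spacing_pos[OF that]
        by (simp add: h mult_neg_pos mult_pos_neg mult_neg_neg less_imp_le)
    next
      case 3
      then have "height j x > height j y"
        unfolding K_eq by (meson ceiling_mono not_less)
      then show ?thesis
        using 3 length_pos[OF that] spacing_pos[OF that] by (simp add: h)
    qed auto
  qed
  have "vertex_at x - vertex_at y = (\<Sum>j<r. of_int (K j x - K j y) *\<^sub>R edge_vec j)"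
    unfolding vertex_at_def sum_subtractf[symmetric] by (intro sum.cong) (auto simp: scaleR_diff_left)
  then have "(\<Sum>j<r. ?t j) = (x - y) \<bullet> (vertex_at x - vertex_at y)"
    by (simp add: inner_sum_right edge_vec_def mult.assoc)
  then have "(\<Sum>j<r. ?t j) = 0"
    using eq by simp
  then have "\<forall>j\<in>{..<r}. ?t j = 0"
    using t by (subst (asm) sum_nonneg_eq_0_iff) auto
  then show ?thesis
    using t[OF j] j by fastforce
qed

lemma vertex_at_cong: "(\<And>j. j < r \<Longrightarrow> K j x = K j y) \<Longrightarrow> vertex_at x = vertex_at y"
  by (simp add: vertex_at_def)

text \<open>Crossing upwards one line from each family in \<open>I\<close> adds the corresponding
  edge vectors. All comparisons of neighbouring vertices take this form.\<close>

lemma vertex_at_shift: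
  assumes "I \<subseteq> {..<r}" "\<And>i. i < r \<Longrightarrow> K i x = K i y + of_bool (i \<in> I)"
  shows "vertex_at x = vertex_at y + (\<Sum>i\<in>I. edge_vec i)"
proof -
  have "vertex_at x = (\<Sum>j<r. of_int (K j y) *\<^sub>R edge_vec j + (if j \<in> I then edge_vec j else 0))"
    unfolding vertex_at_def using assms by (intro sum.cong) (auto simp: scaleR_add_left)
  also have "\<dots> = vertex_at y + (\<Sum>i\<in>I. edge_vec i)"
    using sum.inter_restrict[of "{..<r}" edge_vec I] assms(1)
    by (simp add: sum.distrib vertex_at_def inf.absorb2)
  finally show ?thesis .
qed

text \<open>All points of a cell share one vertex, hence the choice; by \<open>vertex_at_inj\<close>
  its outcome does not matter for a joint.\<close>

definition joint_index :: "nat \<Rightarrow> real^2 \<Rightarrow> int" where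
  "joint_index j p = K j (SOME x. vertex_at x = p)"

lemma joint_index_vertex_at: "j < r \<Longrightarrow> joint_index j (vertex_at x) = K j x"
  unfolding joint_index_def by (rule vertex_at_inj[OF someI]) auto

text \<open>Heights are continuous, so near \<open>q\<close> only those lines are met that pass
  through \<open>q\<close>. The ceiling keeps its value on and below such a line and is one larger
  above it.\<close>

lemma eventually_nhds_K:
  assumes "j < r"
  shows "\<forall>\<^sub>F y in nhds q. (if j \<in> lines_at q then K j y = K j q + of_bool (height j y > height j q)
    \<and> (height j y \<in> \<int> \<longrightarrow> height j y = height j q)
    else K j y = K j q \<and> height j y \<notin> \<int>)"
proof -
  have lim: "(height j \<longlongrightarrow> height j q) (nhds q)"
    using continuous_height[of UNIV j]
    by (simp add: continuous_on_eq_continuous_within continuous_within tendsto_nhds_iff)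
  show ?thesis
  proof (cases "j \<in> lines_at q")
    case True
    then obtain k where k: "height j q = of_int k"
      by (auto simp: lines_at_def Ints_def)
    have "\<forall>\<^sub>F y in nhds q. height j y > of_int k - 1" "\<forall>\<^sub>F y in nhds q. height j y < of_int k + 1"
      using order_tendstoD[OF lim, of "of_int k - 1"] order_tendstoD[OF lim, of "of_int k + 1"] k by auto
    then show ?thesis
    proof eventually_elim
      case (elim y)
      have "height j y = of_int k" if int: "height j y \<in> \<int>"
      proof -
        obtain a where "height j y = of_int a"
          using int by (rule Ints_cases)
        moreover from this have "a = k"
          using elim by linarith
        ultimately show ?thesis
          by simp
      qed
      moreover have "K j y = k + of_bool (height j y > of_int k)"
        unfolding K_eq using elim by (intro ceiling_unique) auto
      moreover have "K j q = k"
        by (simp add: K_eq k)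
      ultimately show ?case
        using True k by simp
    qed
  next
    case False
    then have ni: "height j q \<notin> \<int>"
      using assms by (simp add: lines_at_def)
    define k where "k = \<lceil>height j q\<rceil>"
    have b: "of_int k - 1 < height j q" "height j q < of_int k"
      using ni unfolding k_def
      by (linarith, metis Ints_of_int le_of_int_ceiling order_less_le)
    have "\<forall>\<^sub>F y in nhds q. height j y > of_int k - 1" "\<forall>\<^sub>F y in nhds q. height j y < of_int k"
      using order_tendstoD[OF lim] b by auto
    then show ?thesis
    proof eventually_elim
      case (elim y)
      have "height j y \<notin> \<int>"
        using elim by (rule not_Ints_between)
      moreover have "K j y = k"
        unfolding K_eq using elim by (intro ceiling_unique) auto
      ultimately show ?case
        using False by (simp add: K_eq k_def)
    qed
  qed
qed

lemma eventually_nhds_K_all: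
  "\<forall>\<^sub>F y in nhds q. \<forall>j<r. if j \<in> lines_at q then K j y = K j q + of_bool (height j y > height j q)
    \<and> (height j y \<in> \<int> \<longrightarrow> height j y = height j q)
    else K j y = K j q \<and> height j y \<notin> \<int>"
proof -
  have "\<forall>\<^sub>F y in nhds q. \<forall>j\<in>{..<r}. if j \<in> lines_at q
    then K j y = K j q + of_bool (height j y > height j q) \<and> (height j y \<in> \<int> \<longrightarrow> height j y = height j q)
    else K j y = K j q \<and> height j y \<notin> \<int>"
    using eventually_nhds_K by (intro eventually_ball_finite) auto
  then show ?thesis
    by (rule eventually_mono) auto
qed

lemma eventually_ray:
  fixes q w :: "real^2"
  assumes "\<forall>\<^sub>F y in nhds q. P y"
  shows "\<forall>\<^sub>F t in at_right 0. P (q + t *\<^sub>R w)"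
proof -
  have "((\<lambda>t. q + t *\<^sub>R w) \<longlongrightarrow> q + 0 *\<^sub>R w) (at_right 0)"
    by (intro tendsto_intros)
  then show ?thesis
    using assms by (simp add: filterlim_iff)
qed

text \<open>A short step along \<open>w\<close> stays on the lines parallel to \<open>w\<close>,
  leaves all others, and raises exactly the indices of the lines crossed in the direction of their
  normals.\<close>

lemma eventually_ray_K:
  "\<forall>\<^sub>F t in at_right (0::real). t > 0 \<and> lines_at (q + t *\<^sub>R w) = {j \<in> lines_at q. w \<bullet> n j = 0} \<and>
    (\<forall>j<r. K j (q + t *\<^sub>R w) = K j q + of_bool (j \<in> lines_at q \<and> w \<bullet> n j > 0))"
  using eventually_ray[OF eventually_nhds_K_all, of q w] eventually_at_right_less[of 0]
proof eventually_elim
  case (elim t)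
  have h: "height j (q + t *\<^sub>R w) = height j q + t * (w \<bullet> n j) / spacing M j" for j
    by (simp add: height_add)
  have 1: "j \<in> lines_at (q + t *\<^sub>R w) \<longleftrightarrow> j \<in> lines_at q \<and> w \<bullet> n j = 0" if j: "j < r" for j
  proof (cases "j \<in> lines_at q")
    case True
    then have "height j (q + t *\<^sub>R w) \<in> \<int> \<longrightarrow> height j (q + t *\<^sub>R w) = height j q"
      using elim(1)[rule_format, OF j] by simp
    then have "height j (q + t *\<^sub>R w) \<in> \<int> \<longrightarrow> t * (w \<bullet> n j) / spacing M j = 0"
      unfolding h by linarith
    then have "height j (q + t *\<^sub>R w) \<in> \<int> \<longrightarrow> w \<bullet> n j = 0"
      using elim(2) j by simp
    then show ?thesis
      using True j h[of j] by (auto simp: lines_at_def)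
  next
    case False
    then show ?thesis
      using elim(1)[rule_format, OF j] j unfolding if_not_P[OF False] by (simp add: lines_at_def)
  qed
  have 2: "K j (q + t *\<^sub>R w) = K j q + of_bool (j \<in> lines_at q \<and> w \<bullet> n j > 0)" if j: "j < r" for j
  proof -
    have "height j (q + t *\<^sub>R w) > height j q \<longleftrightarrow> w \<bullet> n j > 0"
      using h[of j] elim(2) spacing_pos[OF j] by (simp add: zero_less_divide_iff zero_less_mult_iff)
    then show ?thesis
      using elim(1)[rule_format, OF j] by (cases "j \<in> lines_at q") auto
  qed
  have "lines_at (q + t *\<^sub>R w) = {j \<in> lines_at q. w \<bullet> n j = 0}"
    using 1 lines_at_less by blast
  then show ?case
    using 2 elim(2) by blast
qed

text \<open>At most two normals occur, and they are independent, so their inner products with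
  \<open>w\<close> can be prescribed. With three concurrent lines some sign patterns would be
  missing.\<close>

lemma exists_direction:
  assumes "I \<subseteq> lines_at q"
  shows "\<exists>w. \<forall>j\<in>lines_at q. w \<bullet> n j = (if j \<in> I then 1 else - 1)"
proof (rule lines_at_cases[of q])
  fix j
  assume "lines_at q = {j}"
  then show ?thesis
    using lines_at_less[of j q]
    by (intro exI[of _ "(if j \<in> I then 1 else - 1) *\<^sub>R n j"]) auto
next
  fix i j
  assume "i \<noteq> j" "lines_at q = {i, j}"
  then show ?thesis
    using exists_inner_eq[OF perp_n[of i j]] lines_at_less[of _ q] by fastforce
qed auto

text \<open>A short step with the prescribed signs enters the cell above the lines in
  \<open>I\<close> and below the other lines through \<open>q\<close>.\<close>

lemma exists_generic_near:
  assumes "I \<subseteq> lines_at q" "\<forall>\<^sub>F y in nhds q. P y"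
  obtains x where "P x" "lines_at x = {}" "\<And>j. j < r \<Longrightarrow> K j x = K j q + of_bool (j \<in> I)"
proof -
  obtain w where w: "\<And>j. j \<in> lines_at q \<Longrightarrow> w \<bullet> n j = (if j \<in> I then 1 else - 1)"
    using exists_direction[OF assms(1)] by blast
  have "\<forall>\<^sub>F t in at_right 0. P (q + t *\<^sub>R w) \<and> lines_at (q + t *\<^sub>R w) = {} \<and>
      (\<forall>j<r. K j (q + t *\<^sub>R w) = K j q + of_bool (j \<in> I))"
    using eventually_ray[OF assms(2), of w] eventually_ray_K[of q w]
  proof eventually_elim
    case (elim t)
    have "j \<in> lines_at q \<and> w \<bullet> n j > 0 \<longleftrightarrow> j \<in> I" for j
      using w[of j] assms(1) by (cases "j \<in> I") auto
    moreover have "w \<bullet> n j \<noteq> 0" if "j \<in> lines_at q" for j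
      using w[OF that] by simp
    then have "{j \<in> lines_at q. w \<bullet> n j = 0} = {}"
      by blast
    ultimately show ?case
      using elim by simp
  qed
  from eventually_happens'[OF trivial_limit_at_right_real this]
  obtain t where "P (q + t *\<^sub>R w) \<and> lines_at (q + t *\<^sub>R w) = {} \<and>
      (\<forall>j<r. K j (q + t *\<^sub>R w) = K j q + of_bool (j \<in> I))"
    by blast
  then show ?thesis
    using that by blast
qed

lemma frequently_generic: "\<exists>\<^sub>F y in nhds q. lines_at y = {}"
  unfolding frequently_def
proof
  assume "\<forall>\<^sub>F y in nhds q. lines_at y \<noteq> {}"
  then show False
    using exists_generic_near[of "{}" q] by blast
qed

subsection \<open>Cells, vertices, edges and tiles\<close>

lemma mem_cell_of_self: "lines_at x = {} \<Longrightarrow> x \<in> cell_of x"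
  by (simp add: cell_of_def)

text \<open>Off the grid lines the indices are locally constant, hence constant on connected sets.
  Conversely, fixed indices confine a point to an intersection of open strips, which is convex and
  meets no line.\<close>

lemma component_eq_cell_of:
  assumes "lines_at x = {}"
  shows "connected_component_set (- \<Union> (grid_lines M)) x = cell_of x"
proof
  let ?G = "- \<Union> (grid_lines M)"
  have G: "y \<in> ?G \<longleftrightarrow> lines_at y = {}" for y
    using mem_Union_grid_lines_iff[of y] by blast
  show "connected_component_set ?G x \<subseteq> cell_of x"
  proof
    fix y
    assume y: "y \<in> connected_component_set ?G x"
    then have yG: "lines_at y = {}"
      using connected_component_subset G by blast
    obtain T where T: "connected T" "T \<subseteq> ?G" "x \<in> T" "y \<in> T"
      using y by (auto simp: connected_component_def)
    have "K j y = K j x" if j: "j < r" for j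
    proof (rule connected_local_const[OF T(1,4,3)])
      show "\<forall>a\<in>T. \<forall>\<^sub>F b in at a within T. K j a = K j b"
      proof
        fix a
        assume "a \<in> T"
        then have "j \<notin> lines_at a"
          using T(2) G by blast
        then have "\<forall>\<^sub>F b in nhds a. K j a = K j b"
          using eventually_nhds_K[OF j, of a] by (auto elim: eventually_mono)
        then show "\<forall>\<^sub>F b in at a within T. K j a = K j b"
          by (auto simp: eventually_at_filter elim: eventually_mono)
      qed
    qed
    then show "y \<in> cell_of x"
      using yG by (simp add: cell_of_def)
  qed
  show "cell_of x \<subseteq> connected_component_set ?G x"
  proof
    fix y
    assume y: "y \<in> cell_of x"
    have "closed_segment x y \<subseteq> ?G"
    proof
      fix z
      assume "z \<in> closed_segment x y"
      then obtain s where s: "0 \<le> s" "s \<le> 1" and z: "z = (1 - s) *\<^sub>R x + s *\<^sub>R y"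
        by (auto simp: in_segment)
      have "height j z \<notin> \<int>" if j: "j < r" for j
      proof -
        have nx: "height j x \<notin> \<int>" and ny: "height j y \<notin> \<int>" and k: "\<lceil>height j y\<rceil> = \<lceil>height j x\<rceil>"
          using assms y j by (auto simp: cell_of_def lines_at_def K_eq)
        define k where "k = \<lceil>height j x\<rceil>"
        have "height j x < of_int k" "height j x > of_int k - 1" "height j y < of_int k" "height j y > of_int k - 1"
          using nx ny k unfolding k_def
          by (metis Ints_of_int le_of_int_ceiling order_less_le, linarith,
              metis Ints_of_int le_of_int_ceiling order_less_le, linarith)
        moreover have hz: "height j z = (1 - s) * height j x + s * height j y"
          using spacing_pos[OF j]
          by (simp add: height_def z inner_add_left add_divide_distrib[symmetric] divide_simps)
            (simp add: algebra_simps)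
        ultimately have "height j z < of_int k" "height j z > of_int k - 1"
          using convex_bound_lt[of "height j x" "of_int k" "height j y" "1 - s" s] s
            convex_bound_lt[of "- height j x" "1 - of_int k" "- height j y" "1 - s" s]
          by (auto simp: algebra_simps)
        then show ?thesis
          by (intro not_Ints_between)
      qed
      then show "z \<in> ?G"
        using G by (auto simp: lines_at_def)
    qed
    then show "y \<in> connected_component_set ?G x"
      by (auto simp: connected_component_def intro!: exI[of _ "closed_segment x y"])
  qed
qed

lemma cells_eq: "cells M = cell_of ` {x. lines_at x = {}}"
proof -
  have "- \<Union> (grid_lines M) = {x. lines_at x = {}}"
    using mem_Union_grid_lines_iff by blast
  then show ?thesis
    unfolding cells_def components_def using component_eq_cell_of by auto
qed

lemma cell_vertex_cell_of:
  assumes "lines_at x = {}"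
  shows "cell_vertex M l (cell_of x) = vertex_at x"
proof -
  have "(SOME y. y \<in> cell_of x) \<in> cell_of x"
    using mem_cell_of_self[OF assms] by (rule someI)
  then have "vertex_at (SOME y. y \<in> cell_of x) = vertex_at x"
    by (intro vertex_at_cong) (simp add: cell_of_def)
  then show ?thesis
    by (simp add: cell_vertex_def vertex_at_def edge_vec_def)
qed

text \<open>The cells touching \<open>y\<close> are those obtained by choosing a side of each line
  through \<open>y\<close>: nearby points of the cell reveal the choice, and every choice is
  realised arbitrarily close to \<open>y\<close>.\<close>

lemma closure_cell_of_iff:
  assumes "lines_at x = {}"
  shows "y \<in> closure (cell_of x) \<longleftrightarrow>
    (\<exists>I\<subseteq>lines_at y. \<forall>i<r. K i x = K i y + of_bool (i \<in> I))"
proof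
  assume "y \<in> closure (cell_of x)"
  then have "\<exists>\<^sub>F z in nhds y. z \<in> cell_of x"
    unfolding frequently_def eventually_nhds_metric closure_approachable by meson
  then obtain z where z: "z \<in> cell_of x" and
    K: "\<forall>j<r. if j \<in> lines_at y then K j z = K j y + of_bool (height j z > height j y)
         \<and> (height j z \<in> \<int> \<longrightarrow> height j z = height j y) else K j z = K j y \<and> height j z \<notin> \<int>"
    using frequently_eventually_frequently[OF _ eventually_nhds_K_all[of y]] frequently_ex by blast
  let ?I = "{j \<in> lines_at y. height j z > height j y}"
  have "K i x = K i y + of_bool (i \<in> ?I)" if "i < r" for i
    using K z that by (auto simp: cell_of_def split: if_splits)
  then show "\<exists>I\<subseteq>lines_at y. \<forall>i<r. K i x = K i y + of_bool (i \<in> I)"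
    by (intro exI[of _ ?I]) auto
next
  assume "\<exists>I\<subseteq>lines_at y. \<forall>i<r. K i x = K i y + of_bool (i \<in> I)"
  then obtain I where I: "I \<subseteq> lines_at y" "\<And>i. i < r \<Longrightarrow> K i x = K i y + of_bool (i \<in> I)"
    by blast
  show "y \<in> closure (cell_of x)"
    unfolding closure_approachable
  proof (intro allI impI)
    fix e :: real
    assume "0 < e"
    then have "\<forall>\<^sub>F z in nhds y. dist z y < e"
      by (auto simp: eventually_nhds_metric)
    then obtain z where "dist z y < e" "lines_at z = {}" "\<And>j. j < r \<Longrightarrow> K j z = K j y + of_bool (j \<in> I)"
      using exists_generic_near[OF I(1)] by blast
    then show "\<exists>z\<in>cell_of x. dist z y < e"
      using I(2) by (intro bexI[of _ z]) (auto simp: cell_of_def)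
  qed
qed

abbreviation P :: tiling where "P \<equiv> dual_tiling M l"

lemma vertex_at_add:
  assumes "I \<subseteq> lines_at q"
  obtains x where "lines_at x = {}" "vertex_at x = vertex_at q + (\<Sum>i\<in>I. edge_vec i)"
    "\<And>j. j < r \<Longrightarrow> K j x = K j q + of_bool (j \<in> I)"
proof -
  obtain x where x: "lines_at x = {}" "\<And>j. j < r \<Longrightarrow> K j x = K j q + of_bool (j \<in> I)"
    using exists_generic_near[OF assms, of "\<lambda>_. True"] by auto
  moreover have "vertex_at x = vertex_at q + (\<Sum>i\<in>I. edge_vec i)"
    using assms lines_at_less x by (intro vertex_at_shift) auto
  ultimately show ?thesis
    using that by blast
qed

lemma vertex_at_add_edge:
  assumes "j \<in> lines_at q"
  obtains x where "vertex_at x = vertex_at q + edge_vec j"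
    "\<And>i. i < r \<Longrightarrow> K i x = K i q + of_bool (i = j)"
  by (rule vertex_at_add[of "{j}" q]) (use assms that in auto)

text \<open>A point on grid lines gives nothing new, because stepping below all of its lines reaches
  a cell without changing any index.\<close>

lemma tverts_eq: "tverts P = range vertex_at"
proof -
  have "tverts P = vertex_at ` {x. lines_at x = {}}"
    by (simp add: dual_tiling_def cells_eq image_image cell_vertex_cell_of)
  also have "\<dots> = range vertex_at"
  proof -
    have "vertex_at q \<in> vertex_at ` {x. lines_at x = {}}" for q
      using vertex_at_add[of "{}" q] by (metis (mono_tags, lifting) add.right_neutral empty_subsetI
          image_eqI mem_Collect_eq sum.empty)
    then show ?thesis by blast
  qed
  finally show ?thesis .
qed

lemma cells_at:
  "cell_vertex M l ` {C \<in> cells M. q \<in> closure C} =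
   (\<lambda>I. vertex_at q + (\<Sum>i\<in>I. edge_vec i)) ` Pow (lines_at q)"
proof (intro equalityI subsetI)
  fix p
  assume "p \<in> cell_vertex M l ` {C \<in> cells M. q \<in> closure C}"
  then obtain x where x: "lines_at x = {}" "q \<in> closure (cell_of x)" "p = cell_vertex M l (cell_of x)"
    by (auto simp: cells_eq)
  then obtain I where I: "I \<subseteq> lines_at q" "\<forall>i<r. K i x = K i q + of_bool (i \<in> I)"
    using closure_cell_of_iff by blast
  then have "vertex_at x = vertex_at q + (\<Sum>i\<in>I. edge_vec i)"
    using lines_at_less by (intro vertex_at_shift) auto
  then show "p \<in> (\<lambda>I. vertex_at q + (\<Sum>i\<in>I. edge_vec i)) ` Pow (lines_at q)"
    using x I cell_vertex_cell_of by auto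
next
  fix p
  assume "p \<in> (\<lambda>I. vertex_at q + (\<Sum>i\<in>I. edge_vec i)) ` Pow (lines_at q)"
  then obtain I where I: "I \<subseteq> lines_at q" "p = vertex_at q + (\<Sum>i\<in>I. edge_vec i)"
    by auto
  obtain x where x: "lines_at x = {}" "vertex_at x = vertex_at q + (\<Sum>i\<in>I. edge_vec i)"
    "\<And>j. j < r \<Longrightarrow> K j x = K j q + of_bool (j \<in> I)"
    using vertex_at_add[OF I(1)] by blast
  then have "q \<in> closure (cell_of x)"
    using closure_cell_of_iff[OF x(1)] I(1) by blast
  moreover have "p = cell_vertex M l (cell_of x)"
    using I x cell_vertex_cell_of by simp
  ultimately show "p \<in> cell_vertex M l ` {C \<in> cells M. q \<in> closure C}"
    using x(1) by (auto simp: cells_eq)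
qed

text \<open>Adjacency asks for a whole segment in both frontiers. Sliding from \<open>q\<close>
  along its line meets no other line for a while and changes no index, so the same two cells stay on
  the two sides.\<close>

lemma edge_at:
  assumes q: "lines_at q = {j}"
  shows "{vertex_at q, vertex_at q + edge_vec j} \<in> tedges P"
proof -
  have j: "j < r" "height j q \<in> \<int>"
    using q by (auto simp: lines_at_def)
  obtain k where k: "height j q = of_int k"
    using j(2) by (rule Ints_cases)
  let ?w = "perp (n j)"
  have "\<forall>\<^sub>F t in at_right (0::real). lines_at (q + t *\<^sub>R ?w) = {j} \<and> (\<forall>i<r. K i (q + t *\<^sub>R ?w) = K i q)"
    using eventually_ray_K[of q ?w]
  proof eventually_elim
    case (elim t)
    have "{i \<in> lines_at q. ?w \<bullet> n i = 0} = {j}"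
      using q by auto
    moreover have "\<not> (i \<in> lines_at q \<and> ?w \<bullet> n i > 0)" for i
      using q by auto
    ultimately show ?case
      using elim by simp
  qed
  then obtain b where b: "b > 0" "\<And>t. 0 < t \<Longrightarrow> t < b \<Longrightarrow>
      lines_at (q + t *\<^sub>R ?w) = {j} \<and> (\<forall>i<r. K i (q + t *\<^sub>R ?w) = K i q)"
    unfolding eventually_at_right_field by blast
  have b': "lines_at (q + t *\<^sub>R ?w) = {j} \<and> (\<forall>i<r. K i (q + t *\<^sub>R ?w) = K i q)"
    if "0 \<le> t" "t < b" for t
    using b(2)[of t] that q by (cases "t = 0") auto
  let ?y = "q + (b/2) *\<^sub>R ?w"
  obtain x1 where x1: "lines_at x1 = {}" "vertex_at x1 = vertex_at q"
    "\<And>i. i < r \<Longrightarrow> K i x1 = K i q"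
    using vertex_at_add[of "{}" q] by auto
  obtain x2 where x2: "lines_at x2 = {}" "vertex_at x2 = vertex_at q + edge_vec j"
    "\<And>i. i < r \<Longrightarrow> K i x2 = K i q + of_bool (i \<in> {j})"
    using vertex_at_add[of "{j}" q] q by auto
  have seg: "closed_segment q ?y \<subseteq> grid_line M j k \<inter> frontier (cell_of x1) \<inter> frontier (cell_of x2)"
  proof
    fix z
    assume "z \<in> closed_segment q ?y"
    then obtain s where s: "0 \<le> s" "s \<le> 1" "z = (1 - s) *\<^sub>R q + s *\<^sub>R ?y"
      by (auto simp: in_segment)
    then have z: "z = q + (s * b/2) *\<^sub>R ?w"
      by (simp add: algebra_simps)
    have t: "0 \<le> s * b / 2" "s * b / 2 < b"
      using s b(1) mult_right_mono[of s 1 b] by (simp_all)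
    have lz: "lines_at z = {j}" "\<And>i. i < r \<Longrightarrow> K i z = K i q"
      using b'[OF t] z by auto
    have "z \<notin> cell_of x1" "z \<notin> cell_of x2"
      using lz by (auto simp: cell_of_def)
    moreover have "z \<in> closure (cell_of x1)"
      unfolding closure_cell_of_iff[OF x1(1)] using lz x1 by (intro exI[of _ "{}"]) auto
    moreover have "z \<in> closure (cell_of x2)"
      unfolding closure_cell_of_iff[OF x2(1)] using lz x2 by (intro exI[of _ "{j}"]) auto
    moreover have "z \<in> grid_line M j k"
      using j k by (simp add: mem_grid_line_iff z height_add)
    ultimately show "z \<in> grid_line M j k \<inter> frontier (cell_of x1) \<inter> frontier (cell_of x2)"
      using interior_subset by (auto simp: frontier_def)
  qed
  have "x2 \<in> cell_of x2" "x2 \<notin> cell_of x1"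
    using x1 x2 j by (auto simp: cell_of_def)
  then have "cell_of x1 \<noteq> cell_of x2"
    by blast
  moreover have "q \<noteq> ?y"
    using b(1) j by simp
  moreover have "grid_line M j k \<in> grid_lines M"
    using j by (auto simp: grid_lines_def)
  ultimately have "adjacent_cells M (cell_of x1) (cell_of x2)"
    unfolding adjacent_cells_def cells_eq using seg x1(1) x2(1) by blast
  then have "{cell_vertex M l (cell_of x1), cell_vertex M l (cell_of x2)} \<in> tedges P"
    by (auto simp: dual_tiling_def)
  then show ?thesis
    using x1 x2 cell_vertex_cell_of by simp
qed

text \<open>A nondegenerate boundary segment is uncountable, so it contains a point lying on a
  single grid line. Edges can therefore be read off at such points.\<close>

lemma countable_crossings:
  assumes "j < r"
  shows "countable {q \<in> grid_line M j k. lines_at q \<noteq> {j}}"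
proof (rule countable_subset)
  show "{q \<in> grid_line M j k. lines_at q \<noteq> {j}} \<subseteq>
    (\<Union>i\<in>{..<r} - {j}. \<Union>a. grid_line M j k \<inter> grid_line M i a)"
  proof
    fix q
    assume q: "q \<in> {q \<in> grid_line M j k. lines_at q \<noteq> {j}}"
    then have "j \<in> lines_at q"
      using assms by (auto simp: lines_at_def mem_grid_line_iff)
    then obtain i where i: "i \<in> lines_at q" "i \<noteq> j"
      using q by blast
    then have "i < r" "height i q \<in> \<int>"
      by (auto simp: lines_at_def)
    then obtain a where "height i q = of_int a"
      using Ints_cases by blast
    then show "q \<in> (\<Union>i\<in>{..<r} - {j}. \<Union>a. grid_line M j k \<inter> grid_line M i a)"
      using q i \<open>i < r\<close> mem_grid_line_iff by blast
  qed
  have "finite (grid_line M j k \<inter> grid_line M i a)" if "i < r" "i \<noteq> j" for i a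
  proof -
    have "x = y" if "x \<in> grid_line M j k \<inter> grid_line M i a" "y \<in> grid_line M j k \<inter> grid_line M i a" for x y
      using that heights_unique[OF assms \<open>i < r\<close> \<open>i \<noteq> j\<close>[symmetric], of x y] assms \<open>i < r\<close>
      by (auto simp: mem_grid_line_iff)
    then have "is_singleton (grid_line M j k \<inter> grid_line M i a) \<or> grid_line M j k \<inter> grid_line M i a = {}"
      by (metis (no_types, lifting) is_singletonI' )
    then show ?thesis
      by (auto simp: is_singleton_def)
  qed
  then show "countable (\<Union>i\<in>{..<r} - {j}. \<Union>a. grid_line M j k \<inter> grid_line M i a)"
    by (intro countable_UN) (auto intro: countable_finite)
qed

text \<open>Both cells have \<open>q\<close> in their closures and so correspond to subsets of
  \<open>{j}\<close>. As they differ, they are the two sides of the line.\<close>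

lemma tedges_cases:
  assumes "e \<in> tedges P"
  obtains q j where "lines_at q = {j}" "e = {vertex_at q, vertex_at q + edge_vec j}"
proof -
  obtain C D where CD: "adjacent_cells M C D" "e = {cell_vertex M l C, cell_vertex M l D}"
    using assms by (auto simp: dual_tiling_def)
  then obtain L x y where L: "L \<in> grid_lines M" "x \<noteq> y"
    "closed_segment x y \<subseteq> L \<inter> frontier C \<inter> frontier D" "C \<in> cells M" "D \<in> cells M" "C \<noteq> D"
    unfolding adjacent_cells_def by blast
  then obtain j k where j: "j < r" "L = grid_line M j k"
    by (auto simp: grid_lines_def)
  have "\<not> closed_segment x y \<subseteq> {q \<in> grid_line M j k. lines_at q \<noteq> {j}}"
    using countable_subset[OF _ countable_crossings[OF j(1)]] uncountable_closed_segment[OF L(2)] by blast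
  then obtain q where q: "q \<in> closed_segment x y" "lines_at q = {j}"
    using L(3) j(2) by blast
  then have "q \<in> closure C" "q \<in> closure D"
    using L(3) by (auto simp: frontier_def)
  obtain c d where c: "lines_at c = {}" "C = cell_of c" and d: "lines_at d = {}" "D = cell_of d"
    using L(4,5) by (auto simp: cells_eq)
  obtain I where I: "I \<subseteq> {j}" "\<forall>i<r. K i c = K i q + of_bool (i \<in> I)"
    using closure_cell_of_iff[OF c(1), of q] \<open>q \<in> closure C\<close> c q by auto
  obtain I' where I': "I' \<subseteq> {j}" "\<forall>i<r. K i d = K i q + of_bool (i \<in> I')"
    using closure_cell_of_iff[OF d(1), of q] \<open>q \<in> closure D\<close> d q by auto
  have "I \<noteq> I'"
  proof
    assume "I = I'"
    then have "cell_of c = cell_of d"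
      using I I' by (auto simp: cell_of_def)
    then show False
      using L(6) c d by simp
  qed
  moreover have "vertex_at c = vertex_at q + (\<Sum>i\<in>I. edge_vec i)"
    using I j by (intro vertex_at_shift) auto
  moreover have "vertex_at d = vertex_at q + (\<Sum>i\<in>I'. edge_vec i)"
    using I' j by (intro vertex_at_shift) auto
  moreover have "I = {} \<or> I = {j}" "I' = {} \<or> I' = {j}"
    using I(1) I'(1) by blast+
  ultimately have "e = {vertex_at q, vertex_at q + edge_vec j}"
    using CD(2) c d cell_vertex_cell_of by auto
  then show ?thesis
    using that q by blast
qed

definition tile_at :: "real^2 \<Rightarrow> (real^2) set" where
  "tile_at q = convex hull ((\<lambda>I. vertex_at q + (\<Sum>i\<in>I. edge_vec i)) ` Pow (lines_at q))"

lemma tiles_iff: "T \<in> tiles P \<longleftrightarrow> (\<exists>q i j. i \<noteq> j \<and> lines_at q = {i, j} \<and> T = tile_at q)"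
proof -
  have "(\<exists>L1\<in>grid_lines M. \<exists>L2\<in>grid_lines M. L1 \<noteq> L2 \<and> q \<in> L1 \<inter> L2) \<longleftrightarrow>
        (\<exists>i j. i \<noteq> j \<and> lines_at q = {i, j})" (is "?lhs \<longleftrightarrow> ?rhs") for q
  proof
    assume ?lhs
    then obtain i j a b where ij: "i < r" "j < r" "grid_line M i a \<noteq> grid_line M j b"
      "q \<in> grid_line M i a" "q \<in> grid_line M j b"
      unfolding grid_lines_def by blast
    then have h: "height i q = of_int a" "height j q = of_int b"
      by (auto simp: mem_grid_line_iff)
    then have mem: "i \<in> lines_at q" "j \<in> lines_at q"
      using ij by (auto simp: lines_at_def)
    have "i \<noteq> j"
      using h ij(3) by auto
    then show ?rhs
      using mem by (cases q rule: lines_at_cases) auto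
  next
    assume ?rhs
    then obtain i j where ij: "i \<noteq> j" "lines_at q = {i, j}"
      by blast
    then have "i < r" "j < r" "height i q \<in> \<int>" "height j q \<in> \<int>"
      by (auto simp: lines_at_def)
    moreover obtain a where "height i q = of_int a"
      using \<open>height i q \<in> \<int>\<close> by (rule Ints_cases)
    moreover obtain b where "height j q = of_int b"
      using \<open>height j q \<in> \<int>\<close> by (rule Ints_cases)
    ultimately have "q \<in> grid_line M i a" "q \<in> grid_line M j b" "grid_line M i a \<noteq> grid_line M j b"
      "grid_line M i a \<in> grid_lines M" "grid_line M j b \<in> grid_lines M"
      using grid_line_neq ij(1) by (auto simp: mem_grid_line_iff grid_lines_def)
    then show ?lhs
      by blast
  qed
  then show ?thesis
    by (auto simp: dual_tiling_def cells_at tile_at_def)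
qed

lemma tile_at_eq:
  assumes "i \<noteq> j" "lines_at q = {i, j}"
  shows "tile_at q = convex hull {vertex_at q, vertex_at q + edge_vec i, vertex_at q + edge_vec j,
    vertex_at q + edge_vec i + edge_vec j}"
proof -
  have "Pow (lines_at q) = {{}, {i}, {j}, {i, j}}"
    using assms by auto
  then show ?thesis
    using assms by (simp add: tile_at_def add.assoc insert_commute)
qed

subsection \<open>Linear approximation of the dualisation\<close>

text \<open>The map \<open>A\<close> of the overview.\<close>

definition dual_map :: "real^2 \<Rightarrow> real^2" where
  "dual_map x = (\<Sum>j<r. (x \<bullet> n j / spacing M j) *\<^sub>R edge_vec j)"

definition ribbon_direction :: "nat \<Rightarrow> real^2" where
  "ribbon_direction j = dual_map (perp (n j))"

lemma linear_dual_map: "linear dual_map"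
  unfolding dual_map_def
  by (intro linearI) (auto simp: inner_add_left add_divide_distrib scaleR_add_left sum.distrib scaleR_sum_right)

text \<open>The quadratic form \<open>x \<bullet> dual_map x\<close> is a positive combination of
  the squares of all \<open>x \<bullet> n j\<close>; it vanishes only if \<open>x\<close> is
  orthogonal to two independent normals.\<close>

lemma inj_dual_map: "inj dual_map"
proof -
  have "x = 0" if "dual_map x = 0" for x
  proof -
    have "x \<bullet> dual_map x = (\<Sum>j<r. l j / spacing M j * (x \<bullet> n j)\<^sup>2)"
      by (simp add: dual_map_def inner_sum_right edge_vec_def power2_eq_square algebra_simps)
    then have "(\<Sum>j<r. l j / spacing M j * (x \<bullet> n j)\<^sup>2) = 0"
      using that by simp
    then have 0: "\<forall>j\<in>{..<r}. l j / spacing M j * (x \<bullet> n j)\<^sup>2 = 0"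
      using length_pos spacing_pos by (subst (asm) sum_nonneg_eq_0_iff) (auto simp: less_imp_le)
    have "x \<bullet> n j = 0" if "j < r" for j
      using bspec[OF 0, of j] that length_pos[OF that] by simp
    then have "x \<bullet> n 0 = 0" "x \<bullet> n 1 = 0"
      using r_ge_2 by auto
    then show ?thesis
      using inner_eq_0_imp_eq_0[OF perp_n[of 0 1]] r_ge_2 by auto
  qed
  then show ?thesis
    using linear_injective_0[OF linear_dual_map] by blast
qed

lemma surj_dual_map: "surj dual_map"
  using linear_injective_imp_surjective[OF linear_dual_map inj_dual_map refl] .

lemma ribbon_direction_nonzero: "j < r \<Longrightarrow> ribbon_direction j \<noteq> 0"
  using linear_injective_0[OF linear_dual_map] inj_dual_map perp_eq_0_iff n_nonzero
  unfolding ribbon_direction_def by metis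

section \<open>Vertices as a bounded perturbation of a linear map, and the Delone property\<close>

lemma K_approx:
  obtains B where "B \<ge> 0" "\<And>j x. j < r \<Longrightarrow> \<bar>of_int (K j x) - x \<bullet> n j / spacing M j\<bar> \<le> B"
proof
  let ?B = "\<Sum>j<r. 1 + \<bar>shift M j / spacing M j\<bar>"
  show "?B \<ge> 0"
    by (intro sum_nonneg) auto
  fix j x
  assume j: "j < r"
  have "\<bar>of_int (K j x) - x \<bullet> n j / spacing M j\<bar> \<le> 1 + \<bar>shift M j / spacing M j\<bar>"
    unfolding K_eq height_def add_divide_distrib by linarith
  also have "\<dots> \<le> ?B"
    using j by (intro member_le_sum) auto
  finally show "\<bar>of_int (K j x) - x \<bullet> n j / spacing M j\<bar> \<le> ?B" .
qed

lemma vertex_approx: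
  obtains B where "B \<ge> 0" "\<And>x. norm (vertex_at x - dual_map x) \<le> B"
proof -
  obtain B where B: "B \<ge> 0" "\<And>j x. j < r \<Longrightarrow> \<bar>of_int (K j x) - x \<bullet> n j / spacing M j\<bar> \<le> B"
    using K_approx by blast
  have "norm (vertex_at x - dual_map x) \<le> (\<Sum>j<r. B * norm (edge_vec j))" for x
  proof -
    have "vertex_at x - dual_map x = (\<Sum>j<r. (of_int (K j x) - x \<bullet> n j / spacing M j) *\<^sub>R edge_vec j)"
      unfolding vertex_at_def dual_map_def sum_subtractf[symmetric]
      by (intro sum.cong) (auto simp: scaleR_diff_left)
    then show ?thesis
      using B by (auto intro!: sum_norm_le mult_right_mono)
  qed
  moreover have "(\<Sum>j<r. B * norm (edge_vec j)) \<ge> 0"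
    using B by (intro sum_nonneg) auto
  ultimately show ?thesis
    using that by blast
qed

text \<open>Joints at distance at most 1 come from points at bounded distance, as
  \<open>dual_map\<close> is bounded below. Their index differences are then bounded, which leaves
  finitely many difference vectors; the least nonzero length among these, capped at 1, is the
  separation.\<close>

lemma vertex_at_separated:
  obtains \<rho> where "\<rho> > 0" "\<And>x y. vertex_at x \<noteq> vertex_at y \<Longrightarrow> \<rho> \<le> dist (vertex_at x) (vertex_at y)"
proof -
  obtain B where B: "B \<ge> 0" "\<And>x. norm (vertex_at x - dual_map x) \<le> B"
    using vertex_approx by blast
  obtain B' where B': "B' \<ge> 0" "\<And>j x. j < r \<Longrightarrow> \<bar>of_int (K j x) - x \<bullet> n j / spacing M j\<bar> \<le> B'"
    using K_approx by blast
  obtain c where c: "c > 0" "\<And>x. c * norm x \<le> norm (dual_map x)"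
    using linear_inj_bounded_below_pos[OF linear_dual_map inj_dual_map] by metis
  define D where "D = (1 + 2 * B) / c"
  define N where "N = \<lceil>2 * B' + (\<Sum>j<r. D / spacing M j)\<rceil>"
  define F where "F = (\<lambda>f. \<Sum>j<r. of_int (f j) *\<^sub>R edge_vec j) ` (PiE {..<r} (\<lambda>_. {-N..N}))"
  have D: "D \<ge> 0"
    using B c by (simp add: D_def)
  have "finite F"
    unfolding F_def by (intro finite_imageI finite_PiE) auto
  have mem: "vertex_at x - vertex_at y \<in> F" if d: "dist (vertex_at x) (vertex_at y) \<le> 1" for x y
  proof -
    have "norm (dual_map (x - y)) \<le> 1 + 2 * B"
    proof -
      have "dual_map (x - y) = (vertex_at x - vertex_at y) - (vertex_at x - dual_map x) + (vertex_at y - dual_map y)"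
        by (simp add: linear_diff[OF linear_dual_map])
      also have "norm \<dots> \<le> norm (vertex_at x - vertex_at y) + norm (vertex_at x - dual_map x) + norm (vertex_at y - dual_map y)"
        by (meson add_right_mono norm_triangle_ineq norm_triangle_ineq4 order_trans)
      also have "\<dots> \<le> 1 + 2 * B"
        using d B(2)[of x] B(2)[of y] by (simp add: dist_norm)
      finally show ?thesis .
    qed
    then have xy: "norm (x - y) \<le> D"
      using c(1) c(2)[of "x - y"] by (simp add: D_def field_simps)
    have "\<bar>K j x - K j y\<bar> \<le> N" if j: "j < r" for j
    proof -
      have "\<bar>(x - y) \<bullet> n j\<bar> \<le> D"
        using Cauchy_Schwarz_ineq2[of "x - y" "n j"] xy j by simp
      then have "\<bar>x \<bullet> n j / spacing M j - y \<bullet> n j / spacing M j\<bar> \<le> D / spacing M j"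
        using spacing_pos[OF j]
        by (simp add: diff_divide_distrib[symmetric] inner_diff_left divide_right_mono abs_divide)
      moreover have "D / spacing M j \<le> (\<Sum>j<r. D / spacing M j)"
        using j D spacing_pos by (intro member_le_sum) (auto intro: divide_nonneg_nonneg less_imp_le)
      ultimately have "\<bar>real_of_int (K j x) - of_int (K j y)\<bar> \<le> 2 * B' + (\<Sum>j<r. D / spacing M j)"
        using B'(2)[OF j, of x] B'(2)[OF j, of y] by linarith
      then have "real_of_int \<bar>K j x - K j y\<bar> \<le> of_int N"
        unfolding N_def by (simp add: le_of_int_ceiling order_trans)
      then show ?thesis
        by linarith
    qed
    then have "restrict (\<lambda>j. K j x - K j y) {..<r} \<in> PiE {..<r} (\<lambda>_. {-N..N})"
      by (force simp: abs_le_iff)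
    moreover have "vertex_at x - vertex_at y = (\<Sum>j<r. of_int (restrict (\<lambda>j. K j x - K j y) {..<r} j) *\<^sub>R edge_vec j)"
      unfolding vertex_at_def sum_subtractf[symmetric] by (intro sum.cong) (auto simp: scaleR_diff_left)
    ultimately show ?thesis
      unfolding F_def by blast
  qed
  define \<rho> where "\<rho> = Min (insert 1 (norm ` (F - {0})))"
  have fin: "finite (insert 1 (norm ` (F - {0})))"
    using \<open>finite F\<close> by simp
  have "\<rho> > 0"
    unfolding \<rho>_def using fin by (subst Min_gr_iff) auto
  moreover have "\<rho> \<le> dist (vertex_at x) (vertex_at y)" if ne: "vertex_at x \<noteq> vertex_at y" for x y
  proof (cases "dist (vertex_at x) (vertex_at y) \<le> 1")
    case True
    then show ?thesis
      unfolding \<rho>_def dist_norm using mem[OF True] ne by (intro Min_le[OF fin]) auto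
  next
    case False
    moreover have "\<rho> \<le> 1"
      unfolding \<rho>_def by (intro Min_le[OF fin]) auto
    ultimately show ?thesis by simp
  qed
  ultimately show ?thesis
    using that by blast
qed

lemma vertex_at_dense:
  obtains R where "\<And>z. \<exists>x. dist z (vertex_at x) \<le> R"
proof -
  obtain B where B: "\<And>x. norm (vertex_at x - dual_map x) \<le> B"
    using vertex_approx by blast
  have "\<exists>x. dist z (vertex_at x) \<le> B" for z
  proof -
    obtain x where "z = dual_map x"
      using surj_dual_map by (metis surjD)
    then show ?thesis
      using B[of x] by (auto simp: dist_norm norm_minus_commute)
  qed
  then show ?thesis
    using that by blast
qed

text \<open>Needed since \<open>periodic_slippage_line\<close> contains the Delone property as a
  conjunct.\<close>

lemma delone_framework_dual: "delone_framework (tiling_framework P)"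
proof -
  have "countable (range vertex_at)"
  proof (rule countable_subset)
    show "range vertex_at \<subseteq> (\<lambda>f. \<Sum>j<r. of_int (f j) *\<^sub>R edge_vec j) ` (PiE {..<r} (\<lambda>_. UNIV :: int set))"
    proof
      fix p
      assume "p \<in> range vertex_at"
      then obtain x where "p = vertex_at x" by blast
      then have "p = (\<Sum>j<r. of_int (restrict (\<lambda>j. K j x) {..<r} j) *\<^sub>R edge_vec j)"
        by (simp add: vertex_at_def)
      then show "p \<in> (\<lambda>f. \<Sum>j<r. of_int (f j) *\<^sub>R edge_vec j) ` (PiE {..<r} (\<lambda>_. UNIV :: int set))"
        by (intro image_eqI[where x = "restrict (\<lambda>j. K j x) {..<r}"]) auto
    qed
    show "countable ((\<lambda>f. \<Sum>j<r. of_int (f j) *\<^sub>R edge_vec j) ` (PiE {..<r} (\<lambda>_. UNIV :: int set)))"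
      by (intro countable_image countable_PiE) auto
  qed
  moreover have "\<exists>v\<in>range vertex_at. \<exists>w\<in>range vertex_at. v \<noteq> w \<and> e = {v, w}" if "e \<in> tedges P" for e
  proof -
    obtain q j where q: "lines_at q = {j}" "e = {vertex_at q, vertex_at q + edge_vec j}"
      using tedges_cases[OF \<open>e \<in> tedges P\<close>] by blast
    obtain x where "vertex_at x = vertex_at q + edge_vec j"
      using vertex_at_add_edge[of j q] q(1) by blast
    moreover have "edge_vec j \<noteq> 0"
      using edge_vec_nonzero lines_at_less q by auto
    ultimately have "vertex_at q \<noteq> vertex_at x" "e = {vertex_at q, vertex_at x}"
      using q by auto
    then show ?thesis
      by blast
  qed
  moreover have "dist v w \<le> (\<Sum>j<r. norm (edge_vec j))" if "{v, w} \<in> tedges P" for v w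
  proof -
    obtain q j where q: "lines_at q = {j}" "{v, w} = {vertex_at q, vertex_at q + edge_vec j}"
      using tedges_cases[OF \<open>{v, w} \<in> tedges P\<close>] by blast
    then have "dist v w = norm (edge_vec j)"
      by (auto simp: doubleton_eq_iff dist_norm)
    also have "\<dots> \<le> (\<Sum>j<r. norm (edge_vec j))"
      using lines_at_less[of j q] q by (intro member_le_sum) auto
    finally show ?thesis .
  qed
  moreover have "delone_set (range vertex_at)"
  proof -
    obtain \<rho> where "\<rho> > 0" "\<And>x y. vertex_at x \<noteq> vertex_at y \<Longrightarrow> \<rho> \<le> dist (vertex_at x) (vertex_at y)"
      using vertex_at_separated by blast
    moreover obtain R where "\<And>z. \<exists>x. dist z (vertex_at x) \<le> R"
      using vertex_at_dense by blast
    ultimately show ?thesis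
      unfolding delone_set_def by auto
  qed
  ultimately show ?thesis
    unfolding delone_framework_def bar_joint_framework_def joints_tiling
    by (auto simp: tiling_framework_def tverts_eq)
qed

subsection \<open>The ribbon figure\<close>

text \<open>Near \<open>q\<close> every line met passes through \<open>q\<close>, and two lines of
  different families have only one common point. So crossings are isolated.\<close>

lemma eventually_nhds_crossing:
  "\<forall>\<^sub>F y in nhds q. \<forall>i j. i \<noteq> j \<longrightarrow> i \<in> lines_at y \<longrightarrow> j \<in> lines_at y \<longrightarrow> y = q"
  using eventually_nhds_K_all[of q]
proof eventually_elim
  case (elim y)
  show ?case
  proof (intro allI impI)
    fix i j
    assume ij: "i \<noteq> j" "i \<in> lines_at y" "j \<in> lines_at y"
    have "height a y = height a q" if "a \<in> lines_at y" for a
    proof -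
      have "a < r" "height a y \<in> \<int>"
        using that by (auto simp: lines_at_def)
      then show ?thesis
        using elim[rule_format, OF \<open>a < r\<close>] by (cases "a \<in> lines_at q") auto
    qed
    then show "y = q"
      using ij heights_unique[of i j y q] lines_at_less by blast
  qed
qed

lemma finite_crossings_bounded:
  assumes "bounded B"
  shows "finite (B \<inter> {q. \<exists>i j. i \<noteq> j \<and> i \<in> lines_at q \<and> j \<in> lines_at q})" (is "finite (B \<inter> ?X)")
proof -
  have "finite (closure B \<inter> ?X)"
  proof (rule finite_not_islimpt_in_compact)
    show "compact (closure B)"
      using assms by (simp add: compact_closure)
    show "\<not> z islimpt ?X" for z
    proof
      assume "z islimpt ?X"
      then have "\<exists>\<^sub>F y in at z. y \<in> ?X"
        by (simp add: islimpt_iff_eventually frequently_def)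
      moreover have "\<forall>\<^sub>F y in at z. y \<notin> ?X"
        using eventually_nhds_crossing[of z] unfolding eventually_at_filter
        by eventually_elim blast
      ultimately show False
        by (simp add: frequently_def)
    qed
  qed
  then show ?thesis
    by (rule finite_subset[rotated]) (use closure_subset in auto)
qed

lemma on_grid_line_param:
  assumes "j < r" "height j x = height j y"
  obtains s where "x = y + s *\<^sub>R perp (n j)"
proof -
  have "(x - y) \<bullet> n j = 0"
    using height_diff[of j x y] assms by simp
  then have "perp (perp (n j)) \<bullet> (x - y) = 0"
    by (simp add: inner_real2 algebra_simps)
  moreover have "perp (n j) \<noteq> 0"
    using assms by simp
  ultimately have "x - y = ((perp (n j) \<bullet> (x - y)) / (perp (n j) \<bullet> perp (n j))) *\<^sub>R perp (n j)"
    using perp_eq_0_imp_parallel by blast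
  then show ?thesis
    using that[of "(perp (n j) \<bullet> (x - y)) / (perp (n j) \<bullet> perp (n j))"] by (metis add.commute diff_add_cancel)
qed

lemma norm_perp_n: "j < r \<Longrightarrow> norm (perp (n j)) = 1"
proof -
  assume "j < r"
  then have "perp (n j) \<bullet> perp (n j) = 1"
    using inner_n_self[of j] by (simp add: inner_real2)
  then show ?thesis
    by (simp add: norm_eq_1)
qed

text \<open>The ends of a face that is a segment are extreme points of the tile, hence among the
  joints indexed by subsets of \<open>lines_at q\<close>. Their \<open>j\<close>th indices differ by
  one, which is possible only if the \<open>j\<close>th family passes through \<open>q\<close> and
  the lower end has the index of \<open>q\<close>.\<close>

lemma face_of_tile_at:
  assumes p: "lines_at p = {j}"
    and face: "convex hull {vertex_at p, vertex_at p + edge_vec j} face_of tile_at q"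
  shows "j \<in> lines_at q" "K j p = K j q"
proof -
  have j: "j < r"
    using p lines_at_less by auto
  have ext: "\<exists>I\<subseteq>lines_at q. v = vertex_at q + (\<Sum>i\<in>I. edge_vec i)"
    if "v \<in> {vertex_at p, vertex_at p + edge_vec j}" for v
  proof -
    have "v extreme_point_of closed_segment (vertex_at p) (vertex_at p + edge_vec j)"
      using that by (simp add: extreme_point_of_segment)
    then have "v extreme_point_of tile_at q"
      using extreme_point_of_face[OF face] by (simp add: segment_convex_hull)
    then show ?thesis
      unfolding tile_at_def by (auto dest!: extreme_point_of_convex_hull)
  qed
  have index: "\<exists>I\<subseteq>lines_at q. joint_index j v = K j q + of_bool (j \<in> I)"
    if v: "v \<in> {vertex_at p, vertex_at p + edge_vec j}" for v
  proof -
    obtain I where I: "I \<subseteq> lines_at q" "v = vertex_at q + (\<Sum>i\<in>I. edge_vec i)"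
      using ext[OF v] by blast
    obtain x where "vertex_at x = v" "K j x = K j q + of_bool (j \<in> I)"
      using vertex_at_add[OF I(1)] I(2) j by metis
    then show ?thesis
      using joint_index_vertex_at[OF j, of x] I(1) by auto
  qed
  obtain x where x: "vertex_at x = vertex_at p + edge_vec j" "K j x = K j p + 1"
    by (rule vertex_at_add_edge[of j p]) (use p j in auto)
  obtain I where I: "I \<subseteq> lines_at q" "K j p = K j q + of_bool (j \<in> I)"
    using index[of "vertex_at p"] unfolding joint_index_vertex_at[OF j] by blast
  obtain I' where I': "I' \<subseteq> lines_at q" "K j p + 1 = K j q + of_bool (j \<in> I')"
  proof -
    have "joint_index j (vertex_at p + edge_vec j) = K j p + 1"
      using joint_index_vertex_at[OF j, of x] x by simp
    then show ?thesis
      using index[of "vertex_at p + edge_vec j"] that by auto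
  qed
  have "j \<notin> I" "j \<in> I'"
    using I(2) I'(2) by (cases "j \<in> I"; cases "j \<in> I'"; simp)+
  then show "j \<in> lines_at q" "K j p = K j q"
    using I I' by auto
qed

lemma K_eq_imp_height_eq:
  assumes "j \<in> lines_at x" "j \<in> lines_at y" "K j x = K j y"
  shows "height j x = height j y"
  using assms unfolding lines_at_def K_eq by (auto elim!: Ints_cases)

text \<open>Edges are unordered pairs, so a translation identifies the edge vectors only up to sign;
  vectors of different families are not even parallel.\<close>

lemma edge_translate_unique:
  assumes "i < r" "j < r" "{v, v + edge_vec i} = (\<lambda>x. c + x) ` {u, u + edge_vec j}"
  shows "i = j"
proof (rule ccontr)
  assume "i \<noteq> j"
  have "edge_vec i = edge_vec j \<or> edge_vec i = - edge_vec j"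
    using assms(3) by (auto simp: doubleton_eq_iff algebra_simps eq_neg_iff_add_eq_0)
  then have "perp (edge_vec j) \<bullet> edge_vec i = 0"
    by auto
  then show False
    using perp_edge_vec[OF assms(2,1)] \<open>i \<noteq> j\<close> by simp
qed

text \<open>Since the shared edges are translates, they all belong to one family \<open>j\<close>.
  Two consecutive tiles share an edge, so their crossings have the same \<open>j\<close>th index and
  lie on \<open>j\<close>-lines; thus all crossings lie on one grid line.\<close>

lemma ribbon_on_grid_line:
  assumes "is_ribbon P T"
  obtains j q where "j < r" "\<And>a. T a = tile_at (q a)" "\<And>a b. height j (q a) = height j (q b)"
    "inj q" "\<And>a. \<exists>i\<noteq>j. i \<in> lines_at (q a) \<and> j \<in> lines_at (q a)"
proof -
  obtain e where e: "\<And>a. e a \<in> tedges P" "\<And>a. (convex hull (e a)) edge_of (T a)"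
    "\<And>a. (convex hull (e a)) edge_of (T (a + 1))" "\<And>a b. \<exists>c. e b = (\<lambda>x. c + x) ` e a"
    using assms unfolding is_ribbon_def by blast
  have T: "inj T" "\<And>a. T a \<in> tiles P"
    using assms unfolding is_ribbon_def by auto
  have "\<forall>a. \<exists>q. (\<exists>i i'. i \<noteq> i' \<and> lines_at q = {i, i'}) \<and> T a = tile_at q"
    using T(2) unfolding tiles_iff by blast
  from choice[OF this] obtain q where
    q: "\<And>a. \<exists>i i'. i \<noteq> i' \<and> lines_at (q a) = {i, i'}" "\<And>a. T a = tile_at (q a)"
    by blast
  have "\<exists>pj. lines_at (fst pj) = {snd pj} \<and> e a = {vertex_at (fst pj), vertex_at (fst pj) + edge_vec (snd pj)}" for a
    by (rule tedges_cases[OF e(1)[of a]]) auto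
  then have "\<forall>a. \<exists>pj. lines_at (fst pj) = {snd pj} \<and> e a = {vertex_at (fst pj), vertex_at (fst pj) + edge_vec (snd pj)}"
    by blast
  from choice[OF this] obtain pj where
    pj: "\<And>a. lines_at (fst (pj a)) = {snd (pj a)}"
        "\<And>a. e a = {vertex_at (fst (pj a)), vertex_at (fst (pj a)) + edge_vec (snd (pj a))}"
    by blast
  define p where "p a = fst (pj a)" for a
  define jj where "jj a = snd (pj a)" for a
  have p: "\<And>a. lines_at (p a) = {jj a}" "\<And>a. e a = {vertex_at (p a), vertex_at (p a) + edge_vec (jj a)}"
    using pj by (auto simp: p_def jj_def)
  have jj: "jj a < r" for a
    using p(1)[of a] lines_at_less by auto
  define j where "j = jj 0"
  have jja: "jj a = j" for a
  proof -
    obtain c where "e a = (\<lambda>x. c + x) ` e 0"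
      using e(4)[where a = 0 and b = a] by blast
    then show ?thesis
      unfolding p(2) j_def by (rule edge_translate_unique[OF jj jj])
  qed
  have 1: "j \<in> lines_at (q a)" "K j (p a) = K j (q a)" for a
    using face_of_tile_at[OF p(1), of a "q a"] e(2)[of a] p(2)[of a] q(2)[of a] jja[of a]
    by (auto simp: edge_of_def)
  have 2: "K j (p a) = K j (q (a + 1))" for a
    using face_of_tile_at[OF p(1), of a "q (a + 1)"] e(3)[of a] p(2)[of a] q(2)[of "a + 1"] jja[of a]
    by (auto simp: edge_of_def)
  have step: "K j (q (a + 1)) = K j (q a)" for a
    using 1(2)[of a] 2[of a] by simp
  have "K j (q a) = K j (q 0)" for a
  proof (induction a rule: int_induct[where k = 0])
    case (step2 i)
    then show ?case
      using step[of "i - 1"] by simp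
  qed (use step in auto)
  then have "height j (q a) = height j (q b)" for a b
    using K_eq_imp_height_eq[OF 1(1) 1(1)] by metis
  moreover have "inj q"
    using T(1) q(2) by (simp add: inj_def)
  moreover have "\<exists>i\<noteq>j. i \<in> lines_at (q a) \<and> j \<in> lines_at (q a)" for a
    using q(1)[of a] 1(1)[of a] by auto
  moreover have "j < r"
    using jj j_def by auto
  ultimately show ?thesis
    using that q(2) by blast
qed

lemma vertex_at_mem_tile_at: "vertex_at q \<in> tile_at q"
  unfolding tile_at_def by (intro hull_inc image_eqI[of _ _ "{}"]) auto

text \<open>The crossings of the ribbon are distinct points of a discrete set on one line, so their
  parameters are unbounded. Up to a bounded error, \<open>perp h\<close> evaluated at the tiles is
  affine in the parameter; being bounded, it has slope zero, and that slope is
  \<open>perp h \<bullet> ribbon_direction j\<close>.\<close>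

lemma ribbon_line_is_ribbon_direction:
  assumes "line_through_origin H" "is_ribbon P T" "\<And>x. x \<in> \<Union> (range T) \<Longrightarrow> infdist x H \<le> R"
  shows "\<exists>j<r. H = span {ribbon_direction j}"
proof -
  obtain h where h: "h \<noteq> 0" "H = span {h}"
    using assms(1) by (auto simp: line_through_origin_def)
  obtain j q where j: "j < r" and q: "\<And>a. T a = tile_at (q a)" "\<And>a b. height j (q a) = height j (q b)"
    "inj q" "\<And>a. \<exists>i\<noteq>j. i \<in> lines_at (q a) \<and> j \<in> lines_at (q a)"
    using ribbon_on_grid_line[OF assms(2)] by blast
  let ?w = "perp (n j)"
  have "\<exists>s. q a = q 0 + s *\<^sub>R ?w" for a
    using on_grid_line_param[OF j q(2)] by blast
  then obtain s where s: "\<And>a. q a = q 0 + s a *\<^sub>R ?w"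
    by metis
  obtain B where B: "\<And>x. norm (vertex_at x - dual_map x) \<le> B"
    using vertex_approx by blast
  have "perp h \<bullet> ribbon_direction j = 0"
  proof (rule unbounded_affine_bounded_imp_slope_0)
    show "\<exists>t\<in>range s. \<bar>t\<bar> > D" for D
    proof (rule ccontr)
      assume "\<not> (\<exists>t\<in>range s. \<bar>t\<bar> > D)"
      moreover have "dist (q 0) (q a) = \<bar>s a\<bar>" for a
        unfolding dist_norm by (subst s[of a]) (simp add: norm_perp_n[OF j])
      ultimately have "range q \<subseteq> cball (q 0) D"
        by (auto simp: not_less)
      then have "range q \<subseteq> cball (q 0) D \<inter> {q. \<exists>i j. i \<noteq> j \<and> i \<in> lines_at q \<and> j \<in> lines_at q}"
        using q(4) by blast
      then have "finite (range q)"
        using finite_subset finite_crossings_bounded[OF bounded_cball] by blast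
      then show False
        using q(3) finite_imageD[of q UNIV] infinite_UNIV_int by blast
    qed
    show "\<bar>perp h \<bullet> dual_map (q 0) + t * (perp h \<bullet> ribbon_direction j)\<bar> \<le> norm (perp h) * R + norm (perp h) * B"
      if t: "t \<in> range s" for t
    proof -
      obtain a where a: "t = s a"
        using t by blast
      have "\<bar>perp h \<bullet> vertex_at (q a)\<bar> \<le> norm (perp h) * R"
        using assms(3)[of "vertex_at (q a)"] vertex_at_mem_tile_at[of "q a"] q(1) h
        by (intro inner_perp_infdist_span) auto
      moreover have "\<bar>perp h \<bullet> (vertex_at (q a) - dual_map (q a))\<bar> \<le> norm (perp h) * B"
        using Cauchy_Schwarz_ineq2[of "perp h" "vertex_at (q a) - dual_map (q a)"]
          mult_left_mono[OF B[of "q a"], of "norm (perp h)"] by simp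
      moreover have "perp h \<bullet> dual_map (q a) = perp h \<bullet> dual_map (q 0) + t * (perp h \<bullet> ribbon_direction j)"
        by (subst s) (simp add: a ribbon_direction_def linear_add[OF linear_dual_map]
            linear_scale[OF linear_dual_map] inner_add_right)
      ultimately show ?thesis
        by (simp add: inner_diff_right)
    qed
  qed
  then show ?thesis
    using span_eq_of_perp[OF _ h(1) ribbon_direction_nonzero[OF j]] h(2) j by blast
qed

section \<open>Construction of a ribbon along a grid line\<close>

lemma vertex_at_const_between:
  assumes "\<And>s. a < s \<Longrightarrow> s < b \<Longrightarrow> lines_at (q + s *\<^sub>R perp (n j)) = {j}"
    "a < s" "s < b" "a < t" "t < b"
  shows "vertex_at (q + s *\<^sub>R perp (n j)) = vertex_at (q + t *\<^sub>R perp (n j))"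
proof (rule connected_local_const[of "{a<..<b}" s t "\<lambda>s. vertex_at (q + s *\<^sub>R perp (n j))"])
  let ?g = "\<lambda>s. q + s *\<^sub>R perp (n j)"
  show "\<forall>u\<in>{a<..<b}. \<forall>\<^sub>F v in at u within {a<..<b}. vertex_at (?g u) = vertex_at (?g v)"
  proof
    fix u
    assume "u \<in> {a<..<b}"
    then have lu: "lines_at (?g u) = {j}"
      using assms(1) by simp
    have lim: "(?g \<longlongrightarrow> ?g u) (at u within {a<..<b})"
      by (intro tendsto_intros)
    have "\<forall>\<^sub>F v in at u within {a<..<b}. \<forall>i<r. if i \<in> lines_at (?g u)
      then K i (?g v) = K i (?g u) + of_bool (height i (?g v) > height i (?g u))
        \<and> (height i (?g v) \<in> \<int> \<longrightarrow> height i (?g v) = height i (?g u))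
      else K i (?g v) = K i (?g u) \<and> height i (?g v) \<notin> \<int>"
      using filterlim_iff[THEN iffD1, OF lim, rule_format, OF eventually_nhds_K_all] .
    then show "\<forall>\<^sub>F v in at u within {a<..<b}. vertex_at (?g u) = vertex_at (?g v)"
    proof eventually_elim
      case (elim v)
      have "K i (?g u) = K i (?g v)" if i: "i < r" for i
      proof (cases "i = j")
        case True
        have "height j (?g v) = height j (?g u)"
          by (simp add: height_add)
        then show ?thesis
          using True by (simp add: K_eq)
      next
        case False
        then show ?thesis
          using elim[rule_format, OF i] lu by simp
      qed
      then show ?case
        by (rule vertex_at_cong)
    qed
  qed
qed (use assms in auto)

lemma eventually_vertex_at_crossing:
  assumes q: "lines_at q = {i, j}" and v: "v \<bullet> n j = 0"
  shows "\<forall>\<^sub>F t in at_right (0::real). t > 0 \<and>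
    vertex_at (q + t *\<^sub>R v) = vertex_at q + (if v \<bullet> n i > 0 then edge_vec i else 0)"
  using eventually_ray_K[of q v]
proof eventually_elim
  case (elim t)
  let ?I = "if v \<bullet> n i > 0 then {i} else {}"
  have "x \<in> lines_at q \<and> v \<bullet> n x > 0 \<longleftrightarrow> x \<in> ?I" for x
    using q v by auto
  then have "\<And>k. k < r \<Longrightarrow> K k (q + t *\<^sub>R v) = K k q + of_bool (k \<in> ?I)"
    using elim by simp
  then have "vertex_at (q + t *\<^sub>R v) = vertex_at q + (\<Sum>k\<in>?I. edge_vec k)"
    using lines_at_less[of i q] q by (intro vertex_at_shift) auto
  then show ?case
    using elim by auto
qed

text \<open>The flag \<open>c\<close> selects one of the two sides of the parallelogram parallel to
  \<open>edge_vec j\<close>. The functional \<open>perp (edge_vec j)\<close> is constant on each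
  side, with different values.\<close>

lemma edge_of_tile_at:
  assumes ij: "i \<noteq> j" "lines_at q = {i, j}" and V: "V = vertex_at q + (if c then edge_vec i else 0)"
  shows "convex hull {V, V + edge_vec j} edge_of tile_at q"
proof -
  have lt: "i < r" "j < r"
    using ij lines_at_less by auto
  let ?f = "\<lambda>x. perp (edge_vec j) \<bullet> x"
  let ?A = "vertex_at q"
  let ?S = "{?A, ?A + edge_vec i, ?A + edge_vec j, ?A + edge_vec i + edge_vec j}"
  let ?c' = "?f ?A + (if c then 0 else ?f (edge_vec i))"
  have fi: "?f (edge_vec i) \<noteq> 0"
    using perp_edge_vec[of j i] lt ij by auto
  have "convex hull {V, V + edge_vec j} face_of convex hull ?S"
  proof (rule face_of_convex_hulls)
    show "{V, V + edge_vec j} \<subseteq> ?S"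
      using V by auto
    have a: "affine hull {V, V + edge_vec j} \<subseteq> {x. ?f x = ?f V}"
      by (intro hull_minimal affine_hyperplane) (auto simp: inner_add_right)
    have b: "convex hull (?S - {V, V + edge_vec j}) \<subseteq> {x. ?f x = ?c'}"
      using V by (intro hull_minimal convex_hyperplane) (auto simp: inner_add_right split: if_splits)
    have "?f V \<noteq> ?c'"
      using V fi by (auto simp: inner_add_right)
    then show "affine hull {V, V + edge_vec j} \<inter> convex hull (?S - {V, V + edge_vec j}) = {}"
    proof (intro equals0I)
      fix x
      assume "?f V \<noteq> ?c'" "x \<in> affine hull {V, V + edge_vec j} \<inter> convex hull (?S - {V, V + edge_vec j})"
      then show False
        using subsetD[OF a, of x] subsetD[OF b, of x] by simp
    qed
  qed auto
  moreover have "aff_dim (convex hull {V, V + edge_vec j}) = 1"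
    using edge_vec_nonzero[OF lt(2)] by (simp add: aff_dim_convex_hull aff_dim_2)
  ultimately show ?thesis
    by (simp add: edge_of_def tile_at_eq[OF ij])
qed

lemma ribbon_exists:
  assumes j: "j < r"
  shows "\<exists>T. is_ribbon P T \<and> (\<exists>R. \<forall>x\<in>\<Union> (range T). infdist x (span {ribbon_direction j}) \<le> R)"
proof -
  \<comment> \<open>Any second family would do: its equally spaced lines provide crossings
    arbitrarily far out in both directions.\<close>
  define i0 where "i0 = (if j = 0 then 1 else (0::nat))"
  have i0: "i0 < r" "i0 \<noteq> j"
    using r_ge_2 by (auto simp: i0_def)
  obtain q0 where q0: "height i0 q0 = 0" "height j q0 = 0"
    using exists_heights[OF i0(1) j i0(2)] by blast
  define w where "w = perp (n j)"
  define \<gamma> where "\<gamma> s = q0 + s *\<^sub>R w" for s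
  have \<gamma>_add: "\<gamma> (s + t) = \<gamma> s + t *\<^sub>R w" for s t
    by (simp add: \<gamma>_def scaleR_add_left)
  have wj: "w \<bullet> n j = 0"
    by (simp add: w_def)
  have norm_w: "norm w = 1"
    using norm_perp_n[OF j] by (simp add: w_def)
  have wi: "w \<bullet> n i \<noteq> 0" if "i < r" "i \<noteq> j" for i
    using perp_n[OF j that(1)] that(2) by (auto simp: w_def)
  have j_in: "j \<in> lines_at (\<gamma> s)" for s
    using j q0 wj by (simp add: lines_at_def \<gamma>_def height_add)
  define X where "X = {s. lines_at (\<gamma> s) \<noteq> {j}}"
  have X: "\<exists>i. i \<noteq> j \<and> lines_at (\<gamma> s) = {i, j}" if "s \<in> X" for s
  proof (rule lines_at_cases[of "\<gamma> s"])
    fix a b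
    assume "a \<noteq> b" "lines_at (\<gamma> s) = {a, b}"
    then show ?thesis
      using j_in[of s] by (cases "a = j") (auto simp: insert_commute)
  qed (use j_in[of s] that in \<open>auto simp: X_def\<close>)
  have finX: "finite (X \<inter> {a..b})" for a b
  proof -
    have "inj \<gamma>"
      using norm_w by (auto simp: inj_def \<gamma>_def)
    have "\<gamma> ` (X \<inter> {a..b}) \<subseteq> cball q0 (max \<bar>a\<bar> \<bar>b\<bar>) \<inter> {q. \<exists>i j. i \<noteq> j \<and> i \<in> lines_at q \<and> j \<in> lines_at q}"
    proof
      fix x
      assume "x \<in> \<gamma> ` (X \<inter> {a..b})"
      then obtain s where s: "x = \<gamma> s" "s \<in> X" "a \<le> s" "s \<le> b"
        by auto
      have "dist q0 x = \<bar>s\<bar>"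
        using norm_w by (simp add: s \<gamma>_def dist_norm)
      moreover have "\<bar>s\<bar> \<le> max \<bar>a\<bar> \<bar>b\<bar>"
        using s by linarith
      ultimately show "x \<in> cball q0 (max \<bar>a\<bar> \<bar>b\<bar>) \<inter> {q. \<exists>i j. i \<noteq> j \<and> i \<in> lines_at q \<and> j \<in> lines_at q}"
        using X[OF s(2)] s(1) by auto
    qed
    then have "finite (\<gamma> ` (X \<inter> {a..b}))"
      using finite_subset finite_crossings_bounded[OF bounded_cball] by blast
    then show ?thesis
      using \<open>inj \<gamma>\<close> by (auto intro: finite_imageD inj_on_subset)
  qed
  define c where "c = (w \<bullet> n i0) / spacing M i0"
  have c: "c \<noteq> 0"
    using wi[OF i0] i0 by (simp add: c_def)
  have inX: "of_int m / c \<in> X" for m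
  proof -
    have "height i0 (\<gamma> (of_int m / c)) = of_int m"
      using c q0 by (simp add: \<gamma>_def height_add) (simp add: c_def)
    then have "i0 \<in> lines_at (\<gamma> (of_int m / c))"
      using i0 by (simp add: lines_at_def)
    then show ?thesis
      using i0(2) by (auto simp: X_def)
  qed
  have above: "\<exists>x\<in>X. x > a" for a
    using exists_int_div_gt[OF c, of a] inX by blast
  have below: "\<exists>x\<in>X. x < a" for a
  proof -
    obtain m :: int where "of_int m / (- c) > - a"
      using exists_int_div_gt[of "- c" "- a"] c by auto
    then have "of_int m / c < a"
      by simp
    then show ?thesis
      using inX by blast
  qed
  obtain f :: "int \<Rightarrow> real" where f: "\<And>a. f a \<in> X" "\<And>a. f a < f (a + 1)"
    "\<And>a t. f a < t \<Longrightarrow> t < f (a + 1) \<Longrightarrow> t \<notin> X"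
    using consecutive_enumeration[OF finX above below] by blast
  define q where "q a = \<gamma> (f a)" for a
  have "\<forall>a. \<exists>i. i \<noteq> j \<and> lines_at (q a) = {i, j}"
    using X f(1) by (auto simp: q_def)
  from choice[OF this] obtain i where i: "\<And>a. i a \<noteq> j" "\<And>a. lines_at (q a) = {i a, j}"
    by blast
  have ir: "i a < r" for a
    using i(2)[of a] lines_at_less[of "i a" "q a"] by simp
  \<comment> \<open>A point strictly between two consecutive crossings; the edge dual to it is the
    one shared by the two tiles.\<close>
  define mid where "mid a = \<gamma> ((f a + f (a + 1)) / 2)" for a
  have between: "lines_at (\<gamma> s) = {j}" if "f a < s" "s < f (a + 1)" for a s
    using f(3)[OF that] by (simp add: X_def)
  have const: "vertex_at (\<gamma> s) = vertex_at (mid a)" if "f a < s" "s < f (a + 1)" for a s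
    unfolding mid_def \<gamma>_def w_def
    by (rule vertex_at_const_between[of "f a" "f (a + 1)"])
      (use between[of a] that f(2)[of a] in \<open>auto simp: \<gamma>_def w_def\<close>)
  have right: "vertex_at (mid a) = vertex_at (q a) + (if w \<bullet> n (i a) > 0 then edge_vec (i a) else 0)" for a
  proof -
    have "\<forall>\<^sub>F t in at_right (0::real). t < f (a + 1) - f a"
      using f(2)[of a] by (intro eventually_at_rightI[of 0 "f (a + 1) - f a"]) auto
    then have "\<forall>\<^sub>F t in at_right (0::real). vertex_at (mid a) = vertex_at (q a) + (if w \<bullet> n (i a) > 0 then edge_vec (i a) else 0)"
      using eventually_vertex_at_crossing[OF i(2) wj, of a]
    proof eventually_elim
      case (elim t)
      then show ?case
        using const[of a "f a + t"] by (simp add: q_def \<gamma>_add)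
    qed
    then show ?thesis
      by simp
  qed
  have left: "vertex_at (mid a) = vertex_at (q (a + 1)) + (if w \<bullet> n (i (a + 1)) < 0 then edge_vec (i (a + 1)) else 0)" for a
  proof -
    have wj': "(- w) \<bullet> n j = 0"
      using wj by simp
    have "\<forall>\<^sub>F t in at_right (0::real). t < f (a + 1) - f a"
      using f(2)[of a] by (intro eventually_at_rightI[of 0 "f (a + 1) - f a"]) auto
    then have "\<forall>\<^sub>F t in at_right (0::real). vertex_at (mid a) = vertex_at (q (a + 1)) + (if w \<bullet> n (i (a + 1)) < 0 then edge_vec (i (a + 1)) else 0)"
      using eventually_vertex_at_crossing[OF i(2) wj', of "a + 1"]
    proof eventually_elim
      case (elim t)
      then show ?case
        using const[of a "f (a + 1) + (- t)"] unfolding \<gamma>_add by (simp add: q_def)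
    qed
    then show ?thesis
      by simp
  qed
  define T where "T a = tile_at (q a)" for a
  define e where "e a = {vertex_at (mid a), vertex_at (mid a) + edge_vec j}" for a
  have mid: "lines_at (mid a) = {j}" for a
    unfolding mid_def using f(2)[of a] by (intro between[of a]) auto
  have wd: "w \<bullet> edge_vec k = l k * (w \<bullet> n k)" for k
    by (simp add: edge_vec_def)
  have "inj T"
  proof -
    \<comment> \<open>A height along the ribbon. It increases strictly with \<open>a\<close>, and
      \<open>h a\<close> is the maximum of \<open>w\<close> on the tile \<open>T a\<close>, so equal
      tiles have equal parameters.\<close>
    define h where "h a = w \<bullet> vertex_at (mid a)" for a
    have "h a < h (a + 1)" for a
    proof -
      have "l (i (a + 1)) > 0" "w \<bullet> n (i (a + 1)) \<noteq> 0"
        using length_pos ir wi i(1) by auto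
      then show ?thesis
        unfolding h_def left[of a] right[of "a + 1"]
        by (cases "w \<bullet> n (i (a + 1)) > 0") (auto simp: inner_add_right wd mult_pos_neg)
    qed
    then have mono: "h a < h b" if "a < b" for a b
      using strict_mono_int_stepI[of h] that by blast
    have le: "w \<bullet> x \<le> h a" if "x \<in> T a" for x a
    proof -
      have "l (i a) > 0" "w \<bullet> n (i a) \<noteq> 0"
        using length_pos ir wi i(1) by auto
      then have "T a \<subseteq> {x. w \<bullet> x \<le> h a}"
        unfolding T_def tile_at_eq[OF i(1,2)] h_def right
        by (intro hull_minimal convex_halfspace_le)
          (auto simp: inner_add_right wd wj mult_pos_neg not_less mult_le_0_iff)
      then show ?thesis
        using that by blast
    qed
    have mem: "vertex_at (mid a) \<in> T a" for a
      unfolding T_def tile_at_eq[OF i(1,2)] right by (rule hull_inc) auto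
    show ?thesis
    proof (rule injI)
      fix a b
      assume "T a = T b"
      then have "h a \<le> h b" "h b \<le> h a"
        using le mem unfolding h_def by metis+
      then show "a = b"
        using mono[of a b] mono[of b a] by linarith
    qed
  qed
  moreover have "T a \<in> tiles P" for a
    unfolding tiles_iff T_def using i by blast
  moreover have "e a \<in> tedges P" for a
    unfolding e_def by (rule edge_at[OF mid])
  moreover have "(convex hull (e a)) edge_of (T a)" for a
    unfolding e_def T_def by (rule edge_of_tile_at[OF i(1,2) right])
  moreover have "(convex hull (e a)) edge_of (T (a + 1))" for a
    unfolding e_def T_def by (rule edge_of_tile_at[OF i(1,2) left])
  moreover have "\<exists>c. e b = (\<lambda>x. c + x) ` e a" for a b
    by (intro exI[of _ "vertex_at (mid b) - vertex_at (mid a)"]) (simp add: e_def)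
  ultimately have "is_ribbon P T"
    unfolding is_ribbon_def by blast
  moreover have "\<exists>R. \<forall>x\<in>\<Union> (range T). infdist x (span {ribbon_direction j}) \<le> R"
  proof -
    obtain B where B: "\<And>x. norm (vertex_at x - dual_map x) \<le> B"
      using vertex_approx by blast
    define D where "D = (\<Sum>k<r. norm (edge_vec k))"
    have "infdist x (span {ribbon_direction j}) \<le> D + D + B + norm (dual_map q0)" if "x \<in> T a" for x a
    proof -
      have d: "norm (edge_vec k) \<le> D" if "k < r" for k
        unfolding D_def using that by (intro member_le_sum) auto
      have "D \<ge> 0"
        unfolding D_def by (intro sum_nonneg) auto
      have "T a \<subseteq> cball (vertex_at (q a)) (D + D)"
        unfolding T_def tile_at_eq[OF i(1,2)]
        using d[OF ir[of a]] d[OF j] \<open>D \<ge> 0\<close> norm_triangle_ineq4[of "- edge_vec (i a)" "edge_vec j"]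
        by (intro hull_minimal convex_cball) (auto simp: dist_norm)
      then have "dist x (vertex_at (q a)) \<le> D + D"
        using that by (auto simp: dist_commute)
      moreover have "dist (vertex_at (q a)) (dual_map (q a)) \<le> B"
        using B by (simp add: dist_norm)
      moreover have "dist (dual_map (q a)) (f a *\<^sub>R ribbon_direction j) = norm (dual_map q0)"
        by (simp add: q_def \<gamma>_def w_def ribbon_direction_def linear_add[OF linear_dual_map]
            linear_scale[OF linear_dual_map] dist_norm)
      ultimately have "dist x (f a *\<^sub>R ribbon_direction j) \<le> D + D + B + norm (dual_map q0)"
        using dist_triangle[of x "f a *\<^sub>R ribbon_direction j" "vertex_at (q a)"]
          dist_triangle[of "vertex_at (q a)" "f a *\<^sub>R ribbon_direction j" "dual_map (q a)"] by linarith
      moreover have "f a *\<^sub>R ribbon_direction j \<in> span {ribbon_direction j}"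
        by (intro span_mul span_base) simp
      ultimately show ?thesis
        by (rule infdist_le2[rotated])
    qed
    then show ?thesis
      by blast
  qed
  ultimately show ?thesis
    by blast
qed

lemma ribbon_figure_eq: "ribbon_figure P = (\<Union>j<r. span {ribbon_direction j})"
proof -
  have "(line_through_origin H \<and> (\<exists>T. is_ribbon P T \<and> (\<exists>R. \<forall>x\<in>\<Union> (range T). infdist x H \<le> R))) \<longleftrightarrow>
    (\<exists>j<r. H = span {ribbon_direction j})" (is "?lhs \<longleftrightarrow> ?rhs") for H
  proof
    assume ?lhs
    then obtain T R where "line_through_origin H" "is_ribbon P T" "\<forall>x\<in>\<Union> (range T). infdist x H \<le> R"
      by blast
    then show ?rhs
      by (intro ribbon_line_is_ribbon_direction[of H T R]) auto
  next
    assume ?rhs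
    then obtain j where j: "j < r" "H = span {ribbon_direction j}"
      by blast
    then show ?lhs
      using ribbon_exists[OF j(1)] ribbon_direction_nonzero[OF j(1)] by (auto simp: line_through_origin_def)
  qed
  then show ?thesis
    by (auto simp: ribbon_figure_def)
qed

subsection \<open>Flexes\<close>

lemma flex_edge:
  assumes "infinitesimal_flex (tiling_framework P) z" "lines_at q = {j}"
  shows "cdot (z (vertex_at q + edge_vec j) - z (vertex_at q)) (edge_vec j) = 0"
proof -
  have "{vertex_at q + edge_vec j, vertex_at q} \<in> tedges P"
    using edge_at[OF assms(2)] by (simp add: insert_commute)
  then have "cdot (z (vertex_at q + edge_vec j) - z (vertex_at q)) (vertex_at q + edge_vec j - vertex_at q) = 0"
    using assms(1) unfolding infinitesimal_flex_tiling_iff by blast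
  then show ?thesis
    by simp
qed

text \<open>Leaving the crossing along the \<open>j\<close>-line, in the direction where the
  \<open>i\<close>th index rises or in the opposite one, reaches either of the two parallel
  \<open>j\<close>-edges of the tile. The flag \<open>c\<close> decides which.\<close>

lemma edge_point_at_crossing:
  assumes ij: "i \<noteq> j" "lines_at q = {i, j}"
  obtains q' where "lines_at q' = {j}" "vertex_at q' = vertex_at q + (if c then edge_vec i else 0)"
proof -
  have lt: "i < r" "j < r"
    using ij lines_at_less by auto
  define v where "v = (if (perp (n j) \<bullet> n i > 0) = c then perp (n j) else - perp (n j))"
  have vj: "v \<bullet> n j = 0"
    by (simp add: v_def)
  have vi: "v \<bullet> n i \<noteq> 0" "v \<bullet> n i > 0 \<longleftrightarrow> c"
    using perp_n[of j i] lt ij(1) by (auto simp: v_def)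
  have only_j: "{k \<in> lines_at q. v \<bullet> n k = 0} = {j}"
    using ij vj vi by auto
  have "\<forall>\<^sub>F t in at_right (0::real). lines_at (q + t *\<^sub>R v) = {j} \<and>
      vertex_at (q + t *\<^sub>R v) = vertex_at q + (if c then edge_vec i else 0)"
    using eventually_ray_K[of q v] eventually_vertex_at_crossing[OF ij(2) vj]
    by eventually_elim (simp add: vi only_j)
  from eventually_happens'[OF trivial_limit_at_right_real this]
  show ?thesis
    using that by blast
qed

text \<open>The four edge conditions at a tile make the difference of the two jumps orthogonal to both
  edge vectors.\<close>

lemma flex_jump_across_tile:
  assumes z: "infinitesimal_flex (tiling_framework P) z" and ij: "i \<noteq> j" "lines_at q = {i, j}"
  shows "z (vertex_at q + edge_vec i + edge_vec j) - z (vertex_at q + edge_vec i) =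
    z (vertex_at q + edge_vec j) - z (vertex_at q)"
proof -
  have lt: "i < r" "j < r"
    using ij lines_at_less by auto
  let ?V = "vertex_at q"
  have ji: "j \<noteq> i" "lines_at q = {j, i}"
    using ij by auto
  have edge: "cdot (z (?V + (if c then edge_vec a else 0) + edge_vec b) - z (?V + (if c then edge_vec a else 0))) (edge_vec b) = 0"
    if "a \<noteq> b" "lines_at q = {a, b}" for a b c
  proof -
    obtain q' where "lines_at q' = {b}" "vertex_at q' = ?V + (if c then edge_vec a else 0)"
      using edge_point_at_crossing[of a b q c] \<open>a \<noteq> b\<close> \<open>lines_at q = {a, b}\<close> by blast
    then show ?thesis
      using flex_edge[OF z] by metis
  qed
  let ?x = "(z (?V + edge_vec i + edge_vec j) - z (?V + edge_vec i)) - (z (?V + edge_vec j) - z ?V)"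
  have "cdot ?x (edge_vec j) = 0"
    using edge[OF ij, of True] edge[OF ij, of False] by (simp add: cdot_diff_left)
  moreover have "cdot ?x (edge_vec i) = 0"
    using edge[OF ji, of True] edge[OF ji, of False]
    by (simp add: cdot_diff_left add.commute add.left_commute)
  ultimately have "?x = 0"
    using cdot_eq_0_imp_eq_0 perp_edge_vec[OF lt ij(1)] by blast
  then show ?thesis
    by simp
qed

lemma lines_at_along:
  assumes "j < r" "j \<in> lines_at q"
  shows "j \<in> lines_at (q + s *\<^sub>R perp (n j))"
  using assms by (simp add: lines_at_def height_add)

lemma frequently_only_line:
  assumes j: "j < r" "j \<in> lines_at q"
  shows "\<exists>\<^sub>F s in nhds s0. lines_at (q + s *\<^sub>R perp (n j)) = {j}"
  unfolding frequently_def
proof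
  let ?w = "perp (n j)"
  let ?q = "q + s0 *\<^sub>R ?w"
  assume ev: "\<forall>\<^sub>F s in nhds s0. lines_at (q + s *\<^sub>R ?w) \<noteq> {j}"
  have "((\<lambda>t. s0 + t) \<longlongrightarrow> s0 + 0) (at_right 0)"
    by (intro tendsto_intros)
  then have "filterlim (\<lambda>t. s0 + t) (nhds s0) (at_right 0)"
    by simp
  from filterlim_iff[THEN iffD1, OF this, rule_format, OF ev]
  have "\<forall>\<^sub>F t in at_right (0::real). lines_at (q + (s0 + t) *\<^sub>R ?w) \<noteq> {j}" .
  then have "\<forall>\<^sub>F t in at_right (0::real). False"
    using eventually_ray_K[of ?q ?w]
  proof eventually_elim
    case (elim t)
    have "{k \<in> lines_at ?q. ?w \<bullet> n k = 0} = {j}"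
      using lines_at_along[OF j, of s0] perp_n[OF j(1)] lines_at_less by fastforce
    then show ?case
      using elim by (simp add: scaleR_add_left add.assoc)
  qed
  then show False
    by simp
qed

text \<open>The jump is considered only at parameters off the crossings. Near a crossing the two
  adjacent edges are opposite sides of one parallelogram and have the same jump, so the jump is
  locally constant and no enumeration of tiles is required.\<close>

lemma flex_jump_along_line:
  assumes z: "infinitesimal_flex (tiling_framework P) z" and j: "j < r" "j \<in> lines_at q"
    and st: "lines_at (q + s *\<^sub>R perp (n j)) = {j}" "lines_at (q + t *\<^sub>R perp (n j)) = {j}"
  shows "z (vertex_at (q + s *\<^sub>R perp (n j)) + edge_vec j) - z (vertex_at (q + s *\<^sub>R perp (n j))) =
    z (vertex_at (q + t *\<^sub>R perp (n j)) + edge_vec j) - z (vertex_at (q + t *\<^sub>R perp (n j)))"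
proof -
  define \<gamma> where "\<gamma> s = q + s *\<^sub>R perp (n j)" for s
  define g where "g s = z (vertex_at (\<gamma> s) + edge_vec j) - z (vertex_at (\<gamma> s))" for s
  have "g s = g t"
  proof (rule densely_locally_constant_imp_constant[of "{s. lines_at (\<gamma> s) = {j}}"])
    show "\<exists>\<^sub>F y in nhds s0. y \<in> {s. lines_at (\<gamma> s) = {j}}" for s0
      using frequently_only_line[OF j, of s0] by (simp add: \<gamma>_def)
    show "\<exists>c. \<forall>\<^sub>F y in nhds s0. y \<in> {s. lines_at (\<gamma> s) = {j}} \<longrightarrow> g y = c" for s0
    proof -
      let ?V = "vertex_at (\<gamma> s0)"
      have jin: "j \<in> lines_at (\<gamma> s0)"
        using lines_at_along[OF j] by (simp add: \<gamma>_def)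
      have lim: "(\<gamma> \<longlongrightarrow> \<gamma> s0) (nhds s0)"
        unfolding \<gamma>_def by (intro tendsto_intros filterlim_ident)
      have ev: "\<forall>\<^sub>F y in nhds s0. \<forall>k<r. if k \<in> lines_at (\<gamma> s0)
        then K k (\<gamma> y) = K k (\<gamma> s0) + of_bool (height k (\<gamma> y) > height k (\<gamma> s0))
          \<and> (height k (\<gamma> y) \<in> \<int> \<longrightarrow> height k (\<gamma> y) = height k (\<gamma> s0))
        else K k (\<gamma> y) = K k (\<gamma> s0) \<and> height k (\<gamma> y) \<notin> \<int>"
        using filterlim_iff[THEN iffD1, OF lim, rule_format, OF eventually_nhds_K_all] .
      have hj: "height j (\<gamma> y) = height j (\<gamma> s0)" for y
        by (simp add: \<gamma>_def height_add)
      from ev have "\<forall>\<^sub>F y in nhds s0. g y = z (?V + edge_vec j) - z ?V"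
      proof eventually_elim
        case (elim y)
        let ?I = "{k \<in> lines_at (\<gamma> s0). height k (\<gamma> y) > height k (\<gamma> s0)}"
        have "K k (\<gamma> y) = K k (\<gamma> s0) + of_bool (k \<in> ?I)" if "k < r" for k
          using elim[rule_format, OF that] by (cases "k \<in> lines_at (\<gamma> s0)") auto
        then have V: "vertex_at (\<gamma> y) = ?V + (\<Sum>k\<in>?I. edge_vec k)"
          using lines_at_less by (intro vertex_at_shift) auto
        have jI: "j \<notin> ?I"
          using hj[of y] by simp
        show ?case
        proof (cases "?I = {}")
          case True
          have "vertex_at (\<gamma> y) = ?V"
            unfolding V True by simp
          then show ?thesis
            by (simp add: g_def)
        next
          case False
          then obtain i where i: "i \<in> ?I"
            by blast
          then have ij: "i \<noteq> j"
            using jI by auto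
          then have l: "lines_at (\<gamma> s0) = {i, j}"
            using i jin by (cases "\<gamma> s0" rule: lines_at_cases) auto
          then have I: "?I = {i}"
            using i jI by auto
          have "vertex_at (\<gamma> y) = ?V + edge_vec i"
            unfolding V I by simp
          then show ?thesis
            unfolding g_def using flex_jump_across_tile[OF z ij l] by simp
        qed
      qed
      then show ?thesis
        by (intro exI[of _ "z (?V + edge_vec j) - z ?V"]) (auto elim: eventually_mono)
    qed
  qed (use st in \<open>auto simp: \<gamma>_def\<close>)
  then show ?thesis
    by (simp add: g_def \<gamma>_def)
qed

text \<open>Every grid line leaves the strip in which the flex lives, so all its jumps vanish.\<close>

lemma confined_flex_eq_0:
  assumes z: "infinitesimal_flex (tiling_framework P) z" and "v \<noteq> 0"
    and transv: "\<And>j. j < r \<Longrightarrow> v \<bullet> ribbon_direction j \<noteq> 0"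
    and conf: "\<And>x. \<bar>v \<bullet> vertex_at x\<bar> > D \<Longrightarrow> z (vertex_at x) = 0"
  shows "z (vertex_at x) = 0"
proof -
  obtain B where B: "B \<ge> 0" "\<And>x. norm (vertex_at x - dual_map x) \<le> B"
    using vertex_approx by blast
  have approx: "\<bar>v \<bullet> vertex_at x - v \<bullet> dual_map x\<bar> \<le> norm v * B" for x
    using Cauchy_Schwarz_ineq2[of v "vertex_at x - dual_map x"] mult_left_mono[OF B(2)[of x], of "norm v"]
    by (simp add: inner_diff_right)
  have jump: "z (vertex_at q + edge_vec j) = z (vertex_at q)" if q: "lines_at q = {j}" for q j
  proof -
    have j: "j < r" "j \<in> lines_at q"
      using q lines_at_less by auto
    let ?g = "\<lambda>s. q + s *\<^sub>R perp (n j)"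
    let ?a = "v \<bullet> dual_map q" and ?b = "v \<bullet> ribbon_direction j"
    let ?C = "D + norm v * B + \<bar>v \<bullet> edge_vec j\<bar>"
    \<comment> \<open>Along the line, \<open>v\<close> composed with \<open>dual_map\<close> grows
      with slope \<open>?b\<close>. Beyond \<open>s0\<close> it exceeds \<open>D\<close> by enough
      to absorb the approximation error and to place both ends of the dual edge outside the
      strip.\<close>
    define s0 where "s0 = (\<bar>?C\<bar> + \<bar>?a\<bar>) / \<bar>?b\<bar>"
    have b: "?b \<noteq> 0"
      using transv j by auto
    have far: "\<bar>v \<bullet> vertex_at (?g s)\<bar> > D + \<bar>v \<bullet> edge_vec j\<bar>" if s: "s > s0" for s
    proof -
      have "s * \<bar>?b\<bar> > \<bar>?C\<bar> + \<bar>?a\<bar>"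
        using s b by (simp add: s0_def field_simps)
      then have 1: "\<bar>s * ?b\<bar> > \<bar>?C\<bar> + \<bar>?a\<bar>"
        by (simp add: abs_mult) (smt (verit) mult_right_mono abs_ge_zero)
      have 2: "v \<bullet> dual_map (?g s) = ?a + s * ?b"
        by (simp add: ribbon_direction_def linear_add[OF linear_dual_map]
            linear_scale[OF linear_dual_map] inner_add_right)
      show ?thesis
        using 1 approx[of "?g s"] unfolding 2 by linarith
    qed
    have "\<exists>\<^sub>F s in nhds (s0 + 1). lines_at (?g s) = {j} \<and> s > s0"
      using frequently_only_line[OF j] eventually_nhds_in_open[of "{s0<..}" "s0 + 1"]
      by (auto intro: frequently_eventually_frequently)
    then obtain s where s: "lines_at (?g s) = {j}" "s > s0"
      using frequently_ex by blast
    obtain x where x: "vertex_at x = vertex_at (?g s) + edge_vec j"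
      by (rule vertex_at_add_edge[of j "?g s"]) (use s in auto)
    have "z (vertex_at (?g s)) = 0"
      using far[OF s(2)] by (intro conf) auto
    moreover have "z (vertex_at (?g s) + edge_vec j) = 0"
      unfolding x[symmetric] using far[OF s(2)] by (intro conf) (simp add: x inner_add_right)
    ultimately have "z (vertex_at (?g 0) + edge_vec j) - z (vertex_at (?g 0)) = 0"
      using flex_jump_along_line[OF z j, of 0 s] s q by simp
    then show ?thesis
      by simp
  qed
  \<comment> \<open>With all jumps zero, \<open>z\<close> takes a single value on all joints whose
    cells touch \<open>q\<close>; this is local constancy for the connectedness argument over the
    plane.\<close>
  have sub: "z (vertex_at q + (\<Sum>k\<in>I. edge_vec k)) = z (vertex_at q)" if I: "I \<subseteq> lines_at q" for q I
  proof (rule lines_at_cases[of q])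
    assume "lines_at q = {}"
    then show ?thesis
      using I by simp
  next
    fix j
    assume q: "lines_at q = {j}"
    then have "I = {} \<or> I = {j}"
      using I by auto
    then show ?thesis
      using jump[OF q] by auto
  next
    fix i j
    assume ij: "i \<noteq> j" "lines_at q = {i, j}"
    have single: "z (vertex_at q + (if c then edge_vec a else 0) + edge_vec b) = z (vertex_at q + (if c then edge_vec a else 0))"
      if "a \<noteq> b" "lines_at q = {a, b}" for a b c
    proof -
      obtain q' where "lines_at q' = {b}" "vertex_at q' = vertex_at q + (if c then edge_vec a else 0)"
        using edge_point_at_crossing[of a b q c] \<open>a \<noteq> b\<close> \<open>lines_at q = {a, b}\<close> by blast
      then show ?thesis
        using jump by metis
    qed
    have ji: "j \<noteq> i" "lines_at q = {j, i}"
      using ij by auto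
    have "I \<in> Pow {i, j}"
      using I ij by auto
    then have "I = {} \<or> I = {i} \<or> I = {j} \<or> I = {i, j}"
      by auto
    then show ?thesis
      using single[OF ij, of True] single[OF ij, of False] single[OF ji, of False] ij(1)
      by (auto simp: add.assoc)
  qed
  \<comment> \<open>A point whose vertex lies outside the strip even after the approximation error;
    it fixes the constant value of \<open>z\<close> as zero.\<close>
  obtain q0 where q0: "dual_map q0 = ((\<bar>D\<bar> + norm v * B + 1) / (v \<bullet> v)) *\<^sub>R v"
    using surj_dual_map by (metis surjD)
  have "v \<bullet> dual_map q0 = \<bar>D\<bar> + norm v * B + 1"
    using \<open>v \<noteq> 0\<close> by (simp add: q0)
  then have "z (vertex_at q0) = 0"
    using approx[of q0] by (intro conf) linarith
  moreover have generic: "\<exists>y. lines_at y = {} \<and> vertex_at y = vertex_at x" for x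
    using vertex_at_add[of "{}" x] by (metis add.right_neutral empty_subsetI sum.empty)
  then obtain y0 y where y: "lines_at y0 = {}" "vertex_at y0 = vertex_at q0" "lines_at y = {}" "vertex_at y = vertex_at x"
    by meson
  moreover have "z (vertex_at y) = z (vertex_at y0)"
  proof (rule densely_locally_constant_imp_constant[where X = "{x. lines_at x = {}}"
        and g = "\<lambda>x. z (vertex_at x)"])
    show "connected (UNIV :: (real^2) set)"
      by (intro convex_connected convex_UNIV)
    show "\<exists>\<^sub>F y in nhds q. y \<in> {x. lines_at x = {}}" for q
      using frequently_generic[of q] by simp
    show "\<exists>c. \<forall>\<^sub>F y in nhds q. y \<in> {x. lines_at x = {}} \<longrightarrow> z (vertex_at y) = c" for q
    proof -
      have "\<forall>\<^sub>F y in nhds q. z (vertex_at y) = z (vertex_at q)"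
        using eventually_nhds_K_all[of q]
      proof eventually_elim
        case (elim y)
        let ?I = "{k \<in> lines_at q. height k y > height k q}"
        have "K k y = K k q + of_bool (k \<in> ?I)" if "k < r" for k
          using elim[rule_format, OF that] by (cases "k \<in> lines_at q") auto
        then have "vertex_at y = vertex_at q + (\<Sum>k\<in>?I. edge_vec k)"
          using lines_at_less by (intro vertex_at_shift) auto
        then show ?case
          using sub[of ?I q] by simp
      qed
      then show ?thesis
        by (intro exI[of _ "z (vertex_at q)"]) (auto elim: eventually_mono)
    qed
  qed (use y in auto)
  ultimately show ?thesis
    by simp
qed

subsection \<open>The slippage figure\<close>

lemma periodic_slippage_line_imp:
  assumes "periodic_slippage_line (tiling_framework P) H"
  shows "\<exists>j<r. H = span {ribbon_direction j}"
proof (rule ccontr)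
  assume no: "\<not> (\<exists>j<r. H = span {ribbon_direction j})"
  obtain t1 t2 b where H: "H = span {t1}" and basis: "perp t1 \<bullet> t2 \<noteq> 0" and b: "b \<noteq> 0" and
    slip: "\<And>\<epsilon>. \<epsilon> > 0 \<Longrightarrow> \<exists>u. \<exists>m::nat. infinitesimal_flex (tiling_framework P) u \<and> m > 0 \<and>
         (\<forall>lam. norm lam = 1 \<longrightarrow>
            infinitesimal_flex (tiling_framework P) (modulation (banded_phase_field lam t1 (real m *\<^sub>R t2)) u)) \<and>
         (\<forall>lam. norm lam = 1 \<longrightarrow>
            mostly_close (joints (tiling_framework P)) \<epsilon>
              (modulation (banded_phase_field lam t1 (real m *\<^sub>R t2)) u)
              (modulation (banded_phase_field lam t1 (real m *\<^sub>R t2)) (constant_field b)))"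
    using assms unfolding periodic_slippage_line_def is_basis_iff_perp by blast
  have t1: "t1 \<noteq> 0"
    using basis by (auto simp: inner_real2)
  have transv: "perp t1 \<bullet> ribbon_direction j \<noteq> 0" if "j < r" for j
    using no that span_eq_of_perp[OF _ t1 ribbon_direction_nonzero[OF that]] H by blast
  define z0 where "z0 = constant_field b 0"
  have z0: "z0 \<noteq> 0" "\<And>x. constant_field b x = z0"
    using b complexify_eq_0_iff[of b] by (auto simp: z0_def constant_field_def)
  \<comment> \<open>Small enough that the zero field misses the constant field at every joint, and
    at most 1, so that then the strict count inequality fails.\<close>
  define \<epsilon> where "\<epsilon> = min 1 (norm z0 / 2)"
  have eps: "\<epsilon> > 0" "\<epsilon> \<le> 1" "\<epsilon> < norm z0"
    using z0(1) by (auto simp: \<epsilon>_def min_def)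
  obtain u m where u: "infinitesimal_flex (tiling_framework P) u" "m > (0::nat)"
    "\<And>lam. norm lam = 1 \<Longrightarrow>
      infinitesimal_flex (tiling_framework P) (modulation (banded_phase_field lam t1 (real m *\<^sub>R t2)) u)"
    "\<And>lam. norm lam = 1 \<Longrightarrow> mostly_close (tverts P) \<epsilon>
              (modulation (banded_phase_field lam t1 (real m *\<^sub>R t2)) u)
              (modulation (banded_phase_field lam t1 (real m *\<^sub>R t2)) (constant_field b))"
    using slip[OF eps(1)] unfolding joints_tiling by blast
  define t2' where "t2' = real m *\<^sub>R t2"
  have basis': "perp t1 \<bullet> t2' \<noteq> 0"
    using basis u(2) by (simp add: t2'_def)
  define \<beta> where "\<beta> x = \<lfloor>transverse t1 t2' x\<rfloor>" for x
  have phase: "banded_phase_field lam t1 (real m *\<^sub>R t2) = (\<lambda>x. lam powi \<beta> x)" for lam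
    using banded_phase_field_eq[OF basis'] by (auto simp: \<beta>_def t2'_def)
  have zero: "u (vertex_at x) = 0" for x
  proof -
    define k where "k = \<beta> (vertex_at x)"
    define z where "z p = (if \<beta> p = k then u p else 0)" for p
    have "z (vertex_at x) = 0"
    proof (rule confined_flex_eq_0)
      show "infinitesimal_flex (tiling_framework P) z"
        unfolding z_def using u(3) by (intro flex_restrict_band[OF u(1)]) (simp add: phase)
      show "perp t1 \<noteq> 0"
        using t1 by simp
      \<comment> \<open>In band \<open>k\<close> the transverse coordinate is at most
        \<open>\<bar>k\<bar> + 1\<close> in absolute value; multiplying by
        \<open>\<bar>perp t1 \<bullet> t2'\<bar>\<close> removes the denominator of
        \<open>transverse\<close>.\<close>
      show "z (vertex_at y) = 0" if y: "\<bar>perp t1 \<bullet> vertex_at y\<bar> > (\<bar>of_int k\<bar> + 1) * \<bar>perp t1 \<bullet> t2'\<bar>" for y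
      proof -
        have "\<bar>transverse t1 t2' (vertex_at y)\<bar> > \<bar>of_int k\<bar> + 1"
          using y basis' by (simp add: transverse_def field_simps)
        then have "\<beta> (vertex_at y) \<noteq> k"
          unfolding \<beta>_def by linarith
        then show ?thesis
          by (simp add: z_def)
      qed
    qed (use transv in auto)
    then show ?thesis
      by (simp add: z_def k_def)
  qed
  have "mostly_close (tverts P) \<epsilon> (modulation (\<lambda>x. 1) u) (modulation (\<lambda>x. 1) (constant_field b))"
    using u(4)[of 1] unfolding phase by simp
  then obtain N :: nat where "real (card {x \<in> tverts P \<inter> box_at 0 N. norm (modulation (\<lambda>x. 1) u x - modulation (\<lambda>x. 1) (constant_field b) x) > \<epsilon>})
      < \<epsilon> * real (card (tverts P \<inter> box_at 0 N))"
    unfolding mostly_close_def Let_def box_at_def by blast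
  moreover have "{x \<in> tverts P \<inter> box_at 0 N. norm (modulation (\<lambda>x. 1) u x - modulation (\<lambda>x. 1) (constant_field b) x) > \<epsilon>} =
      tverts P \<inter> box_at 0 N"
  proof -
    have "norm (modulation (\<lambda>x. 1) u x - modulation (\<lambda>x. 1) (constant_field b) x) > \<epsilon>" if x: "x \<in> tverts P" for x
    proof -
      obtain y where "x = vertex_at y"
        using x unfolding tverts_eq by blast
      then show ?thesis
        using eps(3) by (simp add: modulation_def zero z0(2))
    qed
    then show ?thesis
      by auto
  qed
  ultimately have "real (card (tverts P \<inter> box_at 0 N)) < \<epsilon> * real (card (tverts P \<inter> box_at 0 N))"
    by simp
  moreover have "\<epsilon> * real (card (tverts P \<inter> box_at 0 N)) \<le> 1 * real (card (tverts P \<inter> box_at 0 N))"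
    using eps by (intro mult_right_mono) auto
  ultimately show False
    by simp
qed

text \<open>An edge of family \<open>j\<close> is orthogonal to the velocity, and on any other edge
  \<open>K j\<close> does not change. As \<open>g\<close> is arbitrary, this covers a field and its
  modulations alike.\<close>

lemma flex_of_joint_index:
  assumes j: "j < r" and u: "\<And>x. u (vertex_at x) = g (K j x) *s (\<chi> i. complex_of_real (perp (n j) $ i))"
  shows "infinitesimal_flex (tiling_framework P) u"
  unfolding infinitesimal_flex_tiling_iff
proof (intro allI impI)
  fix v w
  assume "{v, w} \<in> tedges P"
  then obtain q k where q: "lines_at q = {k}" "{v, w} = {vertex_at q, vertex_at q + edge_vec k}"
    using tedges_cases by blast
  let ?b = "(\<chi> i. complex_of_real (perp (n j) $ i)) :: complex^2"
  obtain x where x: "vertex_at x = vertex_at q + edge_vec k" "\<And>i. i < r \<Longrightarrow> K i x = K i q + of_bool (i = k)"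
    by (rule vertex_at_add_edge[of k q]) (use q in auto)
  have "cdot (u (vertex_at x) - u (vertex_at q)) (edge_vec k) = 0"
  proof (cases "k = j")
    case True
    have "cdot ?b (edge_vec j) = 0"
      by (simp add: cdot_eq edge_vec_def algebra_simps)
    then show ?thesis
      unfolding u True by (simp add: cdot_diff_left cdot_scale_left)
  next
    case False
    then show ?thesis
      using x(2)[OF j] by (simp add: u cdot_zero_left)
  qed
  then have *: "cdot (u (vertex_at q + edge_vec k) - u (vertex_at q)) (edge_vec k) = 0"
    by (simp add: x(1))
  consider "v = vertex_at q" "w = vertex_at q + edge_vec k" | "w = vertex_at q" "v = vertex_at q + edge_vec k"
    using q(2) by (auto simp: doubleton_eq_iff)
  then show "cdot (u v - u w) (v - w) = 0"
    using * by cases (auto simp: cdot_diff_left cdot_minus_right)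
qed

section \<open>Bands adapted to one component grid\<close>

lemma dual_map_coordinates:
  assumes j: "j < r"
  shows "dual_map x = (x \<bullet> perp (n j)) *\<^sub>R ribbon_direction j +
    (x \<bullet> n j / spacing M j) *\<^sub>R dual_map (spacing M j *\<^sub>R n j)"
proof -
  have "(n j \<bullet> n j) *\<^sub>R x = (x \<bullet> perp (n j)) *\<^sub>R perp (n j) + (x \<bullet> n j) *\<^sub>R n j"
    by (simp add: eq_real2_iff inner_real2 algebra_simps)
  then have "x = (x \<bullet> perp (n j)) *\<^sub>R perp (n j) + (x \<bullet> n j) *\<^sub>R n j"
    using j by simp
  then have "dual_map x = dual_map ((x \<bullet> perp (n j)) *\<^sub>R perp (n j) + (x \<bullet> n j) *\<^sub>R n j)"
    by simp
  then show ?thesis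
    using j by (simp add: ribbon_direction_def linear_add[OF linear_dual_map] linear_scale[OF linear_dual_map])
qed

lemma perp_ribbon_direction:
  assumes j: "j < r"
  shows "perp (ribbon_direction j) \<bullet> dual_map (spacing M j *\<^sub>R n j) \<noteq> 0"
proof
  assume "perp (ribbon_direction j) \<bullet> dual_map (spacing M j *\<^sub>R n j) = 0"
  then obtain c where "dual_map (spacing M j *\<^sub>R n j) = c *\<^sub>R ribbon_direction j"
    using perp_eq_0_imp_parallel[OF _ ribbon_direction_nonzero[OF j]] by blast
  also have "\<dots> = dual_map (c *\<^sub>R perp (n j))"
    by (simp add: ribbon_direction_def linear_scale[OF linear_dual_map])
  finally have "spacing M j *\<^sub>R n j = c *\<^sub>R perp (n j)"
    using inj_dual_map by (simp add: inj_eq)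
  then have "(spacing M j *\<^sub>R n j) \<bullet> n j = (c *\<^sub>R perp (n j)) \<bullet> n j"
    by simp
  then show False
    using j by simp
qed

text \<open>The second basis vector is the image of one grid spacing along the normal. This makes
  the second coordinate of \<open>dual_map x\<close> equal to
  \<open>x \<bullet> n j / spacing M j\<close>, so passing one grid line costs one unit, up to a
  bounded error.\<close>

lemma transverse_vertex_at:
  assumes j: "j < r"
  obtains C :: nat where
    "\<And>x. \<bar>transverse (ribbon_direction j) (dual_map (spacing M j *\<^sub>R n j)) (vertex_at x) - of_int (K j x)\<bar> \<le> real C"
proof -
  let ?t1 = "ribbon_direction j" and ?t2 = "dual_map (spacing M j *\<^sub>R n j)"
  obtain B where B: "\<And>x. norm (vertex_at x - dual_map x) \<le> B"
    using vertex_approx by blast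
  obtain B' where B': "\<And>x. \<bar>of_int (K j x) - x \<bullet> n j / spacing M j\<bar> \<le> B'"
    using K_approx j by metis
  obtain L where L: "L \<ge> 0" "\<And>x. \<bar>transverse ?t1 ?t2 x\<bar> \<le> L * norm x"
    using transverse_bound by blast
  obtain C :: nat where C: "L * B + B' \<le> real C"
    using real_arch_simple by blast
  have "\<bar>transverse ?t1 ?t2 (vertex_at x) - of_int (K j x)\<bar> \<le> real C" for x
  proof -
    have "transverse ?t1 ?t2 (dual_map x) = x \<bullet> n j / spacing M j"
      unfolding transverse_def using perp_ribbon_direction[OF j]
      by (subst dual_map_coordinates[OF j]) (simp add: inner_add_right)
    moreover have "\<bar>transverse ?t1 ?t2 (vertex_at x) - transverse ?t1 ?t2 (dual_map x)\<bar> \<le> L * B"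
      unfolding transverse_diff using L(2)[of "vertex_at x - dual_map x"] mult_left_mono[OF B L(1), of x] by linarith
    ultimately show ?thesis
      using B'[of x] C by linarith
  qed
  then show ?thesis
    using that by blast
qed

lemma periodic_slippage_line_ribbon_direction:
  assumes j: "j < r"
  shows "periodic_slippage_line (tiling_framework P) (span {ribbon_direction j})"
proof -
  define t1 where "t1 = ribbon_direction j"
  define t2 where "t2 = dual_map (spacing M j *\<^sub>R n j)"
  define b where "b = perp (n j)"
  define bc where "bc = ((\<chi> i. complex_of_real (b $ i)) :: complex^2)"
  have basis: "perp t1 \<bullet> t2 \<noteq> 0"
    using perp_ribbon_direction[OF j] by (simp add: t1_def t2_def)
  obtain C :: nat where C: "\<And>x. \<bar>transverse t1 t2 (vertex_at x) - of_int (K j x)\<bar> \<le> real C"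
    using transverse_vertex_at[OF j] unfolding t1_def t2_def by blast
  obtain \<rho> where \<rho>: "\<rho> > 0" "\<And>x y. vertex_at x \<noteq> vertex_at y \<Longrightarrow> \<rho> \<le> dist (vertex_at x) (vertex_at y)"
    using vertex_at_separated by blast
  have sep: "\<rho> \<le> dist p q" if "p \<in> tverts P" "q \<in> tverts P" "p \<noteq> q" for p q
    using \<rho>(2) that unfolding tverts_eq by blast
  obtain R where R: "\<And>z. \<exists>x. dist z (vertex_at x) \<le> R"
    using vertex_at_dense by blast
  have close: "\<bar>transverse t1 t2 p - of_int (joint_index j p)\<bar> \<le> real C" if "p \<in> tverts P" for p
    using that C joint_index_vertex_at[OF j] unfolding tverts_eq by auto
  obtain c1 c2 :: real where c12: "c1 \<ge> 0" "c2 \<ge> 0" and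
    count: "\<And>m N c. m > 0 \<Longrightarrow> N \<ge> 1 \<Longrightarrow>
      finite {p \<in> tverts P \<inter> box_at c N. joint_index j p mod int m < int C \<or> joint_index j p mod int m \<ge> int m - int C} \<and>
      real (card {p \<in> tverts P \<inter> box_at c N. joint_index j p mod int m < int C \<or> joint_index j p mod int m \<ge> int m - int C})
        \<le> (c1 * N / m + 2) * c2 * N"
    using card_near_band_boundaries[OF basis \<rho>(1) sep close] by blast
  have dense: "\<exists>p\<in>tverts P. dist z p \<le> R" for z
    using R[of z] unfolding tverts_eq by blast
  obtain c3 :: real and N1 :: nat where c3: "c3 > 0"
    "\<And>N c. N \<ge> N1 \<Longrightarrow> real (card (tverts P \<inter> box_at c N)) \<ge> c3 * real N ^ 2"
    using card_dense_box[OF dense finite_separated_box[OF \<rho>(1) sep]] by blast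
  have main: "\<exists>u. \<exists>m::nat. infinitesimal_flex (tiling_framework P) u \<and> m > 0 \<and>
         (\<forall>lam. norm lam = 1 \<longrightarrow>
            infinitesimal_flex (tiling_framework P) (modulation (banded_phase_field lam t1 (real m *\<^sub>R t2)) u)) \<and>
         (\<forall>lam. norm lam = 1 \<longrightarrow>
            mostly_close (joints (tiling_framework P)) \<epsilon>
              (modulation (banded_phase_field lam t1 (real m *\<^sub>R t2)) u)
              (modulation (banded_phase_field lam t1 (real m *\<^sub>R t2)) (constant_field b)))"
    if eps: "\<epsilon> > 0" for \<epsilon>
  proof -
    \<comment> \<open>The count of bad joints has a quadratic term with coefficient
      \<open>c1 * c2 / m\<close> and a linear term \<open>2 * c2 * N\<close>, against at least
      \<open>c3 * N ^ 2\<close> joints. A large \<open>m\<close> makes the quadratic term less than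
      half of the permitted amount.\<close>
    obtain m0 :: nat where m0: "real m0 > 2 * c1 * c2 / (\<epsilon> * c3)"
      using reals_Archimedean2 by blast
    define m where "m = Suc m0"
    have m: "m > 0" "c1 * c2 / m < \<epsilon> * c3 / 2"
    proof -
      show "m > 0"
        by (simp add: m_def)
      have "real m > 2 * c1 * c2 / (\<epsilon> * c3)"
        using m0 by (simp add: m_def)
      then show "c1 * c2 / m < \<epsilon> * c3 / 2"
        using eps c3(1) \<open>m > 0\<close> by (simp add: field_simps)
    qed
    \<comment> \<open>Indices that keep a distance from both ends of their block of length
      \<open>m\<close>, large enough for the error \<open>C\<close>.\<close>
    define good where "good k \<longleftrightarrow> \<not> (k mod int m < int C \<or> k mod int m \<ge> int m - int C)" for k
    define u where "u p = (if good (joint_index j p) then 1 else 0) *s bc" for p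
    have phase: "banded_phase_field lam t1 (real m *\<^sub>R t2) = (\<lambda>x. lam powi \<lfloor>transverse t1 t2 x / m\<rfloor>)" for lam
      using banded_phase_field_eq[of t1 "real m *\<^sub>R t2" lam] basis m(1)
      by (auto simp: transverse_scale_right)
    \<comment> \<open>Hence the phase depends on the index alone wherever \<open>u\<close> is
      nonzero, and the modulated field is again of the form \<open>g (K j x)\<close> times a fixed
      vector.\<close>
    have band: "\<lfloor>transverse t1 t2 (vertex_at x) / m\<rfloor> = K j x div int m" if g: "good (K j x)" for x
    proof -
      let ?k = "K j x" and ?s = "transverse t1 t2 (vertex_at x)"
      have k: "?k = int m * (?k div int m) + ?k mod int m"
        by simp
      have g': "?k mod int m \<ge> int C" "?k mod int m + int C < int m"
        using g by (auto simp: good_def)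
      have "int m * (?k div int m) \<le> ?k - int C" "?k + int C < int m * (?k div int m) + int m"
        using k g' by linarith+
      then have "real_of_int (int m * (?k div int m)) \<le> of_int (?k - int C)"
        "real_of_int (?k + int C) < of_int (int m * (?k div int m) + int m)"
        by (simp_all only: of_int_le_iff of_int_less_iff)
      then have "real m * of_int (?k div int m) \<le> ?s" "?s < real m * of_int (?k div int m) + real m"
        using C[of x] by simp_all
      then show ?thesis
        using m(1) by (intro floor_unique) (simp_all add: field_simps)
    qed
    have flex_u: "infinitesimal_flex (tiling_framework P) u"
      by (rule flex_of_joint_index[OF j, of _ "\<lambda>k. if good k then 1 else 0"])
        (simp add: u_def joint_index_vertex_at[OF j] bc_def b_def)
    have flex_mod: "infinitesimal_flex (tiling_framework P) (modulation (banded_phase_field lam t1 (real m *\<^sub>R t2)) u)" for lam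
    proof (rule flex_of_joint_index[OF j, of _ "\<lambda>k. if good k then lam powi (k div int m) else 0"])
      fix x
      show "modulation (banded_phase_field lam t1 (real m *\<^sub>R t2)) u (vertex_at x) =
        (if good (K j x) then lam powi (K j x div int m) else 0) *s (\<chi> i. complex_of_real (perp (n j) $ i))"
        using band[of x] by (simp add: modulation_def phase u_def joint_index_vertex_at[OF j] bc_def b_def)
    qed
    have close: "mostly_close (tverts P) \<epsilon>
        (modulation (banded_phase_field lam t1 (real m *\<^sub>R t2)) u)
        (modulation (banded_phase_field lam t1 (real m *\<^sub>R t2)) (constant_field b))" for lam
    proof -
      \<comment> \<open>From this size on, the linear term takes at most the other half.\<close>
      obtain N2 :: nat where N2: "real N2 > 4 * c2 / (\<epsilon> * c3)"
        using reals_Archimedean2 by blast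
      have "real (card {x \<in> tverts P \<inter> box_at c N. norm (modulation (banded_phase_field lam t1 (real m *\<^sub>R t2)) u x -
          modulation (banded_phase_field lam t1 (real m *\<^sub>R t2)) (constant_field b) x) > \<epsilon>})
          < \<epsilon> * real (card (tverts P \<inter> box_at c N))" (is "real (card ?X) < _") if N: "N \<ge> Suc (N1 + N2)" for N c
      proof -
        let ?Y = "{p \<in> tverts P \<inter> box_at c N. joint_index j p mod int m < int C \<or> joint_index j p mod int m \<ge> int m - int C}"
        have cY: "finite ?Y" "real (card ?Y) \<le> (c1 * N / m + 2) * c2 * N"
          using count[OF m(1), of N c] N by auto
        have "?X \<subseteq> ?Y"
        proof
          fix x
          assume x: "x \<in> ?X"
          have "\<not> good (joint_index j x)"
          proof
            assume "good (joint_index j x)"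
            then have "u x = constant_field b x"
              by (simp add: u_def constant_field_def bc_def)
            then show False
              using x eps by (simp add: modulation_def)
          qed
          then show "x \<in> ?Y"
            using x by (simp add: good_def)
        qed
        then have "real (card ?X) \<le> real (card ?Y)"
          using card_mono[OF cY(1)] by simp
        also have "\<dots> \<le> (c1 * N / m + 2) * c2 * N"
          by (rule cY(2))
        also have "\<dots> = (c1 * c2 / m) * N ^ 2 + 2 * c2 * N"
          by (simp add: power2_eq_square algebra_simps)
        also have "\<dots> < (\<epsilon> * c3 / 2) * N ^ 2 + (\<epsilon> * c3 / 2) * N ^ 2"
        proof (rule add_less_le_mono)
          have N0: "real N > 0"
            using N by simp
          show "(c1 * c2 / m) * N ^ 2 < (\<epsilon> * c3 / 2) * N ^ 2"
            using m(2) N0 by (intro mult_strict_right_mono) auto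
          have "real N > 4 * c2 / (\<epsilon> * c3)"
            using N2 N by linarith
          then have "2 * c2 \<le> (\<epsilon> * c3 / 2) * N"
            using eps c3(1) by (simp add: field_simps)
          then show "2 * c2 * N \<le> (\<epsilon> * c3 / 2) * N ^ 2"
            using mult_right_mono[of "2 * c2" "(\<epsilon> * c3 / 2) * N" "real N"] by (simp add: power2_eq_square mult.assoc)
        qed
        also have "\<dots> = \<epsilon> * (c3 * real N ^ 2)"
          by (simp add: field_simps)
        also have "\<dots> \<le> \<epsilon> * real (card (tverts P \<inter> box_at c N))"
          using c3(2)[of N c] N eps by (intro mult_left_mono) auto
        finally show ?thesis .
      qed
      then show ?thesis
        unfolding mostly_close_def Let_def box_at_def by blast
    qed
    show ?thesis
      using flex_u flex_mod close m(1) unfolding joints_tiling by blast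
  qed
  have "b \<noteq> 0"
    using j by (simp add: b_def)
  then show ?thesis
    unfolding periodic_slippage_line_def is_basis_iff_perp t1_def[symmetric]
    using delone_framework_dual basis main by blast
qed

lemma periodic_slippage_figure_eq:
  "periodic_slippage_figure (tiling_framework P) = (\<Union>j<r. span {ribbon_direction j})"
proof -
  have "periodic_slippage_line (tiling_framework P) H \<longleftrightarrow> (\<exists>j<r. H = span {ribbon_direction j})" for H
    using periodic_slippage_line_imp periodic_slippage_line_ribbon_direction by blast
  then show ?thesis
    by (auto simp: periodic_slippage_figure_def)
qed

end

theorem theorem4p10:
  fixes P :: tiling and a1 a2 :: "real^2"
  assumes "regular_multigrid_tiling P" and "is_basis a1 a2"
  shows "reduced_slippage_spectrum (tiling_framework P) a1 a2 =
         reduce_mod_Z2 (reciprocal_figure a1 a2 (ribbon_figure P))"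
proof -
  obtain M l where P: "regular_multigrid M" "\<forall>j<num_grids M. l j > 0" "P = dual_tiling M l"
    using assms(1) unfolding regular_multigrid_tiling_def by blast
  interpret multigrid_dual M l
    using P by unfold_locales auto
  \<comment> \<open>The figures agree as sets of points already before the reciprocal figure is
    formed and reduced.\<close>
  have "periodic_slippage_figure (tiling_framework P) = ribbon_figure P"
    unfolding P(3) periodic_slippage_figure_eq ribbon_figure_eq ..
  then show ?thesis
    by (simp add: reduced_slippage_spectrum_def slippage_spectrum_def)
qed

end
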